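(* Let $n\ge 1$ and let $u:S^1\to\mathbb{R}$ be a $C^{2n}$-function, where $S^1=\mathbb{R}/2\pi\mathbb{Z}$. Then $u$ has at least $n+1$ clean maximal flexes of order $2n+1$ and at least $n+1$ clean minimal flexes of order $2n+1$.
   Context: Let $A_{2n+1}$ be the $(2n+1)$-dimensional space of trigonometric polynomials $\varphi(t)=a_0+\sum_{k=1}^n(a_k\cos kt+b_k\sin kt)$ with real coefficients. For a $C^{2n}$-function $u:S^1\to\mathbb{R}$ and $s\in S^1$, the osculating polynomial $\varphi_s$ (of order $2n+1$) of $u$ at $s$ is the unique element of $A_{2n+1}$ whose value and first $2n$ derivatives at $s$ coincide with those of $u$ at $s$. A point $s\in S^1$ is a clean maximal flex (resp. clean minimal flex) of $u$ of order $2n+1$ if $\varphi_s\ge u$ (resp. $\varphi_s\le u$) on all of $S^1$ and the set $(\varphi_s-u)^{-1}(0)\subset S^1$ is connected. *)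

theory Defs
  imports "HOL-Analysis.Analysis"
begin

text \<open>
  The circle is $\mathbb{R}/2\pi\mathbb{Z}$. Functions on it are $2\pi$-periodic functions on the
  reals, and its points are represented by reals modulo $2\pi$. A subset of the circle, given by a
  $2\pi$-periodic set of reals, has the topology of its image in the unit circle of the complex
  plane under \<^term>\<open>cis\<close>, which induces a homeomorphism from $\mathbb{R}/2\pi\mathbb{Z}$ onto
  that unit circle.
\<close>

definition periodic_2pi :: "(real \<Rightarrow> real) \<Rightarrow> bool" where
  "periodic_2pi u \<longleftrightarrow> (\<forall>t. u (t + 2 * pi) = u t)"

definition cont_diff :: "nat \<Rightarrow> (real \<Rightarrow> real) \<Rightarrow> bool" where
  "cont_diff k f \<longleftrightarrow>
     (\<forall>j<k. \<forall>x. (deriv ^^ j) f differentiable (at x)) \<and> continuous_on UNIV ((deriv ^^ k) f)"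

text \<open>The space $A_{2n+1}$; its index here is \<^term>\<open>n\<close>, not the dimension $2n+1$.\<close>

definition trig_polys :: "nat \<Rightarrow> (real \<Rightarrow> real) set" where
  "trig_polys n =
     {\<lambda>t. a 0 + (\<Sum>k=1..n. a k * cos (real k * t) + b k * sin (real k * t)) |
        (a :: nat \<Rightarrow> real) (b :: nat \<Rightarrow> real). True}"

text \<open>
  For \<^term>\<open>u\<close> of class $C^{2n}$ there is exactly one such element, since an element of
  $A_{2n+1}$ that vanishes at \<^term>\<open>s\<close> with its first $2n$ derivatives is zero.
\<close>

definition osculating_poly :: "nat \<Rightarrow> (real \<Rightarrow> real) \<Rightarrow> real \<Rightarrow> real \<Rightarrow> real" where
  "osculating_poly n u s =
     (THE \<phi>. \<phi> \<in> trig_polys n \<and> (\<forall>j\<le>2 * n. (deriv ^^ j) \<phi> s = (deriv ^^ j) u s))"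

definition circle_contact_set :: "nat \<Rightarrow> (real \<Rightarrow> real) \<Rightarrow> real \<Rightarrow> complex set" where
  "circle_contact_set n u s = cis ` {t. osculating_poly n u s t - u t = 0}"

definition clean_maximal_flex :: "nat \<Rightarrow> (real \<Rightarrow> real) \<Rightarrow> real \<Rightarrow> bool" where
  "clean_maximal_flex n u s \<longleftrightarrow>
     (\<forall>t. osculating_poly n u s t \<ge> u t) \<and> connected (circle_contact_set n u s)"

definition clean_minimal_flex :: "nat \<Rightarrow> (real \<Rightarrow> real) \<Rightarrow> real \<Rightarrow> bool" where
  "clean_minimal_flex n u s \<longleftrightarrow>
     (\<forall>t. osculating_poly n u s t \<le> u t) \<and> connected (circle_contact_set n u s)"

end

theory Submission
  imports Defs
begin

text \<open>
  A trigonometric polynomial \<open>\<phi> \<ge> u\<close> of degree \<open>n\<close> touches \<open>u\<close> in a multiset of points if \<open>\<phi> - u\<close> has a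
  double zero for each of them. A point \<open>s\<close> is a maximal flex if some \<open>\<phi>\<close> touches \<open>u\<close> there with
  multiplicity \<open>n + 1\<close>. Two facts carry the proof.

  Existence: for every \<open>n\<close> points there is a \<open>\<phi>\<close> that touches \<open>u\<close> in them and has one further contact. It is the
  lowest polynomial above \<open>u\<close> among those that agree with \<open>u\<close> to second order at these points.

  Comparison: if two such polynomials both touch in \<open>X\<close>, their difference is the product of
  \<open>1 - cos (t - x)\<close>, \<open>x \<in> X\<close>, and a factor of degree \<open>n - |X|\<close>, which is nonnegative at the further contacts of the lower term
  of the difference and nonpositive at those of the upper one. For \<open>|X| = n\<close> this gives uniqueness. For
  \<open>|X| = n - 1\<close> the factor has degree \<open>1\<close>, so its signs cannot alternate four times around the circle, and the
  remaining contacts of the two polynomials do not cross. In particular, if two contacts \<open>a\<close>, \<open>b\<close> are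
  replaced by two points, one of them an arbitrary non-contact \<open>m\<close> between \<open>a\<close> and \<open>b\<close>, then the other one also
  lies between \<open>a\<close> and \<open>b\<close>, and \<open>\<phi>\<close> increases on the complementary arc.

  Hence contacts can be driven together. Suppose that \<open>\<phi>\<close> has \<open>n + 1\<close> contacts in an arc, including both end points,
  and that \<open>\<phi> = u\<close> does not hold on the whole arc. A few exchanges move the contacts into the open arc and make
  \<open>\<phi> > u\<close> on the complementary arc. By compactness there is a polynomial of this kind whose value at a given point of the
  complementary arc is largest. No further exchange is possible for it, so its contacts form an
  interval: the open arc contains a clean flex, and the contact set stays inside.

  It remains to find \<open>n + 1\<close> such flexes, by induction on \<open>n\<close>. Polynomials that are required to touch \<open>u\<close> in
  a fixed multiset \<open>Z\<close> behave like those of degree \<open>n - |Z|\<close>, which replaces the passage to the quotient of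
  \<open>u\<close> by a weight. Take a clean flex \<open>p\<close>. The induction hypothesis with \<open>p\<close> added to \<open>Z\<close> yields \<open>n - 1\<close> points
  \<open>\<sigma> \<noteq> p\<close> with polynomials that touch \<open>u\<close> at \<open>p\<close>, and at \<open>\<sigma>\<close> with multiplicity \<open>n\<close>. Together with \<open>p\<close> they divide
  the circle into \<open>n\<close> arcs. For an arc that ends in \<open>p\<close> these polynomials have all their contacts at the end
  points. For an arc from \<open>\<sigma>\<close> to \<open>\<sigma>'\<close> the \<open>n\<close>-fold contact is moved gradually from \<open>\<sigma>\<close> to \<open>\<sigma>'\<close>;
  the last contact, which starts from \<open>p\<close>, moves in the opposite direction and has to enter the arc. So each
  of the \<open>n\<close> open arcs contains a clean flex, and \<open>p\<close> is another one.

  If \<open>u\<close> is itself a trigonometric polynomial of degree \<open>n\<close>, every point is a clean flex. The minimal flexes of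
  \<open>u\<close> are the maximal flexes of \<open>- u\<close>.
\<close>

section \<open>Trigonometric polynomials\<close>

lemma trig_polys_combine:
  assumes "f \<in> trig_polys m" "g \<in> trig_polys m"
  shows "(\<lambda>t. c * f t + d * g t) \<in> trig_polys m"
proof -
  obtain a b where f: "f = (\<lambda>t. a 0 + (\<Sum>k=1..m. a k * cos (real k * t) + b k * sin (real k * t)))"
    using assms(1) unfolding trig_polys_def by blast
  obtain a' b' where g: "g = (\<lambda>t. a' 0 + (\<Sum>k=1..m. a' k * cos (real k * t) + b' k * sin (real k * t)))"
    using assms(2) unfolding trig_polys_def by blast
  have "(\<lambda>t. c * f t + d * g t) = (\<lambda>t. (c * a 0 + d * a' 0) + (\<Sum>k=1..m. (c * a k + d * a' k) * cos (real k * t)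
      + (c * b k + d * b' k) * sin (real k * t)))"
    unfolding f g by (rule ext) (simp add: sum_distrib_left sum.distrib algebra_simps)
  then show ?thesis unfolding trig_polys_def
    by (intro CollectI exI[of _ "\<lambda>k. c * a k + d * a' k"] exI[of _ "\<lambda>k. c * b k + d * b' k"]) simp
qed

lemma trig_polys_add:
  "f \<in> trig_polys m \<Longrightarrow> g \<in> trig_polys m \<Longrightarrow> (\<lambda>t. f t + g t) \<in> trig_polys m"
  using trig_polys_combine[of f m g 1 1] by simp

lemma trig_polys_diff:
  "f \<in> trig_polys m \<Longrightarrow> g \<in> trig_polys m \<Longrightarrow> (\<lambda>t. f t - g t) \<in> trig_polys m"
  using trig_polys_combine[of f m g 1 "-1"] by simp

lemma trig_polys_scale: "f \<in> trig_polys m \<Longrightarrow> (\<lambda>t. c * f t) \<in> trig_polys m"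
  using trig_polys_combine[of f m f c 0] by simp

lemma trig_polys_0_iff: "f \<in> trig_polys 0 \<longleftrightarrow> (\<exists>c. f = (\<lambda>t. c))"
  unfolding trig_polys_def by (auto intro: exI[of _ "\<lambda>_. c" for c])

lemma trig_polys_mono:
  assumes "f \<in> trig_polys m" "m \<le> m'"
  shows "f \<in> trig_polys m'"
proof -
  obtain a b where f: "f = (\<lambda>t. a 0 + (\<Sum>k=1..m. a k * cos (real k * t) + b k * sin (real k * t)))"
    using assms(1) unfolding trig_polys_def by blast
  define a' where "a' = (\<lambda>k. if k \<le> m then a k else 0)"
  define b' where "b' = (\<lambda>k. if k \<le> m then b k else 0)"
  have "(\<Sum>k=1..m'. a' k * cos (real k * t) + b' k * sin (real k * t)) =
      (\<Sum>k=1..m. a k * cos (real k * t) + b k * sin (real k * t))" for t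
    by (rule sum.mono_neutral_cong_right) (use assms(2) in \<open>auto simp: a'_def b'_def\<close>)
  then have "f = (\<lambda>t. a' 0 + (\<Sum>k=1..m'. a' k * cos (real k * t) + b' k * sin (real k * t)))"
    unfolding f by (simp add: a'_def)
  then show ?thesis unfolding trig_polys_def by blast
qed

lemma trig_polys_const: "(\<lambda>t. c) \<in> trig_polys m"
  using trig_polys_mono[of "\<lambda>t. c" 0 m] by (auto simp: trig_polys_0_iff)

lemma trig_polys_cos: "k \<le> m \<Longrightarrow> (\<lambda>t. cos (real k * t)) \<in> trig_polys m"
proof (cases "k = 0")
  case True
  then show ?thesis using trig_polys_const[of 1] by simp
next
  case False
  assume "k \<le> m"
  then have "(\<lambda>t. cos (real k * t)) = (\<lambda>t. (if (0::nat) = k then 1 else 0) +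
      (\<Sum>i=1..m. (if i = k then 1 else 0) * cos (real i * t) + 0 * sin (real i * t)))"
    using False by (auto simp: if_distrib[of "\<lambda>x. x * _"] sum.delta cong: if_cong)
  then show ?thesis unfolding trig_polys_def
    by (intro CollectI exI[of _ "\<lambda>i. if i = k then 1 else 0"] exI[of _ "\<lambda>i. 0"]) auto
qed

lemma trig_polys_sin: "k \<le> m \<Longrightarrow> (\<lambda>t. sin (real k * t)) \<in> trig_polys m"
proof (cases "k = 0")
  case True
  then show ?thesis using trig_polys_const[of 0] by simp
next
  case False
  assume "k \<le> m"
  then have "(\<lambda>t. sin (real k * t)) = (\<lambda>t. 0 +
      (\<Sum>i=1..m. 0 * cos (real i * t) + (if i = k then 1 else 0) * sin (real i * t)))"
    using False by (auto simp: if_distrib[of "\<lambda>x. x * _"] sum.delta cong: if_cong)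
  then show ?thesis unfolding trig_polys_def
    by (intro CollectI exI[of _ "\<lambda>i. 0"] exI[of _ "\<lambda>i. if i = k then 1 else 0"]) auto
qed

lemma trig_polys_induct [consumes 1, case_names cos sin combine]:
  assumes f: "f \<in> trig_polys m"
    and c: "\<And>k. k \<le> m \<Longrightarrow> P (\<lambda>t. cos (real k * t))"
    and s: "\<And>k. k \<le> m \<Longrightarrow> P (\<lambda>t. sin (real k * t))"
    and comb: "\<And>f g c d. P f \<Longrightarrow> P g \<Longrightarrow> P (\<lambda>t. c * f t + d * g t)"
  shows "P f"
proof -
  obtain a b where f: "f = (\<lambda>t. a 0 + (\<Sum>k=1..m. a k * cos (real k * t) + b k * sin (real k * t)))"
    using f unfolding trig_polys_def by blast
  have "P (\<lambda>t. a 0 + (\<Sum>k=1..j. a k * cos (real k * t) + b k * sin (real k * t)))" if "j \<le> m" for j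
    using that
  proof (induction j)
    case 0
    show ?case using comb[OF c[of 0] c[of 0], of "a 0" 0] by simp
  next
    case (Suc j)
    have "P (\<lambda>t. 1 * (a 0 + (\<Sum>k=1..j. a k * cos (real k * t) + b k * sin (real k * t)))
       + 1 * (a (Suc j) * cos (real (Suc j) * t) + b (Suc j) * sin (real (Suc j) * t)))"
      by (rule comb, use Suc in simp, rule comb[OF c s]) (use Suc in auto)
    then show ?case by (simp add: algebra_simps)
  qed
  from this[of m] show ?thesis unfolding f by simp
qed

lemma trig_polys_times_cos_sin:
  assumes "f \<in> trig_polys m"
  shows "(\<lambda>t. cos t * f t) \<in> trig_polys (Suc m) \<and> (\<lambda>t. sin t * f t) \<in> trig_polys (Suc m)"
  using assms
proof (induction rule: trig_polys_induct)
  case (cos k)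
  show ?case
  proof (cases k)
    case 0
    then show ?thesis using trig_polys_cos[of 1 "Suc m"] trig_polys_sin[of 1 "Suc m"] by simp
  next
    case (Suc j)
    have k: "real (Suc k) * t = real k * t + t" "real j * t = real k * t - t" for t
      by (auto simp: Suc algebra_simps)
    have "(\<lambda>t. cos t * cos (real k * t)) =
        (\<lambda>t. (1/2) * cos (real (Suc k) * t) + (1/2) * cos (real j * t))"
      unfolding k by (rule ext) (simp only: cos_add cos_diff, simp add: field_simps)
    moreover have "(\<lambda>t. sin t * cos (real k * t)) =
        (\<lambda>t. (1/2) * sin (real (Suc k) * t) + (- 1/2) * sin (real j * t))"
      unfolding k by (rule ext) (simp only: sin_add sin_diff, simp add: field_simps)
    ultimately show ?thesis using cos Suc
      by (simp only:) (intro conjI trig_polys_combine trig_polys_cos trig_polys_sin, auto)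
  qed
next
  case (sin k)
  show ?case
  proof (cases k)
    case 0
    then show ?thesis by (simp add: trig_polys_const)
  next
    case (Suc j)
    have k: "real (Suc k) * t = real k * t + t" "real j * t = real k * t - t" for t
      by (auto simp: Suc algebra_simps)
    have "(\<lambda>t. cos t * sin (real k * t)) =
        (\<lambda>t. (1/2) * sin (real (Suc k) * t) + (1/2) * sin (real j * t))"
      unfolding k by (rule ext) (simp only: sin_add sin_diff, simp add: field_simps)
    moreover have "(\<lambda>t. sin t * sin (real k * t)) =
        (\<lambda>t. (- 1/2) * cos (real (Suc k) * t) + (1/2) * cos (real j * t))"
      unfolding k by (rule ext) (simp only: cos_add cos_diff, simp add: field_simps)
    ultimately show ?thesis using sin Suc
      by (simp only:) (intro conjI trig_polys_combine trig_polys_cos trig_polys_sin, auto)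
  qed
next
  case (combine f g c d)
  show ?case
    using trig_polys_combine[of "\<lambda>t. cos t * f t" "Suc m" "\<lambda>t. cos t * g t" c d]
      trig_polys_combine[of "\<lambda>t. sin t * f t" "Suc m" "\<lambda>t. sin t * g t" c d] combine
    by (simp add: algebra_simps)
qed

lemma trig_polys_times_shift:
  assumes "f \<in> trig_polys m"
  shows "(\<lambda>t. cos (t - x) * f t) \<in> trig_polys (Suc m)" "(\<lambda>t. sin (t - x) * f t) \<in> trig_polys (Suc m)"
    "(\<lambda>t. (1 - cos (t - x)) * f t) \<in> trig_polys (Suc m)"
proof -
  note cs = trig_polys_times_cos_sin[OF assms]
  show 1: "(\<lambda>t. cos (t - x) * f t) \<in> trig_polys (Suc m)"
    using trig_polys_combine[OF cs[THEN conjunct1] cs[THEN conjunct2], of "cos x" "sin x"]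
    by (simp add: cos_diff algebra_simps)
  show "(\<lambda>t. sin (t - x) * f t) \<in> trig_polys (Suc m)"
    using trig_polys_combine[OF cs[THEN conjunct2] cs[THEN conjunct1], of "cos x" "- sin x"]
    by (simp add: sin_diff algebra_simps)
  show "(\<lambda>t. (1 - cos (t - x)) * f t) \<in> trig_polys (Suc m)"
    using trig_polys_diff[OF trig_polys_mono[OF assms, of "Suc m"] 1] by (simp add: algebra_simps)
qed

lemma division_witness:
  assumes "g \<in> trig_polys m" "f = (\<lambda>t. \<alpha> + \<beta> * sin (t - s) + (1 - cos (t - s)) * g t)"
  shows "\<exists>\<alpha> \<beta>. \<exists>g\<in>trig_polys m. f = (\<lambda>t. \<alpha> + \<beta> * sin (t - s) + (1 - cos (t - s)) * g t)"
  using assms by blast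

text \<open>
  Division with remainder by \<open>1 - cos (t - s)\<close>, the trigonometric counterpart of \<open>(t - s)\<^sup>2\<close>.
  A polynomial of degree \<open>m + 2\<close> arises from those of degree \<open>m + 1\<close> by multiplication with
  \<open>cos (t - s)\<close> and \<open>sin (t - s)\<close>, and both products are divided at once by means of
  \<open>cos (t - s) = 1 - (1 - cos (t - s))\<close> and
  \<open>sin (t - s)\<^sup>2 = (1 - cos (t - s)) (1 + cos (t - s))\<close>.
\<close>

lemma trig_polys_division:
  assumes "f \<in> trig_polys (Suc m)"
  shows "\<exists>\<alpha> \<beta>. \<exists>g\<in>trig_polys m. f = (\<lambda>t. \<alpha> + \<beta> * sin (t - s) + (1 - cos (t - s)) * g t)"
  using assms
proof (induction m arbitrary: f)
  case (0 f)
  then obtain a b where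
    "f = (\<lambda>t. a 0 + (\<Sum>k=1..Suc 0. a k * cos (real k * t) + b k * sin (real k * t)))"
    unfolding trig_polys_def by blast
  then have f: "f = (\<lambda>t. a 0 + (a 1 * cos t + b 1 * sin t))" by simp
  have c: "cos t = cos (t - s) * cos s - sin (t - s) * sin s"
    and d: "sin t = sin (t - s) * cos s + cos (t - s) * sin s" for t
    using cos_add[of "t - s" s] sin_add[of "t - s" s] by auto
  have "f = (\<lambda>t. (a (0::nat) + a 1 * cos s + b 1 * sin s) + (b 1 * cos s - a 1 * sin s) * sin (t - s)
     + (1 - cos (t - s)) * (- a 1 * cos s - b 1 * sin s))"
    unfolding f by (rule ext, subst c, subst d) (simp add: algebra_simps)
  then show ?case by (rule division_witness[OF trig_polys_const])
next
  case (Suc m f)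
  let ?D = "\<lambda>k f. \<exists>\<alpha> \<beta>. \<exists>g\<in>trig_polys k. f = (\<lambda>t. \<alpha> + \<beta> * sin (t - s) + (1 - cos (t - s)) * g t)"
  have comb: "?D k (\<lambda>t. c * f t + d * g t)" if fg: "?D k f" "?D k g" for f g c d k
  proof -
    obtain \<alpha> \<beta> p where p: "p \<in> trig_polys k" "f = (\<lambda>t. \<alpha> + \<beta> * sin (t - s) + (1 - cos (t - s)) * p t)"
      using fg(1) by blast
    obtain \<alpha>' \<beta>' q where q: "q \<in> trig_polys k" "g = (\<lambda>t. \<alpha>' + \<beta>' * sin (t - s) + (1 - cos (t - s)) * q t)"
      using fg(2) by blast
    have "(\<lambda>t. c * f t + d * g t) = (\<lambda>t. (c * \<alpha> + d * \<alpha>') + (c * \<beta> + d * \<beta>') * sin (t - s)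
        + (1 - cos (t - s)) * (c * p t + d * q t))"
      unfolding p q by (simp add: algebra_simps)
    then show ?thesis by (rule division_witness[OF trig_polys_combine[OF p(1) q(1)]])
  qed
  have C: "?D (Suc m) (\<lambda>t. cos (t - s) * f t)" and S: "?D (Suc m) (\<lambda>t. sin (t - s) * f t)"
    if f: "f \<in> trig_polys (Suc m)" for f
  proof -
    obtain \<alpha> \<beta> g where g: "g \<in> trig_polys m" "f = (\<lambda>t. \<alpha> + \<beta> * sin (t - s) + (1 - cos (t - s)) * g t)"
      using Suc.IH[OF f] by blast
    have "(\<lambda>t. cos (t - s) * f t) = (\<lambda>t. \<alpha> + \<beta> * sin (t - s) + (1 - cos (t - s)) * (g t - f t))"
      by (subst (2) g) (auto simp: g(2) algebra_simps)
    then show "?D (Suc m) (\<lambda>t. cos (t - s) * f t)"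
      by (rule division_witness[OF trig_polys_diff[OF trig_polys_mono[OF g(1)] f], rotated]) simp
    have sq: "sin (t - s) * sin (t - s) = (1 - cos (t - s)) * (1 + cos (t - s))" for t
      using sin_cos_squared_add2[of "t - s"] by (simp add: power2_eq_square algebra_simps)
    have "(\<lambda>t. sin (t - s) * f t) = (\<lambda>t. 0 + \<alpha> * sin (t - s) + (1 - cos (t - s)) *
        ((\<beta> * 1 + \<beta> * (cos (t - s) * 1)) + sin (t - s) * g t))"
    proof
      fix t
      have "sin (t - s) * f t = \<alpha> * sin (t - s) + \<beta> * (sin (t - s) * sin (t - s)) + (1 - cos (t - s)) * (sin (t - s) * g t)"
        unfolding g(2) by (simp add: algebra_simps)
      also have "\<dots> = 0 + \<alpha> * sin (t - s) + (1 - cos (t - s)) *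
        ((\<beta> * 1 + \<beta> * (cos (t - s) * 1)) + sin (t - s) * g t)"
        unfolding sq by (simp add: algebra_simps)
      finally show "sin (t - s) * f t = \<dots>" .
    qed
    moreover have "(\<lambda>t. (\<beta> * 1 + \<beta> * (cos (t - s) * 1)) + sin (t - s) * g t) \<in> trig_polys (Suc m)"
      using trig_polys_times_shift(1)[OF trig_polys_const[of 1 m]] trig_polys_times_shift(2)[OF g(1)] trig_polys_const
      by (intro trig_polys_add trig_polys_combine) auto
    ultimately show "?D (Suc m) (\<lambda>t. sin (t - s) * f t)" by (rule division_witness[rotated])
  qed
  have lift: "?D (Suc m) f" if f: "f \<in> trig_polys (Suc m)" for f
  proof -
    from Suc.IH[OF f] obtain \<alpha> \<beta> g where g: "g \<in> trig_polys m" "f = (\<lambda>t. \<alpha> + \<beta> * sin (t - s) + (1 - cos (t - s)) * g t)"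
      by blast
    show ?thesis by (rule division_witness[OF trig_polys_mono[OF g(1)] g(2)]) simp
  qed
  have C': "?D (Suc m) (\<lambda>t. cos t * f t)" and S': "?D (Suc m) (\<lambda>t. sin t * f t)"
    if f: "f \<in> trig_polys (Suc m)" for f
  proof -
    have c: "cos t = cos (t - s) * cos s - sin (t - s) * sin s"
      and d: "sin t = sin (t - s) * cos s + cos (t - s) * sin s" for t
      using cos_add[of "t - s" s] sin_add[of "t - s" s] by auto
    have "(\<lambda>t. cos t * f t) = (\<lambda>t. cos s * (cos (t - s) * f t) + (- sin s) * (sin (t - s) * f t))"
      by (rule ext, subst c) (simp add: algebra_simps)
    then show "?D (Suc m) (\<lambda>t. cos t * f t)" using comb[OF C[OF f] S[OF f], of "cos s" "- sin s"] by simp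
    have "(\<lambda>t. sin t * f t) = (\<lambda>t. sin s * (cos (t - s) * f t) + cos s * (sin (t - s) * f t))"
      by (rule ext, subst d) (simp add: algebra_simps)
    then show "?D (Suc m) (\<lambda>t. sin t * f t)" using comb[OF C[OF f] S[OF f], of "sin s" "cos s"] by simp
  qed
  show ?case using Suc.prems
  proof (induction rule: trig_polys_induct)
    case (cos k)
    show ?case
    proof (cases "k \<le> Suc m")
      case True
      then show ?thesis using lift[OF trig_polys_cos] by blast
    next
      case False
      then have k: "k = Suc (Suc m)" using cos by simp
      have e: "(\<lambda>t. cos (real k * t)) =
        (\<lambda>t. 1 * (cos t * cos (real (Suc m) * t)) + (-1) * (sin t * sin (real (Suc m) * t)))"
        proof
        fix t
        have "real k * t = t + real (Suc m) * t" by (simp add: k algebra_simps)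
        then show "cos (real k * t) = 1 * (cos t * cos (real (Suc m) * t)) + (-1) * (sin t * sin (real (Suc m) * t))"
          by (simp only: cos_add)
      qed
      show ?thesis unfolding e by (rule comb[OF C'[OF trig_polys_cos[OF order_refl]] S'[OF trig_polys_sin[OF order_refl]]])
    qed
  next
    case (sin k)
    show ?case
    proof (cases "k \<le> Suc m")
      case True
      then show ?thesis using lift[OF trig_polys_sin] by blast
    next
      case False
      then have k: "k = Suc (Suc m)" using sin by simp
      have e: "(\<lambda>t. sin (real k * t)) =
        (\<lambda>t. 1 * (sin t * cos (real (Suc m) * t)) + 1 * (cos t * sin (real (Suc m) * t)))"
        proof
        fix t
        have "real k * t = t + real (Suc m) * t" by (simp add: k algebra_simps)
        then show "sin (real k * t) = 1 * (sin t * cos (real (Suc m) * t)) + 1 * (cos t * sin (real (Suc m) * t))"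
          by (simp only: sin_add mult_1)
      qed
      show ?thesis unfolding e by (rule comb[OF S'[OF trig_polys_cos[OF order_refl]] C'[OF trig_polys_sin[OF order_refl]]])
    qed
  next
  case (combine f g c d)
  then show ?case by (rule comb)
qed
qed

lemma trig_polys_periodic: "f \<in> trig_polys m \<Longrightarrow> f (t + 2 * pi) = f t"
proof (induction rule: trig_polys_induct)
  case (cos k)
  have "cos (real k * (t + 2 * pi)) = cos (real k * t + 2 * pi * of_int (int k))" by (simp add: algebra_simps)
  then show ?case by (simp add: cos_add del: of_int_of_nat_eq)
next
  case (sin k)
  have "sin (real k * (t + 2 * pi)) = sin (real k * t + 2 * pi * of_int (int k))" by (simp add: algebra_simps)
  then show ?case by (simp add: sin_add del: of_int_of_nat_eq)
qed auto

lemma trig_polys_continuous: "f \<in> trig_polys m \<Longrightarrow> continuous_on S f"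
  by (induction rule: trig_polys_induct) (auto intro!: continuous_intros)

lemma trig_polys_isCont: "f \<in> trig_polys m \<Longrightarrow> isCont f t"
  using trig_polys_continuous[of f m UNIV] by (simp add: continuous_on_eq_continuous_at)

section \<open>Orders of vanishing and division by weights\<close>

text \<open>
  Orders of vanishing are expressed by \<open>f(t) = o((t - s)^k)\<close> rather than by derivatives, because this
  form is inherited by quotients of functions that are only finitely often differentiable. For
  functions of class \<open>C^k\<close> it means that the derivatives of orders \<open>0, ..., k\<close> vanish.
\<close>

definition vanish_order :: "(real \<Rightarrow> real) \<Rightarrow> real \<Rightarrow> nat \<Rightarrow> bool" where
  "vanish_order f s k \<longleftrightarrow> ((\<lambda>t. f t / (t - s) ^ k) \<longlongrightarrow> 0) (at s)"

text \<open>
  Points of the circle are represented by reals, so multiplicities are counted modulo \<open>2 * pi\<close>.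
\<close>

definition mult_at :: "real multiset \<Rightarrow> real \<Rightarrow> nat" where
  "mult_at X s = size (filter_mset (\<lambda>x. cis x = cis s) X)"

text \<open>
  The trigonometric counterpart of the product of the squares \<open>(t - x)\<^sup>2\<close>.
\<close>

definition weight :: "real multiset \<Rightarrow> real \<Rightarrow> real" where
  "weight X t = (\<Prod>x\<in>#X. 1 - cos (t - x))"

lemma mult_at_simps [simp]:
  "mult_at {#} s = 0"
  "mult_at (add_mset x X) s = (if cis x = cis s then Suc (mult_at X s) else mult_at X s)"
  "mult_at (X + Y) s = mult_at X s + mult_at Y s"
  "mult_at (replicate_mset k x) s = (if cis x = cis s then k else 0)"
  proof -
  show "mult_at (replicate_mset k x) s = (if cis x = cis s then k else 0)"
    by (induction k) (auto simp: mult_at_def)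
qed (auto simp: mult_at_def)

lemma mult_at_mono: "X \<subseteq># Y \<Longrightarrow> mult_at X s \<le> mult_at Y s"
  by (metis mult_at_simps(3) le_add1 subset_mset.add_diff_inverse)

lemma mult_at_le_size: "mult_at X s \<le> size X"
  unfolding mult_at_def by (rule size_filter_mset_lesseq)

lemma weight_simps [simp]:
  "weight {#} t = 1"
  "weight (add_mset x X) t = (1 - cos (t - x)) * weight X t"
  "weight (X + Y) t = weight X t * weight Y t"
  by (auto simp: weight_def)

lemma cis_eq_iff_cos: "cis x = cis t \<longleftrightarrow> cos (t - x) = 1"
proof
  assume "cis x = cis t"
  then have "cos x = cos t" "sin x = sin t" by (auto simp: complex_eq_iff)
  then show "cos (t - x) = 1" by (simp add: cos_diff power2_eq_square[symmetric])
next
  assume c: "cos (t - x) = 1"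
  then have s: "sin (t - x) = 0" using sin_cos_squared_add[of "t - x"] by simp
  have "cos t = cos ((t - x) + x)" "sin t = sin ((t - x) + x)" by auto
  then have "cos t = cos x" "sin t = sin x" unfolding cos_add sin_add using c s by auto
  then show "cis x = cis t" by (simp add: complex_eq_iff)
qed

lemma cis_eq_iff: "cis x = cis t \<longleftrightarrow> (\<exists>k::int. t = x + 2 * pi * of_int k)"
  unfolding cis_eq_iff_cos cos_one_2pi_int by (auto simp: algebra_simps)

lemma cis_add_2pi [simp]: "cis (x + 2 * pi) = cis x"
  by (simp add: complex_eq_iff)

lemma cis_diff_2pi [simp]: "cis (x - 2 * pi) = cis x"
  using cis_add_2pi[of "x - 2 * pi"] by simp

lemma cis_eq_within_period:
  assumes "cis x = cis y" "\<bar>x - y\<bar> < 2 * pi"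
  shows "x = y"
proof -
  obtain k :: int where k: "y = x + 2 * pi * of_int k" using assms(1) cis_eq_iff by blast
  then have "\<bar>2 * pi * of_int k\<bar> < 2 * pi * (1::real)" using assms(2) by simp
  then have "\<bar>real_of_int k\<bar> < 1" by (simp add: abs_mult)
  then have "k = 0" by linarith
  with k show ?thesis by simp
qed

lemma weight_nonneg: "weight X t \<ge> 0"
  by (induction X) auto

lemma weight_eq_0_iff: "weight X t = 0 \<longleftrightarrow> mult_at X t > 0"
  by (induction X) (auto simp: cis_eq_iff_cos)

lemma weight_trig_poly: "weight X \<in> trig_polys (size X)"
proof (induction X)
  case empty
  then show ?case using trig_polys_const[of 1 0] by (simp add: weight_simps(1)[abs_def])
next
  case (add x X)
  have "weight (add_mset x X) = (\<lambda>t. (1 - cos (t - x)) * weight X t)" by (simp add: fun_eq_iff)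
  then show ?case using trig_polys_times_shift(3)[OF add, of x] by simp
qed

lemma weight_isCont: "isCont (weight X) t"
  using weight_trig_poly trig_polys_isCont by blast

lemma weight_mult_trig_poly:
  "f \<in> trig_polys m \<Longrightarrow> (\<lambda>t. weight X t * f t) \<in> trig_polys (size X + m)"
proof (induction X)
  case (add x X)
  show ?case using trig_polys_times_shift(3)[OF add.IH[OF add.prems], of x] by (simp add: mult.assoc)
qed simp

lemma tendsto_sin_quot: "((\<lambda>t. sin (t - s) / (t - s)) \<longlongrightarrow> 1) (at (s::real))"
proof -
  have "((\<lambda>t. sin (t - s)) has_real_derivative 1) (at s)"
    by (auto intro!: derivative_eq_intros)
  then show ?thesis by (simp add: has_field_derivative_iff)
qed

lemma tendsto_one_minus_cos_quot:
  "((\<lambda>t. (1 - cos (t - s)) / (t - s) ^ 2) \<longlongrightarrow> 1 / 2) (at (s::real))"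
proof -
  have "((\<lambda>h::real. sin (h / 2) / (h / 2)) \<longlongrightarrow> 1) (at 0)"
  proof -
    have "((\<lambda>h::real. sin (h / 2)) has_real_derivative (1/2)) (at 0)"
      by (auto intro!: derivative_eq_intros)
    then have "((\<lambda>h::real. sin (h / 2) / h) \<longlongrightarrow> 1 / 2) (at 0)" by (simp add: has_field_derivative_iff)
    then have "((\<lambda>h::real. 2 * (sin (h / 2) / h)) \<longlongrightarrow> 2 * (1 / 2)) (at 0)" by (rule tendsto_mult_left)
    then show ?thesis by (simp add: mult.commute)
  qed
  then have "((\<lambda>h::real. (1/2) * (sin (h / 2) / (h / 2)) ^ 2) \<longlongrightarrow> (1/2) * 1 ^ 2) (at 0)"
    by (intro tendsto_intros)
  moreover have "(1/2) * (sin (h / 2) / (h / 2)) ^ 2 = (1 - cos h) / h ^ 2" for h :: real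
    using cos_double_sin[of "h / 2"] by (simp add: power_divide)
  ultimately have "((\<lambda>h::real. (1 - cos h) / h ^ 2) \<longlongrightarrow> (1/2) * 1 ^ 2) (at 0)" by (simp only:)
  then show ?thesis by (subst LIM_offset_zero_iff) auto
qed

lemma weight_leading:
  "\<exists>d>0. ((\<lambda>t. weight X t / (t - s) ^ (2 * mult_at X s)) \<longlongrightarrow> d) (at s)"
proof (induction X)
  case empty
  show ?case by (intro exI[of _ 1]) simp
next
  case (add x X)
  then obtain d where d: "d > 0" "((\<lambda>t. weight X t / (t - s) ^ (2 * mult_at X s)) \<longlongrightarrow> d) (at s)" by blast
  show ?case
  proof (cases "cis x = cis s")
    case True
    then have "cos (t - x) = cos (t - s)" for t by (simp add: cos_diff complex_eq_iff)
    moreover have "((\<lambda>t. (1 - cos (t - s)) / (t - s)\<^sup>2 * (weight X t / (t - s) ^ (2 * mult_at X s))) \<longlongrightarrow> 1/2 * d) (at s)"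
      by (intro tendsto_mult tendsto_one_minus_cos_quot d)
    ultimately show ?thesis using True d(1) by (intro exI[of _ "1/2 * d"]) (simp add: power2_eq_square mult_ac)
  next
    case False
    have "((\<lambda>t. (1 - cos (t - x)) * (weight X t / (t - s) ^ (2 * mult_at X s))) \<longlongrightarrow> (1 - cos (s - x)) * d) (at s)"
      by (intro tendsto_intros d)
    moreover have "(1 - cos (s - x)) * d > 0" using False d(1) cos_le_one[of "s - x"]
      by (auto simp: cis_eq_iff_cos intro!: mult_pos_pos less_le_trans[of _ "1 - cos (s - x)"] simp: less_le)
    ultimately show ?thesis using False by (intro exI[of _ "(1 - cos (s - x)) * d"]) simp
  qed
qed

lemma weight_eventually_nonzero: "\<forall>\<^sub>F t in at s. weight X t \<noteq> 0"
proof -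
  obtain d where d: "d > 0" "((\<lambda>t. weight X t / (t - s) ^ (2 * mult_at X s)) \<longlongrightarrow> d) (at s)"
    using weight_leading by blast
  from order_tendstoD(1)[OF d(2,1)] show ?thesis by (rule eventually_mono) auto
qed

lemma vanish_order_mono:
  assumes "vanish_order f s k" "j \<le> k"
  shows "vanish_order f s j"
proof -
  have "((\<lambda>t. (t - s) ^ (k - j) * (f t / (t - s) ^ k)) \<longlongrightarrow> (s - s) ^ (k - j) * 0) (at s)"
    using assms(1) unfolding vanish_order_def by (intro tendsto_intros)
  moreover have "\<forall>\<^sub>F t in at s. (t - s) ^ (k - j) * (f t / (t - s) ^ k) = f t / (t - s) ^ j"
  proof -
    have "\<forall>\<^sub>F t in at s. t \<noteq> s" by (simp add: eventually_at_filter)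
    then show ?thesis
    proof (rule eventually_mono)
      fix t assume ts: "t \<noteq> s"
      then have "(t - s) ^ k = (t - s) ^ (k - j) * (t - s) ^ j" "(t - s) ^ (k - j) \<noteq> 0" using assms(2)
        by (auto simp flip: power_add)
      then show "(t - s) ^ (k - j) * (f t / (t - s) ^ k) = f t / (t - s) ^ j" using ts by auto
    qed
  qed
  ultimately show ?thesis unfolding vanish_order_def using Lim_transform_eventually by fastforce
qed

lemma vanish_order_cong:
  assumes "vanish_order f s k" "\<forall>\<^sub>F t in at s. f t = g t"
  shows "vanish_order g s k"
  using assms(1) unfolding vanish_order_def
  by (rule Lim_transform_eventually) (rule eventually_mono[OF assms(2)], simp)

lemma vanish_order_combine:
  assumes "vanish_order f s k" "vanish_order g s k"
  shows "vanish_order (\<lambda>t. c * f t + d * g t) s k"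
proof -
  have "((\<lambda>t. c * (f t / (t - s) ^ k) + d * (g t / (t - s) ^ k)) \<longlongrightarrow> c * 0 + d * 0) (at s)"
    using assms unfolding vanish_order_def by (intro tendsto_intros)
  then show ?thesis unfolding vanish_order_def by (simp add: add_divide_distrib)
qed

lemma vanish_order_diff:
  "vanish_order f s k \<Longrightarrow> vanish_order g s k \<Longrightarrow> vanish_order (\<lambda>t. f t - g t) s k"
  using vanish_order_combine[of f s k g 1 "-1"] by simp

lemma vanish_order_mult:
  assumes "vanish_order f s k" "(g \<longlongrightarrow> l) (at s)"
  shows "vanish_order (\<lambda>t. g t * f t) s k"
  using tendsto_mult[OF assms(2) assms(1)[unfolded vanish_order_def]] unfolding vanish_order_def by simp

lemma vanish_order_value: "vanish_order f s k \<Longrightarrow> isCont f s \<Longrightarrow> f s = 0"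
  using vanish_order_mono[of f s k 0] by (auto simp: vanish_order_def isCont_def intro: LIM_unique)

lemma vanish_order_0: "isCont f s \<Longrightarrow> vanish_order f s 0 \<longleftrightarrow> f s = 0"
  using vanish_order_value[of f s 0] by (auto simp: vanish_order_def isCont_def)

lemma periodic_int:
  fixes f :: "real \<Rightarrow> 'a"
  assumes "\<And>t. f (t + 2 * pi) = f t"
  shows "f (t + 2 * pi * of_int j) = f t"
proof (induction j arbitrary: t rule: int_induct[where k=0])
  case (step1 i)
  have "t + 2 * pi * of_int (i + 1) = (t + 2 * pi * of_int i) + 2 * pi" by (simp add: algebra_simps)
  then show ?case using step1 assms by metis
next
  case (step2 i)
  have "t + 2 * pi * of_int i = (t + 2 * pi * of_int (i - 1)) + 2 * pi" by (simp add: algebra_simps)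
  then show ?case using step2 assms by metis
qed simp

lemma periodic_cis:
  fixes f :: "real \<Rightarrow> 'a"
  assumes "\<And>t. f (t + 2 * pi) = f t" "cis s = cis s'"
  shows "f s' = f s"
  using assms cis_eq_iff periodic_int[of f s] by metis

lemma cis_representative: "\<exists>s\<in>{a..<a + 2 * pi}. cis s = cis t"
proof -
  define j where "j = \<lfloor>(t - a) / (2 * pi)\<rfloor>"
  have "of_int j \<le> (t - a) / (2 * pi)" "(t - a) / (2 * pi) < of_int j + 1" unfolding j_def by linarith+
  then have "t - 2 * pi * of_int j \<in> {a..<a + 2 * pi}" by (auto simp: field_simps)
  moreover have "cis (t - 2 * pi * of_int j) = cis t"
    unfolding cis_eq_iff by (intro exI[of _ j]) simp
  ultimately show ?thesis by blast
qed

lemma vanish_order_cong_cis: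
  assumes "\<And>t. f (t + 2 * pi) = f t" "cis s = cis s'" "vanish_order f s k"
  shows "vanish_order f s' k"
proof -
  obtain j :: int where j: "s' = s + 2 * pi * of_int j" using assms(2) cis_eq_iff by blast
  have "((\<lambda>h. f (s + h) / h ^ k) \<longlongrightarrow> 0) (at 0)"
    using assms(3) unfolding vanish_order_def by (subst (asm) LIM_offset_zero_iff) auto
  moreover have "f (s' + h) = f (s + h)" for h
    using periodic_int[of f "s + h" j, OF assms(1)] by (simp add: j algebra_simps)
  ultimately show ?thesis unfolding vanish_order_def by (subst LIM_offset_zero_iff) auto
qed

lemma vanish_order_divide_weight:
  assumes "vanish_order f s (2 * mult_at X s + k)"
  shows "vanish_order (\<lambda>t. f t / weight X t) s k"
proof -
  obtain d where d: "d > 0" "((\<lambda>t. weight X t / (t - s) ^ (2 * mult_at X s)) \<longlongrightarrow> d) (at s)"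
    using weight_leading by blast
  have "((\<lambda>t. (f t / (t - s) ^ (2 * mult_at X s + k)) / (weight X t / (t - s) ^ (2 * mult_at X s))) \<longlongrightarrow> 0 / d) (at s)"
    using assms d unfolding vanish_order_def by (intro tendsto_divide) auto
  moreover have "\<forall>\<^sub>F t in at s. (f t / (t - s) ^ (2 * mult_at X s + k)) / (weight X t / (t - s) ^ (2 * mult_at X s))
      = (f t / weight X t) / (t - s) ^ k"
  proof -
    have "\<forall>\<^sub>F t in at s. t \<noteq> s" by (simp add: eventually_at_filter)
    then show ?thesis by (rule eventually_mono) (simp add: power_add field_simps)
  qed
  ultimately show ?thesis unfolding vanish_order_def using Lim_transform_eventually by fastforce
qed

lemma vanish_order_times_weight:
  assumes "vanish_order g s k"
  shows "vanish_order (\<lambda>t. weight X t * g t) s (2 * mult_at X s + k)"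
proof -
  obtain d where d: "d > 0" "((\<lambda>t. weight X t / (t - s) ^ (2 * mult_at X s)) \<longlongrightarrow> d) (at s)"
    using weight_leading by blast
  have "((\<lambda>t. (weight X t / (t - s) ^ (2 * mult_at X s)) * (g t / (t - s) ^ k)) \<longlongrightarrow> d * 0) (at s)"
    using assms d unfolding vanish_order_def by (intro tendsto_mult) auto
  then show ?thesis unfolding vanish_order_def by (simp add: power_add)
qed

text \<open>
  The zero count for trigonometric polynomials: with a double zero at each of \<open>m\<close> points only a constant
  factor is left. A factor \<open>1 - cos (t - x)\<close> splits off because the remainder \<open>\<alpha> + \<beta> * sin (t - x)\<close> of the
  division is determined by the value and the derivative at \<open>x\<close>.
\<close>

lemma trig_poly_divide_weight:
  assumes "f \<in> trig_polys m" "size X \<le> m"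
    and "\<And>s. mult_at X s > 0 \<Longrightarrow> vanish_order f s (2 * mult_at X s - 1)"
  shows "\<exists>g\<in>trig_polys (m - size X). f = (\<lambda>t. weight X t * g t)"
  using assms
proof (induction X arbitrary: f m)
  case empty
  then show ?case by auto
next
  case (add x X)
  then obtain m' where m: "m = Suc m'" by (cases m) auto
  obtain \<alpha> \<beta> g where g: "g \<in> trig_polys m'" "f = (\<lambda>t. \<alpha> + \<beta> * sin (t - x) + (1 - cos (t - x)) * g t)"
    using trig_polys_division add.prems(1) unfolding m by blast
  have "vanish_order f x 1" using add.prems(3)[of x] by (auto elim: vanish_order_mono)
  then have f1: "vanish_order f x 1" and f0: "f x = 0"
    using vanish_order_value trig_polys_isCont[OF add.prems(1)] by auto
  have \<alpha>: "\<alpha> = 0" using f0 by (simp add: g(2))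
  have "((\<lambda>t. \<beta> * (sin (t - x) / (t - x)) + (t - x) * ((1 - cos (t - x)) / (t - x) ^ 2) * g t) \<longlongrightarrow> \<beta> * 1 + (x - x) * (1 / 2) * g x) (at x)"
    using trig_polys_isCont[OF g(1), of x] unfolding isCont_def
    by (intro tendsto_intros tendsto_sin_quot tendsto_one_minus_cos_quot)
  moreover have "\<beta> * (sin (t - x) / (t - x)) + (t - x) * ((1 - cos (t - x)) / (t - x) ^ 2) * g t = f t / (t - x) ^ 1" for t
    unfolding g(2) \<alpha> by (simp add: power2_eq_square add_divide_distrib)
  ultimately have "\<beta> = 0" using f1 unfolding vanish_order_def by (auto intro: LIM_unique)
  with \<alpha> g(2) have f: "f t = (1 - cos (t - x)) * g t" for t by simp
  have "\<exists>h\<in>trig_polys (m' - size X). g = (\<lambda>t. weight X t * h t)"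
  proof (rule add.IH[OF g(1)])
    show "size X \<le> m'" using add.prems(2) m by simp
    fix s assume s: "mult_at X s > 0"
    have fv: "vanish_order f s (2 * mult_at (add_mset x X) s - 1)" using add.prems(3)[of s] s by auto
    have "vanish_order (\<lambda>t. f t / weight {#x#} t) s (2 * mult_at X s - 1)"
      by (rule vanish_order_divide_weight) (use fv s in \<open>auto split: if_splits\<close>)
    moreover have "\<forall>\<^sub>F t in at s. f t / weight {#x#} t = g t"
      using weight_eventually_nonzero[of "{#x#}" s] by (rule eventually_mono) (simp add: f)
    ultimately show "vanish_order g s (2 * mult_at X s - 1)"
      by (rule vanish_order_cong)
  qed
  then obtain h where h: "h \<in> trig_polys (m' - size X)" "g = (\<lambda>t. weight X t * h t)" by blast
  show ?case
    by (rule bexI[of _ h]) (use h m in \<open>auto simp: f fun_eq_iff\<close>)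
qed

lemma weight_cancel:
  assumes "\<And>t. weight X t * f t = weight X t * g t" "isCont f s" "isCont g s"
  shows "f s = g s"
proof -
  have "\<forall>\<^sub>F t in at s. f t = g t"
    using weight_eventually_nonzero[of X s] by (rule eventually_mono) (use assms(1) in auto)
  then have "(f \<longlongrightarrow> g s) (at s)" using assms(3) unfolding isCont_def
    by (metis (mono_tags, lifting) eventually_mono Lim_transform_eventually)
  then show ?thesis using assms(2) unfolding isCont_def by (auto intro: LIM_unique)
qed

section \<open>Taylor expansions\<close>

lemma cont_diff_has_derivative:
  assumes "cont_diff k f" "j < k"
  shows "((deriv ^^ j) f has_real_derivative (deriv ^^ Suc j) f x) (at x)"
  using assms DERIV_deriv_iff_real_differentiable unfolding cont_diff_def by auto

lemma cont_diff_isCont: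
  assumes "cont_diff k f" "j \<le> k"
  shows "isCont ((deriv ^^ j) f) x"
proof (cases "j = k")
  case True
  then show ?thesis using assms unfolding cont_diff_def by (simp add: continuous_on_eq_continuous_at)
next
  case False
  then show ?thesis using cont_diff_has_derivative[OF assms(1), of j x] assms(2) DERIV_isCont by force
qed

lemma cont_diff_le:
  assumes "cont_diff k f" "j \<le> k"
  shows "cont_diff j f"
  using assms cont_diff_isCont[OF assms] unfolding cont_diff_def
  by (auto simp: continuous_on_eq_continuous_at)

lemma deriv_pow_diff:
  assumes "cont_diff k f" "cont_diff k g" "j \<le> k"
  shows "(deriv ^^ j) (\<lambda>t. f t - g t) = (\<lambda>t. (deriv ^^ j) f t - (deriv ^^ j) g t)"
  using assms(3)
proof (induction j)
  case (Suc j)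
  then have "((\<lambda>t. (deriv ^^ j) f t - (deriv ^^ j) g t) has_real_derivative
      (deriv ^^ Suc j) f x - (deriv ^^ Suc j) g x) (at x)" for x
    using cont_diff_has_derivative[OF assms(1)] cont_diff_has_derivative[OF assms(2)]
    by (intro DERIV_diff) auto
  then have *: "deriv (\<lambda>t. (deriv ^^ j) f t - (deriv ^^ j) g t) x
      = (deriv ^^ Suc j) f x - (deriv ^^ Suc j) g x" for x
    by (rule DERIV_imp_deriv)
  have IH: "(deriv ^^ j) (\<lambda>t. f t - g t) = (\<lambda>t. (deriv ^^ j) f t - (deriv ^^ j) g t)"
    using Suc by simp
  show ?case by (rule ext) (simp only: funpow.simps o_apply IH *)
qed simp

lemma cont_diff_diff:
  assumes "cont_diff k f" "cont_diff k g"
  shows "cont_diff k (\<lambda>t. f t - g t)"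
  unfolding cont_diff_def
proof (intro conjI allI impI)
  fix j x assume "j < k"
  then show "(deriv ^^ j) (\<lambda>t. f t - g t) differentiable at x"
    using assms deriv_pow_diff[OF assms, of j] unfolding cont_diff_def by (auto intro: differentiable_diff)
next
  show "continuous_on UNIV ((deriv ^^ k) (\<lambda>t. f t - g t))"
    using assms deriv_pow_diff[OF assms, of k] unfolding cont_diff_def by (auto intro: continuous_on_diff)
qed

lemma trig_polys_derivative:
  assumes "f \<in> trig_polys m"
  shows "\<exists>g\<in>trig_polys m. \<forall>t. (f has_real_derivative g t) (at t)"
  using assms
proof (induction rule: trig_polys_induct)
  case (cos k)
  show ?case
    by (rule bexI[OF _ trig_polys_scale[OF trig_polys_sin[OF cos], of "- real k"]])
      (auto intro!: derivative_eq_intros)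
next
  case (sin k)
  show ?case
    by (rule bexI[OF _ trig_polys_scale[OF trig_polys_cos[OF sin], of "real k"]])
      (auto intro!: derivative_eq_intros)
next
  case (combine f g c d)
  then obtain f' g' where "f' \<in> trig_polys m" "\<And>t. (f has_real_derivative f' t) (at t)"
    "g' \<in> trig_polys m" "\<And>t. (g has_real_derivative g' t) (at t)" by blast
  then show ?case
    by (intro bexI[OF _ trig_polys_combine[of f' m g' c d]]) (auto intro!: derivative_eq_intros)
qed

lemma trig_polys_deriv:
  assumes "f \<in> trig_polys m"
  shows "deriv f \<in> trig_polys m" "f differentiable at x"
proof -
  obtain g where g: "g \<in> trig_polys m" "\<And>t. (f has_real_derivative g t) (at t)"
    using trig_polys_derivative[OF assms] by blast
  have "deriv f = g" using g(2) DERIV_imp_deriv by blast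
  then show "deriv f \<in> trig_polys m" using g(1) by simp
  show "f differentiable at x" using g(2) real_differentiable_def by blast
qed

lemma trig_polys_deriv_pow: "f \<in> trig_polys m \<Longrightarrow> (deriv ^^ j) f \<in> trig_polys m"
  by (induction j) (auto intro: trig_polys_deriv)

lemma trig_polys_cont_diff: "f \<in> trig_polys m \<Longrightarrow> cont_diff k f"
  unfolding cont_diff_def
  using trig_polys_deriv(2)[OF trig_polys_deriv_pow] trig_polys_continuous[OF trig_polys_deriv_pow] by auto

lemma taylor_leading_term:
  assumes f: "cont_diff k f" and z: "\<And>j. j < k \<Longrightarrow> (deriv ^^ j) f s = 0"
  shows "((\<lambda>t. f t / (t - s) ^ k) \<longlongrightarrow> (deriv ^^ k) f s / fact k) (at s)"
proof (cases "k = 0")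
  case True
  then show ?thesis using cont_diff_isCont[OF f, of 0 s] by (simp add: isCont_def)
next
  case False
  have "\<exists>x. \<bar>x - s\<bar> \<le> \<bar>t - s\<bar> \<and> f t = (deriv ^^ k) f x / fact k * (t - s) ^ k" for t
  proof (cases "t = s")
    case True
    have "f s = 0" using False z[of 0] by simp
    then show ?thesis using False True by (intro exI[of _ s]) simp
  next
    case ts: False
    have "\<exists>x. (if t < s then t < x \<and> x < s else s < x \<and> x < t) \<and>
      f t = (\<Sum>m<k. (deriv ^^ m) f s / fact m * (t - s) ^ m) + (deriv ^^ k) f x / fact k * (t - s) ^ k"
    proof (rule Taylor[where a = "min s t" and b = "max s t"])
      show "\<forall>m x. m < k \<and> min s t \<le> x \<and> x \<le> max s t \<longrightarrow>
          ((deriv ^^ m) f has_real_derivative (deriv ^^ Suc m) f x) (at x)"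
        using cont_diff_has_derivative[OF f] by blast
    qed (use False ts in auto)
    then obtain x where x: "if t < s then t < x \<and> x < s else s < x \<and> x < t"
      "f t = (\<Sum>m<k. (deriv ^^ m) f s / fact m * (t - s) ^ m) + (deriv ^^ k) f x / fact k * (t - s) ^ k"
      by blast
    have "(\<Sum>m<k. (deriv ^^ m) f s / fact m * (t - s) ^ m) = 0"
      by (rule sum.neutral) (simp add: z)
    with x(2) have "f t = (deriv ^^ k) f x / fact k * (t - s) ^ k" by linarith
    moreover have "\<bar>x - s\<bar> \<le> \<bar>t - s\<bar>" using x(1) by (auto split: if_splits)
    ultimately show ?thesis by blast
  qed
  then obtain \<xi> where \<xi>: "\<And>t. \<bar>\<xi> t - s\<bar> \<le> \<bar>t - s\<bar>" "\<And>t. f t = (deriv ^^ k) f (\<xi> t) / fact k * (t - s) ^ k"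
    by metis
  have "((\<lambda>t. \<xi> t - s) \<longlongrightarrow> 0) (at s)"
  proof (rule Lim_null_comparison)
    show "\<forall>\<^sub>F t in at s. norm (\<xi> t - s) \<le> \<bar>t - s\<bar>" using \<xi>(1) by simp
    show "((\<lambda>t. \<bar>t - s\<bar>) \<longlongrightarrow> 0) (at s)" by (auto intro!: tendsto_eq_intros)
  qed
  then have "(\<xi> \<longlongrightarrow> s) (at s)" by (simp add: LIM_zero_iff)
  then have "((\<lambda>t. (deriv ^^ k) f (\<xi> t) / fact k) \<longlongrightarrow> (deriv ^^ k) f s / fact k) (at s)"
    using cont_diff_isCont[OF f order_refl, of s] by (intro tendsto_divide isCont_tendsto_compose[of s "(deriv ^^ k) f"]) auto
  moreover have "\<forall>\<^sub>F t in at s. (deriv ^^ k) f (\<xi> t) / fact k = f t / (t - s) ^ k"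
  proof -
    have "\<forall>\<^sub>F t in at s. t \<noteq> s" by (simp add: eventually_at_filter)
    then show ?thesis by (rule eventually_mono) (simp add: \<xi>(2))
  qed
  ultimately show ?thesis by (rule Lim_transform_eventually)
qed

lemma taylor_first_nonzero:
  assumes f: "cont_diff k f" and nz: "\<not> (\<forall>j\<le>k. (deriv ^^ j) f s = 0)"
  obtains j c where "j \<le> k" "c \<noteq> 0" "((\<lambda>t. f t / (t - s) ^ j) \<longlongrightarrow> c) (at s)"
proof -
  define j where "j = (LEAST j. j \<le> k \<and> (deriv ^^ j) f s \<noteq> 0)"
  have j: "j \<le> k \<and> (deriv ^^ j) f s \<noteq> 0" unfolding j_def by (rule LeastI_ex) (use nz in auto)
  have "(deriv ^^ i) f s = 0" if "i < j" for i
    using not_less_Least[OF that[unfolded j_def]] that j by auto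
  then have "((\<lambda>t. f t / (t - s) ^ j) \<longlongrightarrow> (deriv ^^ j) f s / fact j) (at s)"
    using taylor_leading_term cont_diff_le[OF f] j by blast
  then show thesis using that[of j "(deriv ^^ j) f s / fact j"] j by simp
qed

lemma vanish_order_iff_deriv:
  assumes f: "cont_diff k f"
  shows "vanish_order f s k \<longleftrightarrow> (\<forall>j\<le>k. (deriv ^^ j) f s = 0)"
proof
  assume v: "vanish_order f s k"
  show "\<forall>j\<le>k. (deriv ^^ j) f s = 0"
  proof (rule ccontr)
    assume "\<not> (\<forall>j\<le>k. (deriv ^^ j) f s = 0)"
    then obtain j c where "j \<le> k" "c \<noteq> 0" "((\<lambda>t. f t / (t - s) ^ j) \<longlongrightarrow> c) (at s)"
      by (rule taylor_first_nonzero[OF f])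
    then show False using vanish_order_mono[OF v, of j] unfolding vanish_order_def by (auto dest: LIM_unique)
  qed
next
  assume z: "\<forall>j\<le>k. (deriv ^^ j) f s = 0"
  then show "vanish_order f s k" unfolding vanish_order_def using taylor_leading_term[OF f, of s] by auto
qed

lemma vanish_order_next_coefficient:
  assumes "cont_diff (Suc k) f" "vanish_order f s k"
  shows "\<exists>c. ((\<lambda>t. f t / (t - s) ^ Suc k) \<longlongrightarrow> c) (at s)"
proof -
  have "\<forall>j\<le>k. (deriv ^^ j) f s = 0"
    using assms vanish_order_iff_deriv[OF cont_diff_le[OF assms(1)], of k s] by simp
  then show ?thesis using taylor_leading_term[OF assms(1), of s] by force
qed

text \<open>
  The first nonzero Taylor term of a nonnegative function has even degree, since a term of odd degree
  changes sign.
\<close>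

lemma vanish_order_nonneg:
  assumes f: "cont_diff (2 * k + 1) f" and v: "vanish_order f s (2 * k)" and nn: "\<And>t. f t \<ge> 0"
  shows "vanish_order f s (2 * k + 1)"
proof -
  obtain c where c: "((\<lambda>t. f t / (t - s) ^ (2 * k + 1)) \<longlongrightarrow> c) (at s)"
    using vanish_order_next_coefficient[of "2 * k" f s] f v by auto
  have "c \<ge> 0"
  proof (rule tendsto_lowerbound)
    show "((\<lambda>t. f t / (t - s) ^ (2 * k + 1)) \<longlongrightarrow> c) (at_right s)" using c by (rule tendsto_within_subset) simp
    have "\<forall>\<^sub>F t in at_right s. t > s" by (simp add: eventually_at_filter)
    then show "\<forall>\<^sub>F t in at_right s. 0 \<le> f t / (t - s) ^ (2 * k + 1)"
      by (rule eventually_mono) (simp add: nn)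
  qed simp
  moreover have "c \<le> 0"
  proof (rule tendsto_upperbound)
    show "((\<lambda>t. f t / (t - s) ^ (2 * k + 1)) \<longlongrightarrow> c) (at_left s)" using c by (rule tendsto_within_subset) simp
    have "\<forall>\<^sub>F t in at_left s. t < s" by (simp add: eventually_at_filter)
    then show "\<forall>\<^sub>F t in at_left s. f t / (t - s) ^ (2 * k + 1) \<le> 0"
    proof (rule eventually_mono)
      fix t assume "t < s"
      then have "(t - s) ^ (2 * k + 1) \<le> 0"
        by (simp add: power_mult mult_le_0_iff)
      then show "f t / (t - s) ^ (2 * k + 1) \<le> 0" using nn by (rule divide_nonneg_nonpos[rotated])
    qed
  qed simp
  ultimately show ?thesis using c unfolding vanish_order_def by simp
qed

lemma interval_side_filter:
  fixes s :: real
  assumes "a < b" "s \<in> {a..b}"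
  obtains F where "F \<le> at s" "F \<noteq> bot" "\<forall>\<^sub>F t in F. t \<in> {a..b}"
proof (cases "s < b")
  case True
  have "\<forall>\<^sub>F t in at_right s. t \<in> {a..b}"
    unfolding eventually_at_right[OF True] using assms(2) True by (intro exI[of _ b]) auto
  then show ?thesis by (intro that[of "at_right s"]) (auto simp: at_le)
next
  case False
  then have "a < s" using assms by auto
  have "\<forall>\<^sub>F t in at_left s. t \<in> {a..b}"
    unfolding eventually_at_left[OF \<open>a < s\<close>] using assms(2) \<open>a < s\<close> by (intro exI[of _ a]) auto
  then show ?thesis by (intro that[of "at_left s"]) (auto simp: at_le)
qed

lemma vanish_order_zero_on_interval:
  assumes f: "cont_diff k f" and "a < b" "s \<in> {a..b}" and z: "\<And>t. t \<in> {a..b} \<Longrightarrow> f t = 0"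
  shows "vanish_order f s k"
proof (rule ccontr)
  assume "\<not> vanish_order f s k"
  then have "\<not> (\<forall>j\<le>k. (deriv ^^ j) f s = 0)" using vanish_order_iff_deriv[OF f] by simp
  then obtain j c where c: "c \<noteq> 0" "((\<lambda>t. f t / (t - s) ^ j) \<longlongrightarrow> c) (at s)"
    by (rule taylor_first_nonzero[OF f])
  obtain F where F: "F \<le> at s" "F \<noteq> bot" "\<forall>\<^sub>F t in F. t \<in> {a..b}"
    by (rule interval_side_filter[OF assms(2,3)])
  have "((\<lambda>t. f t / (t - s) ^ j) \<longlongrightarrow> c) F" using c(2) F(1) by (rule tendsto_mono[rotated])
  moreover have "((\<lambda>t. f t / (t - s) ^ j) \<longlongrightarrow> 0) F"
    by (rule tendsto_eventually) (rule eventually_mono[OF F(3)], simp add: z)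
  ultimately show False using tendsto_unique[OF F(2)] c(1) by blast
qed

section \<open>Supporting polynomials and their contacts\<close>

text \<open>
  Contact of multiplicity \<open>m\<close> means that the nonnegative function \<open>\<phi> - u\<close> is \<open>o((t - s)^(2 m - 2))\<close>. By
  nonnegativity it then vanishes to order \<open>2 m - 1\<close> as well, as long as \<open>u\<close> has that many derivatives.
  For the largest multiplicity \<open>N + 1\<close>, where only \<open>2 N\<close> derivatives exist, the condition says
  that \<open>\<phi>\<close> is the osculating polynomial.
\<close>

definition touches :: "nat \<Rightarrow> (real \<Rightarrow> real) \<Rightarrow> (real \<Rightarrow> real) \<Rightarrow> real multiset \<Rightarrow> bool" where
  "touches N u \<phi> Y \<longleftrightarrow> \<phi> \<in> trig_polys N \<and> (\<forall>t. u t \<le> \<phi> t) \<and>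
     (\<forall>s k. k < mult_at Y s \<longrightarrow> vanish_order (\<lambda>t. \<phi> t - u t) s (2 * k))"

locale circle_function =
  fixes N :: nat and u :: "real \<Rightarrow> real"
  assumes periodic: "periodic_2pi u" and smooth: "cont_diff (2 * N) u"
begin

abbreviation "T \<equiv> touches N u"

lemma u_periodic: "u (t + 2 * pi) = u t"
  using periodic unfolding periodic_2pi_def by simp

lemma u_isCont: "isCont u t"
  using cont_diff_isCont[OF smooth, of 0] by simp

lemma touches_trig_poly: "T \<phi> Y \<Longrightarrow> \<phi> \<in> trig_polys N"
  and touches_above: "T \<phi> Y \<Longrightarrow> u t \<le> \<phi> t"
  unfolding touches_def by auto

lemma gap_periodic: "\<phi> \<in> trig_polys N \<Longrightarrow> \<phi> (t + 2 * pi) - u (t + 2 * pi) = \<phi> t - u t"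
  by (simp add: trig_polys_periodic u_periodic)

lemma gap_cont_diff: "\<phi> \<in> trig_polys N \<Longrightarrow> k \<le> 2 * N \<Longrightarrow> cont_diff k (\<lambda>t. \<phi> t - u t)"
  by (intro cont_diff_diff trig_polys_cont_diff cont_diff_le[OF smooth])

lemma gap_isCont: "\<phi> \<in> trig_polys N \<Longrightarrow> isCont (\<lambda>t. \<phi> t - u t) t"
  by (intro continuous_intros u_isCont trig_polys_isCont)

lemma gap_vanish_order_cis:
  assumes "\<phi> \<in> trig_polys N" "cis s = cis s'" "vanish_order (\<lambda>t. \<phi> t - u t) s k"
  shows "vanish_order (\<lambda>t. \<phi> t - u t) s' k"
  by (rule vanish_order_cong_cis[of "\<lambda>t. \<phi> t - u t", OF _ assms(2,3)]) (rule gap_periodic[OF assms(1)])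

lemma touches_mono: "T \<phi> Y \<Longrightarrow> X \<subseteq># Y \<Longrightarrow> T \<phi> X"
  unfolding touches_def using mult_at_mono less_le_trans by blast

lemma touches_mult_at_cong: "T \<phi> X \<Longrightarrow> (\<And>s. mult_at Y s \<le> mult_at X s) \<Longrightarrow> T \<phi> Y"
  unfolding touches_def using less_le_trans by blast

lemma touches_cis: "cis x = cis y \<Longrightarrow> T \<phi> (add_mset x X) \<Longrightarrow> T \<phi> (add_mset y X)"
  by (erule touches_mult_at_cong) auto

lemma touches_add_value: "T \<phi> (add_mset t X) \<Longrightarrow> \<phi> t = u t"
proof -
  assume T: "T \<phi> (add_mset t X)"
  then have "vanish_order (\<lambda>t. \<phi> t - u t) t (2 * 0)" unfolding touches_def
    by (metis mult_at_simps(2) zero_less_Suc)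
  then show ?thesis using vanish_order_value gap_isCont[OF touches_trig_poly[OF T]] by fastforce
qed

lemma touches_single_iff: "T \<phi> {#t#} \<longleftrightarrow> \<phi> \<in> trig_polys N \<and> (\<forall>t. u t \<le> \<phi> t) \<and> \<phi> t = u t"
proof
  assume "T \<phi> {#t#}"
  then show "\<phi> \<in> trig_polys N \<and> (\<forall>t. u t \<le> \<phi> t) \<and> \<phi> t = u t"
    using touches_add_value touches_above touches_trig_poly by blast
next
  assume a: "\<phi> \<in> trig_polys N \<and> (\<forall>t. u t \<le> \<phi> t) \<and> \<phi> t = u t"
  have "vanish_order (\<lambda>t. \<phi> t - u t) s 0" if "cis t = cis s" for s
  proof (rule gap_vanish_order_cis[OF _ that])
    show "vanish_order (\<lambda>t. \<phi> t - u t) t 0" using a vanish_order_0[OF gap_isCont] by simp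
  qed (use a in auto)
  then show "T \<phi> {#t#}" using a unfolding touches_def by auto
qed

lemma touches_vanish_order:
  assumes T: "T \<phi> X" and m: "mult_at X s > 0" "mult_at X s \<le> N"
  shows "vanish_order (\<lambda>t. \<phi> t - u t) s (2 * mult_at X s - 1)"
proof -
  obtain k where k: "mult_at X s = Suc k" using m(1) by (cases "mult_at X s") auto
  have "vanish_order (\<lambda>t. \<phi> t - u t) s (2 * k + 1)"
  proof (rule vanish_order_nonneg)
    show "cont_diff (2 * k + 1) (\<lambda>t. \<phi> t - u t)" using gap_cont_diff[OF touches_trig_poly[OF T]] k m by auto
    show "vanish_order (\<lambda>t. \<phi> t - u t) s (2 * k)" using T k unfolding touches_def by auto
    show "\<phi> t - u t \<ge> 0" for t using touches_above[OF T, of t] by simp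
  qed
  then show ?thesis by (simp add: k)
qed

text \<open>
  Two polynomials that touch \<open>u\<close> in \<open>X\<close> are compared through the quotient of their difference by the
  weight of \<open>X\<close>. Near a further contact \<open>y\<close> of one of them, the gap of that polynomial is negligible against
  the weight of \<open>X\<close>, so the sign of the quotient at \<open>y\<close> is decided by the gap of the other one, which is
  nonnegative. If the quotient vanishes at \<open>y\<close>, both gaps are negligible and both polynomials have the
  further contact.
\<close>

lemma touches_factor:
  assumes "T \<phi> X" "T \<phi>' X" "size X \<le> N"
  obtains \<alpha> where "\<alpha> \<in> trig_polys (N - size X)" "\<And>t. \<phi>' t - \<phi> t = weight X t * \<alpha> t"
proof -
  have "\<exists>\<alpha>\<in>trig_polys (N - size X). (\<lambda>t. \<phi>' t - \<phi> t) = (\<lambda>t. weight X t * \<alpha> t)"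
  proof (rule trig_poly_divide_weight)
    show "(\<lambda>t. \<phi>' t - \<phi> t) \<in> trig_polys N" using assms touches_trig_poly by (intro trig_polys_diff)
    fix s assume s: "mult_at X s > 0"
    have "mult_at X s \<le> N" using mult_at_le_size[of X s] assms(3) by simp
    then have "vanish_order (\<lambda>t. (\<phi>' t - u t) - (\<phi> t - u t)) s (2 * mult_at X s - 1)"
      using s assms by (intro vanish_order_diff touches_vanish_order)
    then show "vanish_order (\<lambda>t. \<phi>' t - \<phi> t) s (2 * mult_at X s - 1)" by simp
  qed (use assms in simp)
  then show thesis using that by (metis (no_types, lifting))
qed

lemma touches_factor_nonneg:
  assumes T: "T \<phi> (add_mset y X)" and above: "\<And>t. u t \<le> \<phi>' t"
    and eq: "\<And>t. \<phi>' t - \<phi> t = weight X t * \<alpha> t" and c: "isCont \<alpha> y"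
  shows "0 \<le> \<alpha> y"
proof -
  have "vanish_order (\<lambda>t. \<phi> t - u t) y (2 * mult_at X y + 0)"
    using T unfolding touches_def by auto
  then have "vanish_order (\<lambda>t. (\<phi> t - u t) / weight X t) y 0"
    by (rule vanish_order_divide_weight)
  then have "((\<lambda>t. (\<phi> t - u t) / weight X t) \<longlongrightarrow> 0) (at y)" by (simp add: vanish_order_def)
  then have "((\<lambda>t. \<alpha> t + (\<phi> t - u t) / weight X t) \<longlongrightarrow> \<alpha> y + 0) (at y)"
    using c unfolding isCont_def by (intro tendsto_add)
  moreover have "\<forall>\<^sub>F t in at y. 0 \<le> \<alpha> t + (\<phi> t - u t) / weight X t"
    using weight_eventually_nonzero[of X y]
  proof (rule eventually_mono)
    fix t assume "weight X t \<noteq> 0"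
    then have "\<alpha> t + (\<phi> t - u t) / weight X t = (\<phi>' t - u t) / weight X t"
      using eq[of t] by (simp add: field_simps)
    then show "0 \<le> \<alpha> t + (\<phi> t - u t) / weight X t"
      using above[of t] weight_nonneg[of X t] by simp
  qed
  ultimately show ?thesis using tendsto_lowerbound by fastforce
qed

lemma touches_factor_nonpos:
  assumes T: "T \<phi>' (add_mset y X)" and above: "\<And>t. u t \<le> \<phi> t"
    and eq: "\<And>t. \<phi>' t - \<phi> t = weight X t * \<alpha> t" and c: "isCont \<alpha> y"
  shows "\<alpha> y \<le> 0"
proof -
  have "0 \<le> - \<alpha> y"
    by (rule touches_factor_nonneg[OF T above]) (use eq c in \<open>auto simp: algebra_simps\<close>)
  then show ?thesis by simp
qed

lemma touches_factor_zero:
  assumes T': "T \<phi>' (add_mset y X)" and T: "T \<phi> X"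
    and eq: "\<And>t. \<phi>' t - \<phi> t = weight X t * \<alpha> t" and c: "isCont \<alpha> y" and z: "\<alpha> y = 0"
  shows "T \<phi> (add_mset y X)"
  unfolding touches_def
proof (intro conjI allI impI)
  show "\<phi> \<in> trig_polys N" "\<And>t. u t \<le> \<phi> t" using T touches_trig_poly touches_above by auto
  have "vanish_order (\<lambda>t. (\<phi>' t - u t) - weight X t * \<alpha> t) y (2 * mult_at X y + 0)"
  proof (rule vanish_order_diff)
    show "vanish_order (\<lambda>t. \<phi>' t - u t) y (2 * mult_at X y + 0)" using T' unfolding touches_def by auto
    show "vanish_order (\<lambda>t. weight X t * \<alpha> t) y (2 * mult_at X y + 0)"
      using vanish_order_0[OF c] z by (intro vanish_order_times_weight) simp
  qed
  moreover have "(\<lambda>t. (\<phi>' t - u t) - weight X t * \<alpha> t) = (\<lambda>t. \<phi> t - u t)" using eq by (auto simp: fun_eq_iff algebra_simps)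
  ultimately have vy: "vanish_order (\<lambda>t. \<phi> t - u t) y (2 * mult_at X y)" by simp
  fix s k assume k: "k < mult_at (add_mset y X) s"
  show "vanish_order (\<lambda>t. \<phi> t - u t) s (2 * k)"
  proof (cases "k < mult_at X s")
    case True
    then show ?thesis using T unfolding touches_def by auto
  next
    case False
    with k have "cis y = cis s" "k = mult_at X s" by (auto split: if_splits)
    moreover from this have "mult_at X s = mult_at X y" by (simp add: mult_at_def)
    ultimately show ?thesis using gap_vanish_order_cis[OF touches_trig_poly[OF T] _ vy] by simp
  qed
qed

text \<open>
  The quotient of the difference by the weight of \<open>X\<close> is a constant, and the additional contacts force
  it to be both nonnegative and nonpositive.
\<close>

lemma touches_unique:
  assumes "size X = N" "T \<phi> (add_mset x X)" "T \<phi>' (add_mset x' X)"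
  shows "\<phi> = \<phi>'"
proof -
  have T: "T \<phi> X" "T \<phi>' X" using assms(2,3) by (auto elim: touches_mono)
  obtain \<alpha> where \<alpha>: "\<alpha> \<in> trig_polys (N - size X)" "\<And>t. \<phi>' t - \<phi> t = weight X t * \<alpha> t"
    using touches_factor[OF T] assms(1) by auto
  then obtain c where c: "\<alpha> = (\<lambda>t. c)" using assms(1) trig_polys_0_iff by auto
  have "0 \<le> \<alpha> x" by (rule touches_factor_nonneg[OF assms(2) touches_above[OF T(2)] \<alpha>(2)]) (simp add: c)
  moreover have "\<alpha> x' \<le> 0" by (rule touches_factor_nonpos[OF assms(3) touches_above[OF T(1)] \<alpha>(2)]) (simp add: c)
  ultimately have "c = 0" unfolding c by simp
  then show ?thesis using \<alpha>(2) c by (auto simp: fun_eq_iff)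
qed

text \<open>
  On an arc of coincidence all derivatives of the gap vanish, at the end points by continuity, so the
  contact has the largest possible multiplicity there.
\<close>

lemma touches_arc:
  assumes "a < b" "s \<in> {a..b}" and arc: "\<And>t. t \<in> {a..b} \<Longrightarrow> \<phi> t = u t" and T: "T \<phi> Z"
  shows "T \<phi> (Z + replicate_mset (Suc N - mult_at Z s) s)"
  unfolding touches_def
proof (intro conjI allI impI)
  show phi: "\<phi> \<in> trig_polys N" "\<And>t. u t \<le> \<phi> t" using T touches_trig_poly touches_above by auto
  fix r k assume k: "k < mult_at (Z + replicate_mset (Suc N - mult_at Z s) s) r"
  show "vanish_order (\<lambda>t. \<phi> t - u t) r (2 * k)"
  proof (cases "k < mult_at Z r")
    case True
    then show ?thesis using T unfolding touches_def by auto
  next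
    case False
    with k have cs: "cis s = cis r" by (auto split: if_splits)
    moreover from this have "mult_at Z s = mult_at Z r" by (simp add: mult_at_def)
    ultimately have "k \<le> N" using k False by auto
    then have "vanish_order (\<lambda>t. \<phi> t - u t) s (2 * k)"
      using assms(1,2) by (intro vanish_order_zero_on_interval[of _ _ a b] gap_cont_diff phi) (auto simp: arc)
    then show ?thesis by (rule gap_vanish_order_cis[OF phi(1) cs])
  qed
qed

section \<open>Existence of supporting polynomials\<close>

text \<open>
  Hermite interpolation in Newton's form: a new point \<open>x\<close> adds a combination of the weight of the old points
  and its product with \<open>sin (t - x)\<close>, whose coefficients correct the next two Taylor coefficients at \<open>x\<close>.
\<close>

lemma hermite_interpolation:
  assumes "size X \<le> N"
  shows "\<exists>\<psi>\<in>trig_polys (size X). \<forall>s. mult_at X s > 0 \<longrightarrow> vanish_order (\<lambda>t. u t - \<psi> t) s (2 * mult_at X s - 1)"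
  using assms
proof (induction X)
  case empty
  then show ?case using trig_polys_const[of 0 0] by auto
next
  case (add x X)
  then obtain \<psi> where \<psi>: "\<psi> \<in> trig_polys (size X)"
    "\<And>s. mult_at X s > 0 \<Longrightarrow> vanish_order (\<lambda>t. u t - \<psi> t) s (2 * mult_at X s - 1)" by auto
  define k where "k = mult_at X x"
  have kN: "k < N" using mult_at_le_size[of X x] add.prems by (simp add: k_def)
  obtain d where d: "d > 0" "((\<lambda>t. weight X t / (t - x) ^ (2 * k)) \<longlongrightarrow> d) (at x)"
    using weight_leading[of X x] unfolding k_def by blast
  have smooth': "cont_diff j (\<lambda>t. u t - \<rho> t)" if "\<rho> \<in> trig_polys m" "j \<le> 2 * N" for \<rho> j m
    using that by (intro cont_diff_diff cont_diff_le[OF smooth] trig_polys_cont_diff)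
  \<comment> \<open>the coefficient of the weight\<close>
  have "\<exists>c. ((\<lambda>t. (u t - \<psi> t) / (t - x) ^ (2 * k)) \<longlongrightarrow> c) (at x)"
  proof (cases k)
    case 0
    have "isCont (\<lambda>t. u t - \<psi> t) x" using u_isCont trig_polys_isCont[OF \<psi>(1)] by (intro continuous_intros)
    then show ?thesis unfolding isCont_def using 0 by auto
  next
    case (Suc j)
    then have "vanish_order (\<lambda>t. u t - \<psi> t) x (2 * k - 1)" using \<psi>(2)[of x] by (simp add: k_def)
    then show ?thesis
      using vanish_order_next_coefficient[of "2 * k - 1" "\<lambda>t. u t - \<psi> t" x] smooth'[OF \<psi>(1)] kN Suc by simp
  qed
  then obtain c where c: "((\<lambda>t. (u t - \<psi> t) / (t - x) ^ (2 * k)) \<longlongrightarrow> c) (at x)" by blast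
  define \<psi>1 where "\<psi>1 = (\<lambda>t. 1 * \<psi> t + (c / d) * weight X t)"
  have \<psi>1: "\<psi>1 \<in> trig_polys (size X)" unfolding \<psi>1_def by (intro trig_polys_combine \<psi>(1) weight_trig_poly)
  have v1: "vanish_order (\<lambda>t. u t - \<psi>1 t) x (2 * k)"
  proof -
    have "((\<lambda>t. (u t - \<psi> t) / (t - x) ^ (2 * k) - (c / d) * (weight X t / (t - x) ^ (2 * k))) \<longlongrightarrow> c - (c / d) * d) (at x)"
      by (intro tendsto_intros c d)
    then show ?thesis unfolding vanish_order_def \<psi>1_def using d(1) by (simp add: diff_divide_distrib add_divide_distrib algebra_simps)
  qed
  obtain c' where c': "((\<lambda>t. (u t - \<psi>1 t) / (t - x) ^ Suc (2 * k)) \<longlongrightarrow> c') (at x)"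
    using vanish_order_next_coefficient[OF smooth'[OF \<psi>1] v1] kN by auto
  define \<psi>2 where "\<psi>2 = (\<lambda>t. 1 * \<psi>1 t + (c' / d) * (sin (t - x) * weight X t))"
  have "\<psi>2 \<in> trig_polys (size (add_mset x X))" unfolding \<psi>2_def
    using trig_polys_times_shift(2)[OF weight_trig_poly[of X], of x] trig_polys_mono[OF \<psi>1]
    by (intro trig_polys_combine) auto
  moreover have "vanish_order (\<lambda>t. u t - \<psi>2 t) s (2 * mult_at (add_mset x X) s - 1)"
    if s: "mult_at (add_mset x X) s > 0" for s
  proof (cases "cis x = cis s")
    case True
    have "((\<lambda>t. (u t - \<psi>1 t) / (t - x) ^ Suc (2 * k) - (c' / d) * ((sin (t - x) / (t - x)) * (weight X t / (t - x) ^ (2 * k))))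
        \<longlongrightarrow> c' - (c' / d) * (1 * d)) (at x)"
      by (intro tendsto_intros c' d tendsto_sin_quot)
    then have "vanish_order (\<lambda>t. u t - \<psi>2 t) x (Suc (2 * k))"
      unfolding vanish_order_def \<psi>2_def using d(1) by (simp add: diff_divide_distrib add_divide_distrib algebra_simps)
    moreover have "k = mult_at X s" using True by (simp add: k_def mult_at_def)
    ultimately show ?thesis using True
        vanish_order_cong_cis[of "\<lambda>t. u t - \<psi>2 t" x s "Suc (2 * k)"]
        trig_polys_periodic[OF \<open>\<psi>2 \<in> trig_polys (size (add_mset x X))\<close>] u_periodic by simp
  next
    case False
    then have m: "mult_at X s > 0" "mult_at (add_mset x X) s = mult_at X s" using s by auto
    have w: "vanish_order (weight X) s (2 * mult_at X s - 1)"
    proof -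
      obtain e where e: "((\<lambda>t. weight X t / (t - s) ^ (2 * mult_at X s)) \<longlongrightarrow> e) (at s)"
        using weight_leading by blast
      have "((\<lambda>t. (t - s) * (weight X t / (t - s) ^ (2 * mult_at X s))) \<longlongrightarrow> (s - s) * e) (at s)"
        by (intro tendsto_intros e)
      moreover have "(t - s) * (weight X t / (t - s) ^ (2 * mult_at X s)) = weight X t / (t - s) ^ (2 * mult_at X s - 1)" for t
        using m(1) by (cases "mult_at X s") (auto)
      ultimately show ?thesis unfolding vanish_order_def by simp
    qed
    have "((\<lambda>t. c / d + (c' / d) * sin (t - x)) \<longlongrightarrow> c / d + (c' / d) * sin (s - x)) (at s)"
      by (intro tendsto_intros)
    from vanish_order_diff[OF \<psi>(2)[OF m(1)] vanish_order_mult[OF w this]]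
    show ?thesis unfolding m(2) \<psi>2_def \<psi>1_def by (simp add: algebra_simps)
  qed
  ultimately show ?case by blast
qed

text \<open>
  Let \<open>\<psi>\<close> interpolate \<open>u\<close> to second order in \<open>X\<close>. The polynomials with this property are
  \<open>\<psi> + c * weight X\<close>, and the smallest \<open>c\<close> for which this lies above \<open>u\<close> is the maximum of
  \<open>(u - \<psi>) / weight X\<close>, which extends continuously to the circle. Where the maximum is attained there is
  one more contact, possibly at a point of \<open>X\<close> itself.
\<close>

lemma touches_exists:
  assumes "size X = N"
  shows "\<exists>\<phi> t. T \<phi> (add_mset t X)"
proof -
  obtain \<psi> where \<psi>: "\<psi> \<in> trig_polys N"
    "\<And>s. mult_at X s > 0 \<Longrightarrow> vanish_order (\<lambda>t. u t - \<psi> t) s (2 * mult_at X s - 1)"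
    using hermite_interpolation[of X] assms by auto
  have fC: "isCont (\<lambda>t. u t - \<psi> t) t" for t
    using u_isCont trig_polys_isCont[OF \<psi>(1)] by (intro continuous_intros)
  have smooth': "cont_diff j (\<lambda>t. u t - \<psi> t)" if "j \<le> 2 * N" for j
    using that \<psi>(1) by (intro cont_diff_diff cont_diff_le[OF smooth] trig_polys_cont_diff)
  \<comment> \<open>the quotient extends continuously over the zeros of the weight\<close>
  define h where "h = (\<lambda>t. (u t - \<psi> t) / weight X t)"
  have "\<exists>l. (h \<longlongrightarrow> l) (at s)" for s
  proof -
    obtain d where d: "d > 0" "((\<lambda>t. weight X t / (t - s) ^ (2 * mult_at X s)) \<longlongrightarrow> d) (at s)"
      using weight_leading[of X s] by blast
    have mN: "mult_at X s \<le> N" using mult_at_le_size[of X s] assms by simp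
    have "\<exists>c. ((\<lambda>t. (u t - \<psi> t) / (t - s) ^ (2 * mult_at X s)) \<longlongrightarrow> c) (at s)"
    proof (cases "mult_at X s")
      case 0
      then show ?thesis using fC[of s] unfolding isCont_def by auto
    next
      case (Suc j)
      then show ?thesis
        using vanish_order_next_coefficient[of "2 * mult_at X s - 1" "\<lambda>t. u t - \<psi> t" s] \<psi>(2)[of s] smooth' mN by simp
    qed
    then obtain c where c: "((\<lambda>t. (u t - \<psi> t) / (t - s) ^ (2 * mult_at X s)) \<longlongrightarrow> c) (at s)" by blast
    have "((\<lambda>t. ((u t - \<psi> t) / (t - s) ^ (2 * mult_at X s)) / (weight X t / (t - s) ^ (2 * mult_at X s))) \<longlongrightarrow> c / d) (at s)"
      using d(1) by (intro tendsto_divide c d) simp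
    moreover have "\<forall>\<^sub>F t in at s. ((u t - \<psi> t) / (t - s) ^ (2 * mult_at X s)) / (weight X t / (t - s) ^ (2 * mult_at X s)) = h t"
    proof -
      have "\<forall>\<^sub>F t in at s. t \<noteq> s" by (simp add: eventually_at_filter)
      then show ?thesis by (rule eventually_mono) (simp add: h_def)
    qed
    ultimately have "(h \<longlongrightarrow> c / d) (at s)" by (rule Lim_transform_eventually)
    then show ?thesis by blast
  qed
  then obtain H where H: "\<And>s. (h \<longlongrightarrow> H s) (at s)" by metis
  have hH: "h t = H t" if "weight X t \<noteq> 0" for t
  proof -
    have "isCont h t" unfolding h_def isCont_def
      using that weight_isCont fC unfolding isCont_def by (intro tendsto_divide)
    then show ?thesis using H[of t] unfolding isCont_def by (auto intro: LIM_unique)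
  qed
  have HC: "isCont H t" for t
  proof -
    have "\<forall>\<^sub>F s in at t. h s = H s"
      using weight_eventually_nonzero[of X t] by (rule eventually_mono) (simp add: hH)
    with H[of t] show ?thesis unfolding isCont_def by (rule Lim_transform_eventually)
  qed
  have wper: "weight X (t + 2 * pi) = weight X t" for t
    using trig_polys_periodic[OF weight_trig_poly] .
  have hper: "h (t + 2 * pi) = h t" for t unfolding h_def using trig_polys_periodic[OF \<psi>(1)] wper u_periodic by simp
  have Hper: "H (t + 2 * pi) = H t" for t
  proof -
    have "((\<lambda>s. h (s + 2 * pi)) \<longlongrightarrow> H (t + 2 * pi)) (at t)"
      using LIM_offset[OF H[of "t + 2 * pi"], of "2 * pi"] by simp
    then show ?thesis using H[of t] by (auto simp: hper intro: LIM_unique)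
  qed
  have "continuous_on {0..2 * pi} H" using HC by (simp add: continuous_at_imp_continuous_on)
  then obtain t0 where t0: "t0 \<in> {0..2 * pi}" "\<And>t. t \<in> {0..2 * pi} \<Longrightarrow> H t \<le> H t0"
    using continuous_attains_sup[of "{0..2 * pi}" H] by auto
  have max: "H t \<le> H t0" for t
  proof -
    obtain s where "s \<in> {0..<0 + 2 * pi}" "cis s = cis t" using cis_representative by blast
    then show ?thesis using t0(2)[of s] periodic_cis[of H s t] Hper by auto
  qed
  define \<phi> where "\<phi> = (\<lambda>t. 1 * \<psi> t + H t0 * weight X t)"
  have \<phi>: "\<phi> \<in> trig_polys N" unfolding \<phi>_def
    using weight_trig_poly[of X] assms by (intro trig_polys_combine \<psi>(1)) simp
  have above: "u t \<le> \<phi> t" for t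
  proof (cases "weight X t = 0")
    case True
    then have "vanish_order (\<lambda>t. u t - \<psi> t) t (2 * mult_at X t - 1)"
      using \<psi>(2)[of t] weight_eq_0_iff[of X t] by simp
    from vanish_order_value[OF this fC] have "u t - \<psi> t = 0" .
    then show ?thesis by (simp add: \<phi>_def True)
  next
    case False
    then have "u t - \<psi> t = H t * weight X t" using hH[of t] by (simp add: h_def field_simps)
    also have "\<dots> \<le> H t0 * weight X t" using max weight_nonneg by (intro mult_right_mono)
    finally show ?thesis by (simp add: \<phi>_def)
  qed
  have vX: "vanish_order (\<lambda>t. \<phi> t - u t) s (2 * k)" if "k < mult_at X s" for k s
  proof -
    have "vanish_order (\<lambda>t. weight X t * H t0) s (2 * mult_at X s - 1)"
    proof -
      obtain e where e: "((\<lambda>t. weight X t / (t - s) ^ (2 * mult_at X s)) \<longlongrightarrow> e) (at s)"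
        using weight_leading by blast
      have "((\<lambda>t. H t0 * (t - s) * (weight X t / (t - s) ^ (2 * mult_at X s))) \<longlongrightarrow> H t0 * (s - s) * e) (at s)"
        by (intro tendsto_intros e)
      moreover have "H t0 * (t - s) * (weight X t / (t - s) ^ (2 * mult_at X s)) = (weight X t * H t0) / (t - s) ^ (2 * mult_at X s - 1)" for t
        using that by (cases "mult_at X s") auto
      ultimately show ?thesis unfolding vanish_order_def by simp
    qed
    from vanish_order_diff[OF this \<psi>(2)] that
    have "vanish_order (\<lambda>t. \<phi> t - u t) s (2 * mult_at X s - 1)" unfolding \<phi>_def by (simp add: algebra_simps)
    then show ?thesis by (rule vanish_order_mono) (use that in simp)
  qed
  have v0: "vanish_order (\<lambda>t. \<phi> t - u t) t0 (2 * mult_at X t0)"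
  proof -
    have "((\<lambda>t. H t0 - h t) \<longlongrightarrow> H t0 - H t0) (at t0)" by (intro tendsto_intros H)
    then have "vanish_order (\<lambda>t. H t0 - h t) t0 0" by (simp add: vanish_order_def)
    then have "vanish_order (\<lambda>t. weight X t * (H t0 - h t)) t0 (2 * mult_at X t0 + 0)"
      by (rule vanish_order_times_weight)
    moreover have "\<forall>\<^sub>F t in at t0. weight X t * (H t0 - h t) = \<phi> t - u t"
      using weight_eventually_nonzero[of X t0]
      by (rule eventually_mono) (simp add: h_def \<phi>_def field_simps)
    ultimately show ?thesis using vanish_order_cong by fastforce
  qed
  have "T \<phi> (add_mset t0 X)" unfolding touches_def
  proof (intro conjI allI impI \<phi> above)
    fix s k assume k: "k < mult_at (add_mset t0 X) s"
    show "vanish_order (\<lambda>t. \<phi> t - u t) s (2 * k)"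
    proof (cases "k < mult_at X s")
      case False
      with k have "cis t0 = cis s" "k = mult_at X s" by (auto split: if_splits)
      moreover from this have "mult_at X s = mult_at X t0" by (simp add: mult_at_def)
      ultimately show ?thesis using gap_vanish_order_cis[OF \<phi> _ v0] by simp
    qed (rule vX)
  qed
  then show ?thesis by blast
qed

end

section \<open>Compactness\<close>

text \<open>
  Rolle's theorem for zeros with multiplicity: an \<open>m\<close>-fold zero of \<open>f\<close> is an \<open>(m - 1)\<close>-fold zero
  of the derivative, and a new zero appears between any two neighbours. The construction proceeds
  from left to right, so that the new zero lies beyond all those obtained before.
\<close>

lemma rolle_multiset_step:
  assumes d: "\<And>x. (f has_real_derivative f' x) (at x)"
  shows "finite S \<Longrightarrow> set_mset U = S \<Longrightarrow> S \<noteq> {} \<Longrightarrow> (\<And>y. y \<in> S \<Longrightarrow> f y = 0) \<Longrightarrow>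
    \<exists>U'. Suc (size U') = size U \<and> (\<forall>y\<in>#U'. (\<exists>x\<in>S. x \<le> y) \<and> (\<exists>x\<in>S. y \<le> x)) \<and>
      (\<forall>y. count U' y \<le> count U y - 1 \<or> count U' y \<le> 1 \<and> f' y = (0::real))"
proof (induction S arbitrary: U rule: finite_linorder_max_induct)
  case (insert b A)
  have bU: "b \<in># U" using insert.prems(1) by auto
  define U0 where "U0 = filter_mset (\<lambda>x. x \<noteq> b) U"
  have U: "U = U0 + replicate_mset (count U b) b" unfolding U0_def
    by (rule multiset_eqI) (auto)
  have sU: "size U = size U0 + count U b" by (subst U) simp
  have setU0: "set_mset U0 = A" using insert.prems(1) insert.hyps(2) unfolding U0_def by auto
  have cb: "count U b > 0" using bU by simp
  show ?case
  proof (cases "A = {}")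
    case True
    then have "U0 = {#}" using setU0 by simp
    then show ?thesis using sU cb bU
      by (intro exI[of _ "replicate_mset (count U b - 1) b"]) (auto simp: True)
  next
    case False
    obtain U1 where U1: "Suc (size U1) = size U0"
      "\<And>y. y \<in># U1 \<Longrightarrow> (\<exists>x\<in>A. x \<le> y) \<and> (\<exists>x\<in>A. y \<le> x)"
      "\<And>y. count U1 y \<le> count U0 y - 1 \<or> count U1 y \<le> 1 \<and> f' y = 0"
      using insert.IH[OF setU0 False] insert.prems(3) by blast
    define a where "a = Max A"
    have a: "a \<in> A" "\<And>x. x \<in> A \<Longrightarrow> x \<le> a" using False insert.hyps(1) unfolding a_def by auto
    have ab: "a < b" using insert.hyps(2) a by auto
    obtain \<xi> where \<xi>: "a < \<xi>" "\<xi> < b" "DERIV f \<xi> :> 0"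
    proof -
      have "\<exists>z>a. z < b \<and> DERIV f z :> 0"
      proof (rule Rolle[OF ab])
        show "f a = f b" using insert.prems(3) a(1) by simp
        show "continuous_on {a..b} f"
          using d DERIV_isCont by (blast intro: continuous_at_imp_continuous_on)
        show "f differentiable at x" if "a < x" "x < b" for x using d real_differentiable_def by blast
      qed
      then show thesis using that by blast
    qed
    have f\<xi>: "f' \<xi> = 0" using \<xi>(3) d DERIV_unique by blast
    have U1le: "y \<le> a" if "y \<in># U1" for y using U1(2)[OF that] a(2) by force
    show ?thesis
    proof (intro exI[of _ "U1 + {#\<xi>#} + replicate_mset (count U b - 1) b"] conjI allI ballI)
      show "Suc (size (U1 + {#\<xi>#} + replicate_mset (count U b - 1) b)) = size U"
        using sU U1(1) cb by simp
      fix y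
      show "\<exists>x\<in>insert b A. x \<le> y" "\<exists>x\<in>insert b A. y \<le> x"
        if y: "y \<in># U1 + {#\<xi>#} + replicate_mset (count U b - 1) b"
        using y U1(2)[of y] \<xi> a(1) by (auto split: if_splits intro: less_imp_le)
      have c1: "count U1 y = 0" if "y > a" using U1le[of y] that by (metis not_in_iff not_less)
      have c0: "count U0 y = count U y" if "y \<noteq> b" using that unfolding U0_def by simp
      show "count (U1 + {#\<xi>#} + replicate_mset (count U b - 1) b) y \<le> count U y - 1 \<or>
         count (U1 + {#\<xi>#} + replicate_mset (count U b - 1) b) y \<le> 1 \<and> f' y = 0"
      proof -
        consider "y = b" | "y = \<xi>" | "y \<noteq> b" "y \<noteq> \<xi>" by blast
        then show ?thesis
        proof cases
          case 1
          then show ?thesis using c1 ab \<xi> by simp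
        next
          case 2
          then show ?thesis using c1 \<xi> f\<xi> by simp
        next
          case 3
          then show ?thesis using U1(3)[of y] c0 by simp
        qed
      qed
    qed
  qed
qed simp

lemma rolle_multiset:
  assumes "cont_diff m f" "set_mset U \<subseteq> {c..d}" "Suc m \<le> size U"
    and "\<And>y i. i < count U y \<Longrightarrow> i \<le> m \<Longrightarrow> (deriv ^^ i) f y = 0"
  shows "\<exists>\<xi>\<in>{c..d}. (deriv ^^ m) f \<xi> = 0"
  using assms
proof (induction m arbitrary: f U)
  case 0
  then obtain y where "y \<in># U" by (metis Suc_le_eq multiset_nonemptyE size_empty less_irrefl)
  then show ?case using 0(2) 0(4)[of 0 y] by auto
next
  case (Suc m)
  have "\<exists>U'. Suc (size U') = size U \<and> (\<forall>y\<in>#U'. (\<exists>x\<in>set_mset U. x \<le> y) \<and> (\<exists>x\<in>set_mset U. y \<le> x)) \<and>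
      (\<forall>y. count U' y \<le> count U y - 1 \<or> count U' y \<le> 1 \<and> deriv f y = 0)"
  proof (rule rolle_multiset_step)
    show "(f has_real_derivative deriv f x) (at x)" for x
      using cont_diff_has_derivative[OF Suc.prems(1), of 0] by simp
    show "set_mset U \<noteq> {}" using Suc.prems(3) by auto
    show "f y = 0" if "y \<in> set_mset U" for y using Suc.prems(4)[of 0 y] that by simp
  qed auto
  then obtain U' where U': "Suc (size U') = size U"
    "\<And>y. y \<in># U' \<Longrightarrow> (\<exists>x\<in>set_mset U. x \<le> y) \<and> (\<exists>x\<in>set_mset U. y \<le> x)"
    "\<And>y. count U' y \<le> count U y - 1 \<or> count U' y \<le> 1 \<and> deriv f y = 0" by blast
  have sw: "(deriv ^^ i) (deriv f) = (deriv ^^ Suc i) f" for i by (simp add: funpow_swap1)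
  have "\<exists>\<xi>\<in>{c..d}. (deriv ^^ m) (deriv f) \<xi> = 0"
  proof (rule Suc.IH)
    show "cont_diff m (deriv f)"
      using Suc.prems(1) unfolding cont_diff_def sw by auto
    show "set_mset U' \<subseteq> {c..d}" using U'(2) Suc.prems(2) by force
    show "Suc m \<le> size U'" using U'(1) Suc.prems(3) by simp
    fix y i assume i: "i < count U' y" "i \<le> m"
    show "(deriv ^^ i) (deriv f) y = 0"
    proof (cases "count U' y \<le> count U y - 1")
      case True
      then show ?thesis unfolding sw using i by (intro Suc.prems(4)) auto
    next
      case False
      then have "i = 0" "deriv f y = 0" using U'(3)[of y] i by auto
      then show ?thesis by simp
    qed
  qed
  then show ?case unfolding sw .
qed

lemma finite_bounded_subsequence:
  fixes x :: "nat \<Rightarrow> 'i \<Rightarrow> real"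
  assumes "finite I" "\<And>i j. i \<in> I \<Longrightarrow> \<bar>x j i\<bar> \<le> B"
  shows "\<exists>r::nat \<Rightarrow> nat. strict_mono r \<and> (\<forall>i\<in>I. convergent (\<lambda>j. x (r j) i))"
  using assms
proof (induction I)
  case empty
  show ?case by (rule exI[of _ id]) (auto simp: strict_mono_def)
next
  case (insert i I)
  then obtain r :: "nat \<Rightarrow> nat" where r: "strict_mono r" "\<And>k. k \<in> I \<Longrightarrow> convergent (\<lambda>j. x (r j) k)" by auto
  have "\<forall>j. x (r j) i \<in> {-B..B}" using insert.prems[of i] by (auto simp: abs_le_iff minus_le_iff)
  then obtain l and q :: "nat \<Rightarrow> nat" where q: "strict_mono q" "((\<lambda>j. x (r j) i) \<circ> q) \<longlonglongrightarrow> l"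
    using compact_Icc[of "-B" B, unfolded compact_def] by metis
  have "convergent (\<lambda>j. x ((r \<circ> q) j) k)" if "k \<in> insert i I" for k
  proof (cases "k = i")
    case True
    then show ?thesis using q(2) unfolding convergent_def o_def by blast
  next
    case False
    then have "convergent (\<lambda>j. x (r j) k)" using r(2) that by blast
    from convergent_subseq_convergent[OF this q(1)] show ?thesis by (simp add: o_def)
  qed
  then show ?case using strict_mono_o[OF r(1) q(1)] by blast
qed

text \<open>
  An explicit form of the members of \<^term>\<open>trig_polys n\<close>, for limits of coefficients.
\<close>

definition trig_sum :: "nat \<Rightarrow> (nat \<Rightarrow> real) \<Rightarrow> (nat \<Rightarrow> real) \<Rightarrow> real \<Rightarrow> real" where
  "trig_sum n a b t = a 0 + (\<Sum>k=1..n. a k * cos (real k * t) + b k * sin (real k * t))"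

lemma trig_sum_combine:
  "c * trig_sum n a b t + d * trig_sum n a' b' t =
     trig_sum n (\<lambda>k. c * a k + d * a' k) (\<lambda>k. c * b k + d * b' k) t"
  unfolding trig_sum_def by (simp add: sum_distrib_left sum.distrib algebra_simps)

lemma trig_polys_iff: "f \<in> trig_polys n \<longleftrightarrow> (\<exists>a b. f = trig_sum n a b)"
  unfolding trig_polys_def trig_sum_def[abs_def] by auto

lemma deriv_trig_sum: "deriv (trig_sum n a b) = trig_sum n (\<lambda>k. real k * b k) (\<lambda>k. - real k * a k)"
proof
  fix t
  have "(trig_sum n a b has_real_derivative trig_sum n (\<lambda>k. real k * b k) (\<lambda>k. - real k * a k) t) (at t)"
    unfolding trig_sum_def[abs_def]
    by (auto intro!: derivative_eq_intros sum.cong simp: algebra_simps)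
  then show "deriv (trig_sum n a b) t = trig_sum n (\<lambda>k. real k * b k) (\<lambda>k. - real k * a k) t"
    by (rule DERIV_imp_deriv)
qed

lemma trig_sum_scale: "c * (deriv ^^ i) (trig_sum n a b) t = (deriv ^^ i) (trig_sum n (\<lambda>k. c * a k) (\<lambda>k. c * b k)) t"
proof (induction i arbitrary: a b)
  case 0
  show ?case by (simp add: trig_sum_def sum_distrib_left algebra_simps)
next
  case (Suc i)
  have eq: "(deriv ^^ Suc i) f = (deriv ^^ i) (deriv f)" for f :: "real \<Rightarrow> real" by (simp add: funpow_swap1)
  show ?case unfolding eq deriv_trig_sum Suc by (simp add: algebra_simps)
qed

lemma tendsto_deriv_trig_sum:
  assumes "\<And>k. k \<le> n \<Longrightarrow> (\<lambda>j. a j k) \<longlonglongrightarrow> a' k" "\<And>k. 1 \<le> k \<Longrightarrow> k \<le> n \<Longrightarrow> (\<lambda>j. b j k) \<longlonglongrightarrow> b' k"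
    and "x \<longlonglongrightarrow> s"
  shows "(\<lambda>j. (deriv ^^ i) (trig_sum n (a j) (b j)) (x j)) \<longlonglongrightarrow> (deriv ^^ i) (trig_sum n a' b') s"
  using assms(1,2)
proof (induction i arbitrary: a b a' b')
  case 0
  then show ?case unfolding trig_sum_def using assms(3) by (auto intro!: tendsto_intros)
next
  case (Suc i)
  have eq: "(deriv ^^ Suc i) f = (deriv ^^ i) (deriv f)" for f :: "real \<Rightarrow> real" by (simp add: funpow_swap1)
  show ?case unfolding eq deriv_trig_sum
  proof (rule Suc.IH)
    fix k assume k: "k \<le> n"
    show "(\<lambda>j. real k * b j k) \<longlonglongrightarrow> real k * b' k"
      by (cases "k = 0") (use k Suc.prems(2)[of k] in \<open>auto intro!: tendsto_intros\<close>)
    show "(\<lambda>j. - real k * a j k) \<longlonglongrightarrow> - real k * a' k"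
      using Suc.prems(1)[of k] k by (intro tendsto_intros)
  qed
qed

text \<open>
  Linear independence of the trigonometric system: applying \<open>(n + 1)\<^sup>2 + d\<^sup>2/dt\<^sup>2\<close> annihilates the
  terms of degree \<open>n + 1\<close> and multiplies the others by nonzero numbers.
\<close>

lemma trig_sum_eq_0:
  assumes "\<And>t. trig_sum n a b t = 0"
  shows "(\<forall>k\<le>n. a k = 0) \<and> (\<forall>k\<in>{1..n}. b k = 0)"
  using assms
proof (induction n arbitrary: a b)
  case 0
  then show ?case by (simp add: trig_sum_def)
next
  case (Suc n)
  let ?N = "real (Suc n)"
  have z: "trig_sum (Suc n) a b = (\<lambda>t. 0)" using Suc.prems by (rule ext)
  have "deriv (deriv (trig_sum (Suc n) a b)) t = 0" for t unfolding z by simp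
  then have d2: "trig_sum (Suc n) (\<lambda>k. real k * (- real k * a k)) (\<lambda>k. - real k * (real k * b k)) t = 0" for t
    unfolding deriv_trig_sum .
  have "trig_sum n (\<lambda>k. (?N\<^sup>2 - (real k)\<^sup>2) * a k) (\<lambda>k. (?N\<^sup>2 - (real k)\<^sup>2) * b k) t = 0" for t
  proof -
    have "trig_sum n (\<lambda>k. (?N\<^sup>2 - (real k)\<^sup>2) * a k) (\<lambda>k. (?N\<^sup>2 - (real k)\<^sup>2) * b k) t
      = trig_sum (Suc n) (\<lambda>k. (?N\<^sup>2 - (real k)\<^sup>2) * a k) (\<lambda>k. (?N\<^sup>2 - (real k)\<^sup>2) * b k) t"
      by (simp add: trig_sum_def)
    also have "\<dots> = ?N\<^sup>2 * trig_sum (Suc n) a b t +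
        1 * trig_sum (Suc n) (\<lambda>k. real k * (- real k * a k)) (\<lambda>k. - real k * (real k * b k)) t"
      unfolding trig_sum_combine by (intro arg_cong3[where f = "\<lambda>a b. trig_sum (Suc n) a b"] ext refl)
        (simp_all add: power2_eq_square algebra_simps)
    finally show ?thesis using d2 Suc.prems by simp
  qed
  from Suc.IH[OF this] have IH: "\<And>k. k \<le> n \<Longrightarrow> (?N\<^sup>2 - (real k)\<^sup>2) * a k = 0"
    "\<And>k. k \<in> {1..n} \<Longrightarrow> (?N\<^sup>2 - (real k)\<^sup>2) * b k = 0" by auto
  have nz: "?N\<^sup>2 - (real k)\<^sup>2 \<noteq> 0" if "k \<le> n" for k
  proof -
    have "(real k)\<^sup>2 < ?N\<^sup>2" using that by (intro power_strict_mono) auto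
    then show ?thesis by linarith
  qed
  have ab: "\<And>k. k \<le> n \<Longrightarrow> a k = 0" "\<And>k. k \<in> {1..n} \<Longrightarrow> b k = 0" using IH nz by auto
  have top: "a (Suc n) * cos (?N * t) + b (Suc n) * sin (?N * t) = 0" for t
    using Suc.prems[of t] ab by (simp add: trig_sum_def)
  have "a (Suc n) = 0" using top[of 0] by simp
  moreover have "?N * (pi / 2 / ?N) = pi / 2" by (simp del: of_nat_Suc)
  then have "b (Suc n) = 0" using top[of "pi / 2 / ?N"] by (simp only: cos_pi_half sin_pi_half mult_zero_right mult_1_right add_0)
  ultimately show ?case using ab by (auto simp: le_Suc_eq)
qed

context circle_function
begin

lemma touches_gap_deriv:
  assumes T: "T \<phi> Y" and i: "i < 2 * mult_at Y y" "i \<le> 2 * N"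
  shows "(deriv ^^ i) (\<lambda>t. \<phi> t - u t) y = 0"
proof -
  define k where "k = i div 2"
  have v: "vanish_order (\<lambda>t. \<phi> t - u t) y (2 * k)" using T i unfolding touches_def k_def by auto
  have "vanish_order (\<lambda>t. \<phi> t - u t) y i"
  proof (cases "even i")
    case True
    then show ?thesis using v by (simp add: k_def)
  next
    case False
    then have ik: "i = 2 * k + 1" by (simp add: k_def)
    show ?thesis unfolding ik
      using v i ik touches_above[OF T] by (intro vanish_order_nonneg gap_cont_diff touches_trig_poly[OF T]) auto
  qed
  then show ?thesis using vanish_order_iff_deriv[OF gap_cont_diff[OF touches_trig_poly[OF T] i(2)]] by simp
qed

text \<open>
  Contacts that converge to \<open>s\<close> add up: by Rolle's theorem the \<open>i\<close>-th derivative of the gap has a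
  zero close to \<open>s\<close>. The factors \<open>c j\<close> admit a rescaling of the polynomials, which is needed to exclude that
  their coefficients are unbounded.
\<close>

lemma touches_limit_deriv:
  fixes L :: "nat \<Rightarrow> real list"
  assumes T: "\<And>j. T (trig_sum N (a j) (b j)) (mset (L j))"
    and len: "\<And>j. length (L j) = length L'"
    and lim: "\<And>k. k < length L' \<Longrightarrow> (\<lambda>j. L j ! k) \<longlonglongrightarrow> L' ! k"
    and a: "\<And>k. k \<le> N \<Longrightarrow> (\<lambda>j. c j * a j k) \<longlonglongrightarrow> a' k"
    and b: "\<And>k. 1 \<le> k \<Longrightarrow> k \<le> N \<Longrightarrow> (\<lambda>j. c j * b j k) \<longlonglongrightarrow> b' k"
    and c: "c \<longlonglongrightarrow> c'"
    and i: "i < 2 * mult_at (mset L') s" "i \<le> 2 * N"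
  shows "(deriv ^^ i) (trig_sum N a' b') s = c' * (deriv ^^ i) u s"
proof -
  define I where "I = {k. k < length L' \<and> cis (L' ! k) = cis s}"
  have fI: "finite I" unfolding I_def by simp
  have cI: "card I = mult_at (mset L') s"
    unfolding I_def mult_at_def by (simp add: length_filter_conv_card flip: mset_filter)
  have "\<exists>z::int. L' ! k = s + 2 * pi * of_int z" if "k \<in> I" for k
    using that cis_eq_iff[of s "L' ! k"] unfolding I_def by auto
  then obtain z :: "nat \<Rightarrow> int" where z: "\<And>k. k \<in> I \<Longrightarrow> L' ! k = s + 2 * pi * of_int (z k)" by metis
  define x where "x = (\<lambda>j k. L j ! k - 2 * pi * of_int (z k))"
  have xlim: "(\<lambda>j. x j k) \<longlonglongrightarrow> s" if k: "k \<in> I" for k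
  proof -
    have "(\<lambda>j. L j ! k - 2 * pi * of_int (z k)) \<longlonglongrightarrow> L' ! k - 2 * pi * of_int (z k)"
      using k by (intro tendsto_intros lim) (simp add: I_def)
    then show ?thesis using z[OF k] by (simp add: x_def)
  qed
  \<comment> \<open>the contacts near \<open>s\<close>, moved by multiples of \<open>2 * pi\<close>, lie within distance \<open>\<epsilon> j\<close>\<close>
  define \<epsilon> where "\<epsilon> = (\<lambda>j. \<Sum>k\<in>I. \<bar>x j k - s\<bar>)"
  have \<epsilon>lim: "\<epsilon> \<longlonglongrightarrow> 0"
  proof -
    have "(\<lambda>j. \<Sum>k\<in>I. \<bar>x j k - s\<bar>) \<longlonglongrightarrow> (\<Sum>k\<in>I. \<bar>s - s\<bar>)"
      by (intro tendsto_intros xlim)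
    then show ?thesis by (simp add: \<epsilon>_def)
  qed
  have "\<exists>\<xi>. \<bar>\<xi> - s\<bar> \<le> \<epsilon> j \<and> (deriv ^^ i) (trig_sum N (a j) (b j)) \<xi> = (deriv ^^ i) u \<xi>" for j
  proof -
    let ?f = "\<lambda>t. trig_sum N (a j) (b j) t - u t"
    note P = touches_trig_poly[OF T[of j]]
    define V where "V = image_mset (x j) (mset_set I)"
    have cV: "count V y \<le> mult_at (mset (L j)) y" for y
    proof -
      have "count V y = card {k \<in> I. x j k = y}"
        unfolding V_def using fI by (simp add: count_image_mset vimage_def Int_def conj_commute cong: conj_cong)
      also have "\<dots> \<le> card {k. k < length (L j) \<and> cis (L j ! k) = cis y}"
      proof (rule card_mono)
        show "{k \<in> I. x j k = y} \<subseteq> {k. k < length (L j) \<and> cis (L j ! k) = cis y}"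
        proof clarify
          fix k assume k: "k \<in> I"
          have "cis (x j k) = cis (L j ! k)"
            unfolding cis_eq_iff x_def by (intro exI[of _ "z k"]) simp
          then show "k < length (L j) \<and> cis (L j ! k) = cis (x j k)" using k len unfolding I_def by simp
        qed
      qed simp
      also have "\<dots> = mult_at (mset (L j)) y"
        unfolding mult_at_def by (simp add: length_filter_conv_card flip: mset_filter)
      finally show ?thesis .
    qed
    \<comment> \<open>every contact is a double zero of the gap\<close>
    have "\<exists>\<xi>\<in>{s - \<epsilon> j..s + \<epsilon> j}. (deriv ^^ i) ?f \<xi> = 0"
    proof (rule rolle_multiset)
      show "cont_diff i ?f" by (rule gap_cont_diff[OF P i(2)])
      show "Suc i \<le> size (V + V)" using i(1) cI unfolding V_def by simp
      have "\<bar>x j k - s\<bar> \<le> \<epsilon> j" if "k \<in> I" for k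
        unfolding \<epsilon>_def using member_le_sum[OF that, of "\<lambda>k. \<bar>x j k - s\<bar>"] fI by simp
      then show "set_mset (V + V) \<subseteq> {s - \<epsilon> j..s + \<epsilon> j}" unfolding V_def using fI by (force simp: abs_le_iff)
      fix y i' assume i': "i' < count (V + V) y" "i' \<le> i"
      show "(deriv ^^ i') ?f y = 0"
        by (rule touches_gap_deriv[OF T]) (use i' cV[of y] i in auto)
    qed
    then obtain \<xi> where \<xi>: "\<xi> \<in> {s - \<epsilon> j..s + \<epsilon> j}" "(deriv ^^ i) ?f \<xi> = 0" by blast
    have "(deriv ^^ i) ?f \<xi> = (deriv ^^ i) (trig_sum N (a j) (b j)) \<xi> - (deriv ^^ i) u \<xi>"
      using fun_cong[OF deriv_pow_diff[OF trig_polys_cont_diff[OF P] smooth i(2)]] .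
    then show ?thesis using \<xi> by (intro exI[of _ \<xi>]) auto
  qed
  then obtain \<xi> where \<xi>: "\<And>j. \<bar>\<xi> j - s\<bar> \<le> \<epsilon> j"
    "\<And>j. (deriv ^^ i) (trig_sum N (a j) (b j)) (\<xi> j) = (deriv ^^ i) u (\<xi> j)" by metis
  have "(\<lambda>j. \<xi> j - s) \<longlonglongrightarrow> 0"
    by (rule Lim_null_comparison[OF _ \<epsilon>lim]) (use \<xi>(1) in simp)
  then have \<xi>s: "\<xi> \<longlonglongrightarrow> s" by (simp add: LIM_zero_iff)
  have "(\<lambda>j. (deriv ^^ i) (trig_sum N (\<lambda>k. c j * a j k) (\<lambda>k. c j * b j k)) (\<xi> j)) \<longlonglongrightarrow> (deriv ^^ i) (trig_sum N a' b') s"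
    by (intro tendsto_deriv_trig_sum a b \<xi>s)
  moreover have "(deriv ^^ i) (trig_sum N (\<lambda>k. c j * a j k) (\<lambda>k. c j * b j k)) (\<xi> j) = c j * (deriv ^^ i) u (\<xi> j)" for j
    using trig_sum_scale[symmetric] \<xi>(2) by simp
  ultimately have "(\<lambda>j. c j * (deriv ^^ i) u (\<xi> j)) \<longlonglongrightarrow> (deriv ^^ i) (trig_sum N a' b') s" by simp
  moreover have "(\<lambda>j. c j * (deriv ^^ i) u (\<xi> j)) \<longlonglongrightarrow> c' * (deriv ^^ i) u s"
    by (intro tendsto_mult c isCont_tendsto_compose[OF cont_diff_isCont[OF smooth i(2)]] \<xi>s)
  ultimately show ?thesis using LIMSEQ_unique by blast
qed

lemma touches_from_derivs:
  assumes \<phi>: "\<phi> \<in> trig_polys N" "\<And>t. u t \<le> \<phi> t" and size: "size Y \<le> Suc N"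
    and d: "\<And>s i. i < 2 * mult_at Y s \<Longrightarrow> i \<le> 2 * N \<Longrightarrow> (deriv ^^ i) \<phi> s = (deriv ^^ i) u s"
  shows "T \<phi> Y"
  unfolding touches_def
proof (intro conjI allI impI \<phi>)
  fix s k assume k: "k < mult_at Y s"
  then have kN: "2 * k \<le> 2 * N" using mult_at_le_size[of Y s] size by simp
  have "(deriv ^^ i) (\<lambda>t. \<phi> t - u t) s = 0" if "i \<le> 2 * k" for i
    using d[of i s] deriv_pow_diff[OF trig_polys_cont_diff[OF \<phi>(1)] smooth, of i] that k kN by auto
  then show "vanish_order (\<lambda>t. \<phi> t - u t) s (2 * k)"
    using vanish_order_iff_deriv[OF gap_cont_diff[OF \<phi>(1) kN]] by simp
qed

end

lemma circle_function_0: "circle_function N (\<lambda>t. 0)"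
proof
  show "periodic_2pi (\<lambda>t. 0)" by (simp add: periodic_2pi_def)
  show "cont_diff (2 * N) (\<lambda>t. 0)" by (rule trig_polys_cont_diff[OF trig_polys_const])
qed

context circle_function
begin

text \<open>
  The coefficients are divided by \<open>1 + \<rho>\<close>, where \<open>\<rho>\<close> is the sum of their absolute values, and a convergent
  subsequence is chosen. If \<open>\<rho>\<close> were unbounded along it, the limit would be a nonnegative trigonometric
  polynomial that touches the zero function in \<open>N + 1\<close> points. By uniqueness it would be zero, although
  its coefficients have absolute sum \<open>1\<close>.
\<close>

lemma touches_compact_list:
  fixes L :: "nat \<Rightarrow> real list"
  assumes T: "\<And>j. T (\<phi> j) (mset (L j))"
    and len: "\<And>j. length (L j) = Suc N"
    and bound: "\<And>j x. x \<in> set (L j) \<Longrightarrow> \<bar>x\<bar> \<le> B"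
  shows "\<exists>(r :: nat \<Rightarrow> nat) \<phi>' L'. strict_mono r \<and> length L' = Suc N \<and> (\<forall>k<Suc N. (\<lambda>j. L (r j) ! k) \<longlonglongrightarrow> L' ! k) \<and>
    (\<forall>t. (\<lambda>j. \<phi> (r j) t) \<longlonglongrightarrow> \<phi>' t) \<and> T \<phi>' (mset L')"
proof -
  have "\<forall>j. \<exists>a b. \<phi> j = trig_sum N a b" using touches_trig_poly[OF T] trig_polys_iff by blast
  then obtain a b where ab: "\<And>j. \<phi> j = trig_sum N (a j) (b j)" by metis
  define \<rho> where "\<rho> = (\<lambda>j. (\<Sum>k\<le>N. \<bar>a j k\<bar>) + (\<Sum>k\<in>{1..N}. \<bar>b j k\<bar>))"
  have \<rho>0: "\<rho> j \<ge> 0" for j unfolding \<rho>_def by (intro add_nonneg_nonneg sum_nonneg) auto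
  define c where "c = (\<lambda>j. 1 / (1 + \<rho> j))"
  have c0: "c j > 0" "c j \<le> 1" for j using \<rho>0[of j] unfolding c_def by auto
  have nn: "0 \<le> (\<Sum>k\<le>N. \<bar>a j k\<bar>)" "0 \<le> (\<Sum>k\<in>{1..N}. \<bar>b j k\<bar>)" for j
    by (intro sum_nonneg; simp)+
  have a\<rho>: "\<bar>a j k\<bar> \<le> \<rho> j" if "k \<le> N" for j k
  proof -
    have "\<bar>a j k\<bar> \<le> (\<Sum>k\<le>N. \<bar>a j k\<bar>)" by (rule member_le_sum) (use that in auto)
    then show ?thesis using nn(2)[of j] unfolding \<rho>_def by linarith
  qed
  have b\<rho>: "\<bar>b j k\<bar> \<le> \<rho> j" if "k \<in> {1..N}" for j k
  proof -
    have "\<bar>b j k\<bar> \<le> (\<Sum>k\<in>{1..N}. \<bar>b j k\<bar>)" by (rule member_le_sum) (use that in auto)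
    then show ?thesis using nn(1)[of j] unfolding \<rho>_def by linarith
  qed
  have scale: "\<bar>c j * y\<bar> \<le> 1" if "\<bar>y\<bar> \<le> \<rho> j" for j y
    using that \<rho>0[of j] unfolding c_def by (auto simp: abs_mult field_simps)
  define X :: "nat \<Rightarrow> nat \<times> nat \<Rightarrow> real" where
    "X = (\<lambda>j p. if fst p = 0 then c j * a j (snd p) else if fst p = 1 then c j * b j (snd p)
       else if fst p = 2 then L j ! snd p else c j)"
  define I :: "(nat \<times> nat) set" where "I = {0} \<times> {..N} \<union> {1} \<times> {1..N} \<union> {2} \<times> {..<Suc N} \<union> {(3, 0::nat)}"
  have "\<exists>r::nat \<Rightarrow> nat. strict_mono r \<and> (\<forall>p\<in>I. convergent (\<lambda>j. X (r j) p))"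
  proof (rule finite_bounded_subsequence)
    show "finite I" unfolding I_def by auto
    fix p j assume "p \<in> I"
    then have "\<bar>X j p\<bar> \<le> 1 \<or> \<bar>X j p\<bar> \<le> B"
      unfolding I_def X_def using scale[OF a\<rho>] scale[OF b\<rho>] c0[of j] bound[OF nth_mem] len
      by (auto simp: abs_of_pos)
    then show "\<bar>X j p\<bar> \<le> max 1 B" by auto
  qed
  then obtain r :: "nat \<Rightarrow> nat" where r: "strict_mono r" "\<And>p. p \<in> I \<Longrightarrow> convergent (\<lambda>j. X (r j) p)" by blast
  define X' where "X' = (\<lambda>p. lim (\<lambda>j. X (r j) p))"
  have X': "(\<lambda>j. X (r j) p) \<longlonglongrightarrow> X' p" if "p \<in> I" for p
    using r(2)[OF that] unfolding X'_def by (simp add: convergent_LIMSEQ_iff)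
  have A: "(\<lambda>j. c (r j) * a (r j) k) \<longlonglongrightarrow> X' (0, k)" if "k \<le> N" for k
    using X'[of "(0, k)"] that unfolding I_def X_def by simp
  have Bl: "(\<lambda>j. c (r j) * b (r j) k) \<longlonglongrightarrow> X' (1, k)" if "1 \<le> k" "k \<le> N" for k
    using X'[of "(1, k)"] that unfolding I_def X_def by simp
  define L' where "L' = map (\<lambda>k. X' (2, k)) [0..<Suc N]"
  have L': "length L' = Suc N" "(\<lambda>j. L (r j) ! k) \<longlonglongrightarrow> L' ! k" if "k < Suc N" for k
    using X'[of "(2, k)"] that unfolding I_def X_def L'_def by (auto simp del: upt_Suc)
  have lenL': "length L' = Suc N" unfolding L'_def by simp
  define c' where "c' = X' (3, 0)"
  have C: "(\<lambda>j. c (r j)) \<longlonglongrightarrow> c'" using X'[of "(3, 0)"] unfolding I_def X_def c'_def by simp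
  have c'0: "c' \<ge> 0" by (rule LIMSEQ_le_const[OF C]) (use c0(1) less_imp_le in blast)
  have Tr: "T (trig_sum N (a (r j)) (b (r j))) (mset (L (r j)))" for j using T[of "r j"] ab by simp
  have lenr: "length (L (r j)) = length L'" for j by (simp only: len lenL')
  have limr: "(\<lambda>j. L (r j) ! k) \<longlonglongrightarrow> L' ! k" if "k < length L'" for k
    using L'(2)[of k] that by (simp only: lenL')
  have c'nz: "c' \<noteq> 0"
  proof
    assume z: "c' = 0"
    interpret Z: circle_function N "\<lambda>t. 0" by (rule circle_function_0)
    let ?\<phi> = "trig_sum N (\<lambda>k. X' (0, k)) (\<lambda>k. X' (1, k))"
    have pl: "(\<lambda>j. c (r j) * \<phi> (r j) t) \<longlonglongrightarrow> ?\<phi> t" for t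
    proof -
      have "(\<lambda>j. (deriv ^^ 0) (trig_sum N (\<lambda>k. c (r j) * a (r j) k) (\<lambda>k. c (r j) * b (r j) k)) t) \<longlonglongrightarrow> (deriv ^^ 0) ?\<phi> t"
        by (rule tendsto_deriv_trig_sum) (use A Bl in auto)
      then show ?thesis using trig_sum_scale[of "c (r j)" 0 N "a (r j)" "b (r j)" t for j] ab by simp
    qed
    have nn: "0 \<le> ?\<phi> t" for t
    proof (rule LIMSEQ_le[OF _ pl])
      show "(\<lambda>j. c (r j) * u t) \<longlonglongrightarrow> 0" using tendsto_mult_right[OF C, of "u t"] unfolding z mult_zero_left .
      show "\<exists>j0. \<forall>j\<ge>j0. c (r j) * u t \<le> c (r j) * \<phi> (r j) t"
        using mult_left_mono[OF touches_above[OF T] less_imp_le[OF c0(1)]] by blast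
    qed
    have "touches N (\<lambda>t. 0) ?\<phi> (mset L')"
    proof (rule Z.touches_from_derivs)
      show "?\<phi> \<in> trig_polys N" unfolding trig_polys_iff by (rule exI, rule exI, rule refl)
      fix s i assume i: "i < 2 * mult_at (mset L') s" "i \<le> 2 * N"
      have "(deriv ^^ i) ?\<phi> s = c' * (deriv ^^ i) u s"
        by (rule touches_limit_deriv[where c = "\<lambda>j. c (r j)", OF Tr lenr limr A Bl C i])
      moreover have "(deriv ^^ i) (\<lambda>t. 0) = (\<lambda>t::real. 0::real)" by (induction i) simp_all
      ultimately show "(deriv ^^ i) ?\<phi> s = (deriv ^^ i) (\<lambda>t. 0) s" using z by simp
    qed (use nn lenL' in auto)
    moreover have "touches N (\<lambda>t. 0) (\<lambda>t. 0) Y" for Y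
      unfolding touches_def vanish_order_def by (auto simp: trig_polys_const)
    moreover obtain x xs where "L' = x # xs" using lenL' by (cases L') auto
    ultimately have "?\<phi> = (\<lambda>t. 0)"
      using lenL' by (intro Z.touches_unique[of "mset xs" _ x _ x]) auto
    then have zero: "\<And>k. k \<le> N \<Longrightarrow> X' (0, k) = 0" "\<And>k. k \<in> {1..N} \<Longrightarrow> X' (1, k) = 0"
      using trig_sum_eq_0[of N "\<lambda>k. X' (0, k)" "\<lambda>k. X' (1, k)"] by (auto simp: fun_eq_iff)
    have "(\<lambda>j. (\<Sum>k\<le>N. \<bar>c (r j) * a (r j) k\<bar>) + (\<Sum>k\<in>{1..N}. \<bar>c (r j) * b (r j) k\<bar>)) \<longlonglongrightarrow>
        (\<Sum>k\<le>N. \<bar>X' (0, k)\<bar>) + (\<Sum>k\<in>{1..N}. \<bar>X' (1, k)\<bar>)"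
      by (intro tendsto_intros) (use A Bl in auto)
    moreover have "(\<Sum>k\<le>N. \<bar>c (r j) * a (r j) k\<bar>) + (\<Sum>k\<in>{1..N}. \<bar>c (r j) * b (r j) k\<bar>) = 1 - c (r j)" for j
    proof -
      have "(\<Sum>k\<le>N. \<bar>c (r j) * a (r j) k\<bar>) + (\<Sum>k\<in>{1..N}. \<bar>c (r j) * b (r j) k\<bar>) = c (r j) * \<rho> (r j)"
        using c0(1)[of "r j"] by (simp add: \<rho>_def abs_mult sum_distrib_left distrib_left)
      also have "\<dots> = 1 - c (r j)" using \<rho>0[of "r j"] by (simp add: c_def field_simps)
      finally show ?thesis .
    qed
    ultimately have "(\<lambda>j. 1 - c (r j)) \<longlonglongrightarrow> 0" using zero by simp
    moreover have "(\<lambda>j. 1 - c (r j)) \<longlonglongrightarrow> 1 - c'" by (intro tendsto_intros C)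
    ultimately show False using z LIMSEQ_unique by fastforce
  qed
  define a' where "a' = (\<lambda>k. X' (0, k) / c')"
  define b' where "b' = (\<lambda>k. X' (1, k) / c')"
  have cnz: "c j \<noteq> 0" for j using c0(1)[of j] by simp
  have A': "(\<lambda>j. 1 * a (r j) k) \<longlonglongrightarrow> a' k" if "k \<le> N" for k
    using tendsto_divide[OF A[OF that] C c'nz] cnz by (simp add: a'_def)
  have B': "(\<lambda>j. 1 * b (r j) k) \<longlonglongrightarrow> b' k" if "1 \<le> k" "k \<le> N" for k
    using tendsto_divide[OF Bl[OF that] C c'nz] cnz by (simp add: b'_def)
  let ?\<phi> = "trig_sum N a' b'"
  have pl: "(\<lambda>j. \<phi> (r j) t) \<longlonglongrightarrow> ?\<phi> t" for t
  proof -
    have "(\<lambda>j. (deriv ^^ 0) (trig_sum N (a (r j)) (b (r j))) t) \<longlonglongrightarrow> (deriv ^^ 0) ?\<phi> t"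
      by (rule tendsto_deriv_trig_sum) (use A' B' in auto)
    then show ?thesis using ab by simp
  qed
  have "T ?\<phi> (mset L')"
  proof (rule touches_from_derivs)
    show "?\<phi> \<in> trig_polys N" unfolding trig_polys_iff by (rule exI, rule exI, rule refl)
    show "u t \<le> ?\<phi> t" for t by (rule LIMSEQ_le_const[OF pl]) (use touches_above[OF T] in blast)
    show "size (mset L') \<le> Suc N" using lenL' by simp
    fix s i assume i: "i < 2 * mult_at (mset L') s" "i \<le> 2 * N"
    have "(deriv ^^ i) ?\<phi> s = 1 * (deriv ^^ i) u s"
      by (rule touches_limit_deriv[where c = "\<lambda>j. 1", OF Tr lenr limr A' B' tendsto_const i])
    then show "(deriv ^^ i) ?\<phi> s = (deriv ^^ i) u s" by simp
  qed
  then show ?thesis using r(1) L' lenL' pl by blast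
qed

end

section \<open>Comparison of supporting polynomials\<close>

text \<open>
  A trigonometric polynomial of degree \<open>1\<close> is an affine function on the plane, restricted to the unit
  circle. As the chords \<open>x1 x3\<close> and \<open>x2 x4\<close> cross, there is a linear relation with positive coefficients
  between the values at the end points of the two chords. The coefficient of each value is, up to a
  common factor, the product of the lengths of the three chords between the other points.
\<close>

lemma trig_polys_1_alternating:
  assumes \<alpha>: "\<alpha> \<in> trig_polys 1" and x: "x1 < x2" "x2 < x3" "x3 < x4" "x4 < x1 + 2 * pi"
    and s: "\<alpha> x1 \<ge> 0" "\<alpha> x2 < 0" "\<alpha> x3 \<ge> 0"
  shows "\<alpha> x4 > 0"
proof -
  obtain a b where ab: "\<alpha> = trig_sum 1 a b" using \<alpha> trig_polys_iff by blast
  define S where "S = (\<lambda>(y::real) (x::real). sin (y / 2) * cos (x / 2) - cos (y / 2) * sin (x / 2))"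
  have S: "S y x > 0" if "x < y" "y < x + 2 * pi" for x y
  proof -
    have "S y x = sin ((y - x) / 2)" unfolding S_def by (simp add: sin_diff diff_divide_distrib)
    also have "\<dots> > 0" using that by (intro sin_gt_zero) auto
    finally show ?thesis .
  qed
  have q: "\<alpha> t = (a 0 + a 1) * cos (t / 2) ^ 2 + (a 0 - a 1) * sin (t / 2) ^ 2 + 2 * b 1 * sin (t / 2) * cos (t / 2)" for t
  proof -
    have c: "cos t = cos (t / 2) ^ 2 - sin (t / 2) ^ 2" using cos_double[of "t / 2"] by simp
    have d: "sin t = 2 * sin (t / 2) * cos (t / 2)" using sin_double[of "t / 2"] by simp
    have e: "a 0 = a 0 * cos (t / 2) ^ 2 + a 0 * sin (t / 2) ^ 2"
      by (simp only: distrib_left[symmetric] sin_cos_squared_add2 mult_1_right)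
    show ?thesis unfolding ab trig_sum_def by (simp add: c d algebra_simps) (rule e)
  qed
  have "S x3 x2 * S x4 x3 * S x4 x2 * \<alpha> x1 + S x2 x1 * S x4 x2 * S x4 x1 * \<alpha> x3 =
    S x3 x1 * S x4 x3 * S x4 x1 * \<alpha> x2 + S x2 x1 * S x3 x2 * S x3 x1 * \<alpha> x4"
    unfolding q S_def by algebra
  moreover have "S x3 x2 * S x4 x3 * S x4 x2 * \<alpha> x1 \<ge> 0" "S x2 x1 * S x4 x2 * S x4 x1 * \<alpha> x3 \<ge> 0"
    using x s by (auto intro!: mult_nonneg_nonneg less_imp_le[OF S])
  moreover have "S x3 x1 * S x4 x3 * S x4 x1 * \<alpha> x2 < 0"
    using x s by (intro mult_pos_neg mult_pos_pos S) auto
  ultimately have "S x2 x1 * S x3 x2 * S x3 x1 * \<alpha> x4 > 0" by linarith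
  moreover have "S x2 x1 * S x3 x2 * S x3 x1 > 0" using x by (intro mult_pos_pos S) auto
  ultimately show ?thesis using zero_less_mult_pos by blast
qed

lemma cis_neq_within_period: "x \<noteq> y \<Longrightarrow> \<bar>x - y\<bar> < 2 * pi \<Longrightarrow> cis x \<noteq> cis y"
  using cis_eq_within_period by blast

lemma weight_pos_outside:
  assumes "set_mset W \<subseteq> {a..b}" "b \<le> t" "t \<le> a + 2 * pi" "t \<notin># W" "t - 2 * pi \<notin># W"
  shows "weight W t > 0"
proof -
  have "mult_at W t = 0"
  proof -
    have "cis x \<noteq> cis t" if x: "x \<in># W" for x
    proof
      assume c: "cis x = cis t"
      show False
      proof (cases "\<bar>x - t\<bar> < 2 * pi")
        case True
        then show False using cis_eq_within_period[OF c] x assms(4) by blast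
      next
        case False
        then have "x = t - 2 * pi" using x assms by (auto simp: abs_if split: if_splits)
        then show False using x assms(5) by blast
      qed
    qed
    then show ?thesis by (induction W) auto
  qed
  then show ?thesis using weight_nonneg[of W t] weight_eq_0_iff[of W t] by simp
qed

context circle_function
begin

lemma touches_factor_swap:
  assumes "\<And>t. \<phi>' t - \<phi> t = weight X t * \<alpha> t"
  shows "\<phi> t - \<phi>' t = weight X t * (- \<alpha> t)"
  using assms[of t] by simp

text \<open>
  Contacts do not cross. Polynomials that touch in the common multiset \<open>V\<close> of \<open>N - 1\<close> points differ by a
  factor \<open>\<alpha>\<close> of degree \<open>1\<close>, which is nonnegative at \<open>a\<close>, \<open>b\<close> and nonpositive at \<open>m\<close>, \<open>p\<close>. Since
  the signs cannot alternate, a new contact \<open>m\<close> in the arc from \<open>a\<close> to \<open>b\<close> forces \<open>p\<close> into the same arc and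
  \<open>\<alpha>\<close> to be positive on the complementary arc.
\<close>

lemma exchange_contacts:
  assumes size: "Suc (size V) = N" and T: "T \<phi> (add_mset a (add_mset b V))"
    and ord: "a < m" "m < b" "b < a + 2 * pi" and m: "\<not> T \<phi> (add_mset m V)"
  obtains \<phi>' p \<alpha> where "a < p" "p < b" "T \<phi>' (add_mset p (add_mset m V))" "\<alpha> \<in> trig_polys 1"
    "\<And>t. \<phi>' t - \<phi> t = weight V t * \<alpha> t" "\<And>t. t \<in> {b..a + 2 * pi} \<Longrightarrow> \<alpha> t > 0"
proof -
  obtain \<phi>' p0 where p0: "T \<phi>' (add_mset p0 (add_mset m V))"
    using touches_exists[of "add_mset m V"] size by auto
  obtain p where p: "p \<in> {a..<a + 2 * pi}" "cis p = cis p0" using cis_representative by blast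
  have T': "T \<phi>' (add_mset p (add_mset m V))" using touches_cis[OF p(2)[symmetric] p0] .
  have Ts: "T \<phi> V" "T \<phi>' V" "T \<phi> (add_mset a V)" "T \<phi> (add_mset b V)" "T \<phi>' (add_mset m V)" "T \<phi>' (add_mset p V)"
    using T T' by (auto elim!: touches_mono simp: add_mset_commute)
  have "N - size V = 1" using size by simp
  then obtain \<alpha> where \<alpha>: "\<alpha> \<in> trig_polys 1" "\<And>t. \<phi>' t - \<phi> t = weight V t * \<alpha> t"
    using touches_factor[OF Ts(1,2)] size by (metis Suc_n_not_le_n le_cases)
  have cont: "isCont \<alpha> t" for t using trig_polys_isCont[OF \<alpha>(1)] .
  note nonneg = touches_factor_nonneg[OF _ touches_above[OF Ts(2)] \<alpha>(2) cont]
  note nonpos = touches_factor_nonpos[OF _ touches_above[OF Ts(1)] \<alpha>(2) cont]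
  have \<alpha>m: "\<alpha> m < 0" using nonpos[OF Ts(5)] touches_factor_zero[OF Ts(5) Ts(1) \<alpha>(2) cont] m by force
  have end_pos: "\<alpha> y > 0" if y: "T \<phi> (add_mset y V)" and z: "\<alpha> z \<ge> 0" "cis z \<noteq> cis y" for y z
  proof (rule ccontr)
    assume "\<not> \<alpha> y > 0"
    then have "- \<alpha> y = 0" using nonneg[OF y] by simp
    then have y': "T \<phi>' (add_mset y V)"
      using touches_factor_zero[OF y Ts(2) touches_factor_swap[OF \<alpha>(2)]] cont by auto
    obtain \<beta> where \<beta>: "\<beta> \<in> trig_polys (N - size (add_mset y V))"
      "\<And>t. \<phi>' t - \<phi> t = weight (add_mset y V) t * \<beta> t"
      using touches_factor[OF y y'] size by auto
    then obtain c where c: "\<beta> = (\<lambda>t. c)" using size trig_polys_0_iff by auto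
    have eq: "\<alpha> t = (1 - cos (t - y)) * c" for t
    proof (rule weight_cancel[of V \<alpha> "\<lambda>t. (1 - cos (t - y)) * c"])
      show "weight V t * \<alpha> t = weight V t * ((1 - cos (t - y)) * c)" for t
        using trans[OF \<alpha>(2)[symmetric] \<beta>(2), of t] c by (simp add: mult_ac)
    qed (intro cont continuous_intros)+
    have "c < 0" using \<alpha>m cos_le_one[of "m - y"] unfolding eq by (simp add: mult_less_0_iff)
    moreover have "1 - cos (z - y) > 0"
      using z(2) cis_eq_iff_cos[of y z] cos_le_one[of "z - y"] by (auto simp: less_le)
    ultimately show False using z(1) unfolding eq by (simp add: zero_le_mult_iff)
  qed
  have ab: "cis a \<noteq> cis b" using ord by (intro cis_neq_within_period) auto
  have \<alpha>a: "\<alpha> a > 0" using end_pos[OF Ts(3) nonneg[OF Ts(4)]] ab by auto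
  have \<alpha>b: "\<alpha> b > 0" using end_pos[OF Ts(4) nonneg[OF Ts(3)]] ab by auto
  have pos: "\<alpha> t > 0" if t: "t \<in> {b..a + 2 * pi}" for t
  proof -
    consider "t = b" | "t = a + 2 * pi" | "b < t" "t < a + 2 * pi" using t by force
    then show ?thesis
    proof cases
      case 2
      then show ?thesis using \<alpha>a trig_polys_periodic[OF \<alpha>(1)] by simp
    next
      case 3
      then show ?thesis using trig_polys_1_alternating[OF \<alpha>(1) ord(1,2) 3] \<alpha>a \<alpha>b \<alpha>m by simp
    qed (simp add: \<alpha>b)
  qed
  have "\<alpha> p \<le> 0" using nonpos[OF Ts(6)] .
  then have "p \<noteq> a" "p \<notin> {b..a + 2 * pi}" using \<alpha>a pos by force+
  then show thesis using that[OF _ _ T' \<alpha>] pos p(1) by auto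
qed

text \<open>
  The points of \<open>Z\<close> are kept, and the two extreme points among the remaining contacts move inwards.
\<close>

lemma contacts_inward:
  assumes T: "T \<phi> (Z + Y)" and size: "size Z + size Y = Suc N"
    and Y: "set_mset Y \<subseteq> {a..b}" "a \<in># Y" "b \<in># Y" and ab: "b < a + 2 * pi"
    and m: "a \<le> m" "m \<le> b" "\<not> T \<phi> (add_mset m Z)"
  obtains \<phi>' p \<alpha> W where "a < m" "m < b" "a < p" "p < b" "Y = add_mset a (add_mset b W)"
    "T \<phi>' (Z + add_mset p (add_mset m W))" "\<alpha> \<in> trig_polys 1"
    "\<And>t. \<phi>' t - \<phi> t = weight Z t * (weight W t * \<alpha> t)" "\<And>t. t \<in> {b..a + 2 * pi} \<Longrightarrow> \<alpha> t > 0"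
proof -
  have C: "T \<phi> (add_mset y Z)" if "y \<in># Y" for y
    by (rule touches_mono[OF T]) (use that in \<open>metis add_mset_add_single mset_subset_eq_mono_add_left_cancel mset_subset_eq_single\<close>)
  have lt: "a < m" "m < b" using C[OF Y(2)] C[OF Y(3)] m by (auto simp: less_le)
  obtain W where W: "Y = add_mset a (add_mset b W)"
    using Y(2,3) lt by (metis insert_noteq_member mset_add order.strict_trans less_irrefl)
  have "\<not> T \<phi> (add_mset m (Z + W))"
    using m(3) touches_mono[of \<phi> "add_mset m (Z + W)" "add_mset m Z"] by auto
  moreover have "T \<phi> (add_mset a (add_mset b (Z + W)))" using T W by simp
  moreover have "Suc (size (Z + W)) = N" using size W by simp
  ultimately obtain \<phi>' p \<alpha> where "a < p" "p < b" "T \<phi>' (add_mset p (add_mset m (Z + W)))" "\<alpha> \<in> trig_polys 1"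
    "\<And>t. \<phi>' t - \<phi> t = weight (Z + W) t * \<alpha> t" "\<And>t. t \<in> {b..a + 2 * pi} \<Longrightarrow> \<alpha> t > 0"
    using exchange_contacts lt ab by metis
  then show thesis using that[OF lt _ _ W, of p \<phi>' \<alpha>] by (simp add: mult.assoc)
qed

lemma touches_arc_add:
  assumes "a < b" "s \<in> {a..b}" and arc: "\<And>t. t \<in> {a..b} \<Longrightarrow> T \<phi> (add_mset t Z)"
    and T: "T \<phi> X" and size: "size X \<le> N"
  shows "T \<phi> (add_mset s X)"
proof -
  have "T \<phi> (X + replicate_mset (Suc N - mult_at X s) s)"
    using touches_arc[OF assms(1,2) _ T] touches_add_value[OF arc] by blast
  moreover have "Suc N - mult_at X s > 0" using mult_at_le_size[of X s] size by simp
  then have "add_mset s X \<subseteq># X + replicate_mset (Suc N - mult_at X s) s"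
    by (cases "Suc N - mult_at X s") auto
  ultimately show ?thesis using touches_mono by blast
qed

text \<open>
  Repeated exchange of the extreme contacts removes the end points \<open>a\<close> and \<open>b\<close>, whose multiplicities drop. The
  quotient \<open>\<beta>\<close> records how far \<open>\<phi>\<close> has risen above the initial \<open>\<phi>0\<close> on the complementary arc. It becomes
  positive at an end point as soon as this point ceases to be a contact. The exchange could only
  get stuck if the hull of the contacts became an arc of coincidence; while an end point is still
  involved, this would give the exchanged pair of polynomials one common contact too many.
\<close>

lemma contacts_into_open_arc:
  assumes ab: "a < b" "b < a + 2 * pi" and T0: "T \<phi>0 Z"
    and T: "T \<phi> (Z + Y)" and size: "size Z + size Y = Suc N" and Y: "set_mset Y \<subseteq> {a..b}"
    and \<beta>: "\<beta> \<in> trig_polys (N - size Z)" "\<And>t. \<phi> t - \<phi>0 t = weight Z t * \<beta> t"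
    and nn: "\<And>t. t \<in> {b..a + 2 * pi} \<Longrightarrow> \<beta> t \<ge> 0"
    and pos: "b \<notin># Y \<Longrightarrow> \<beta> b > 0" "a \<notin># Y \<Longrightarrow> \<beta> (a + 2 * pi) > 0"
      "\<And>t. \<not> (a \<in># Y \<and> b \<in># Y) \<Longrightarrow> b < t \<Longrightarrow> t < a + 2 * pi \<Longrightarrow> \<beta> t > 0"
    and gap: "a \<in># Y \<or> b \<in># Y \<Longrightarrow> \<exists>m\<in>{Min_mset Y..Max_mset Y}. \<not> T \<phi> (add_mset m Z)"
  shows "\<exists>\<phi>1 Y1. size Y1 = size Y \<and> set_mset Y1 \<subseteq> {a<..<b} \<and> T \<phi>1 (Z + Y1) \<and>
    (\<forall>t\<in>{b..a + 2 * pi}. \<not> T \<phi>1 (add_mset t Z))"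
  using T size Y \<beta> nn pos gap
proof (induction "count Y a + count Y b" arbitrary: \<phi> Y \<beta> rule: less_induct)
  case less
  note T = less.prems(1) and size = less.prems(2) and Y = less.prems(3) and \<beta> = less.prems(4,5)
    and nn = less.prems(6) and pos = less.prems(7-9) and gap = less.prems(10)
  have TZ: "T \<phi> Z" using T by (rule touches_mono) simp
  show ?case
  proof (cases "a \<in># Y \<or> b \<in># Y")
    case False
    have "\<not> T \<phi> (add_mset t Z)" if t: "t \<in> {b..a + 2 * pi}" for t
    proof
      assume "T \<phi> (add_mset t Z)"
      then have "\<beta> t \<le> 0"
        by (rule touches_factor_nonpos[OF _ touches_above[OF T0] \<beta>(2)]) (rule trig_polys_isCont[OF \<beta>(1)])
      moreover have "\<beta> t > 0" using t False pos by (cases "t = b"; cases "t = a + 2 * pi") auto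
      ultimately show False by simp
    qed
    moreover have "set_mset Y \<subseteq> {a<..<b}" using Y False by (auto simp: less_le)
    ultimately show ?thesis using T by blast
  next
    case True
    define a' b' where "a' = Min_mset Y" and "b' = Max_mset Y"
    have Yne: "Y \<noteq> {#}" using True by auto
    have a'b': "a' \<in># Y" "b' \<in># Y" "set_mset Y \<subseteq> {a'..b'}" using Yne unfolding a'_def b'_def by auto
    have aa: "a \<le> a'" "b' \<le> b" using a'b' Y by auto
    obtain m where m: "a' \<le> m" "m \<le> b'" "\<not> T \<phi> (add_mset m Z)" using gap[OF True] unfolding a'_def b'_def by auto
    have lt: "b' < a' + 2 * pi" using aa ab by simp
    obtain \<phi>' p \<alpha> W where S: "a' < m" "m < b'" "a' < p" "p < b'" "Y = add_mset a' (add_mset b' W)"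
      "T \<phi>' (Z + add_mset p (add_mset m W))" "\<alpha> \<in> trig_polys 1"
      "\<And>t. \<phi>' t - \<phi> t = weight Z t * (weight W t * \<alpha> t)" "\<And>t. t \<in> {b'..a' + 2 * pi} \<Longrightarrow> \<alpha> t > 0"
      using contacts_inward[OF T size a'b'(3,1,2) lt m] by metis
    define Y' where "Y' = add_mset p (add_mset m W)"
    have W: "set_mset W \<subseteq> {a..b}" "set_mset W \<subseteq> {a'..b'}" using Y a'b'(3) S(5) by auto
    have Y': "set_mset Y' \<subseteq> {a..b}" "size Y' = size Y" "T \<phi>' (Z + Y')"
      using W S aa by (auto simp: Y'_def)
    have aY: "a' = a" if "a \<in># Y" using that a'b'(3) aa by auto
    have bY: "b' = b" if "b \<in># Y" using that a'b'(3) aa by auto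
    have "p \<noteq> a" "m \<noteq> a" "p \<noteq> b" "m \<noteq> b" using S(1-4) aa by auto
    then have cW: "count Y' a = count W a" "count Y' b = count W b" by (simp_all add: Y'_def)
    have cY: "count Y x = count W x + (if x = a' then 1 else 0) + (if x = b' then 1 else 0)" for x
      unfolding S(5) by simp
    have ca: "count Y' a \<le> count Y a" "a \<in># Y \<Longrightarrow> count Y' a < count Y a"
      unfolding cW cY[of a] using aY by auto
    have cb: "count Y' b \<le> count Y b" "b \<in># Y \<Longrightarrow> count Y' b < count Y b"
      unfolding cW cY[of b] using bY by auto
    define \<beta>' where "\<beta>' = (\<lambda>t. \<beta> t + weight W t * \<alpha> t)"
    have \<alpha>pos: "\<alpha> t > 0" if "t \<in> {b..a + 2 * pi}" for t using that aa by (intro S(9)) auto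
    have inc: "weight W t * \<alpha> t \<ge> 0" if "t \<in> {b..a + 2 * pi}" for t
      using weight_nonneg less_imp_le[OF \<alpha>pos[OF that]] by (rule mult_nonneg_nonneg)
    have incpos: "weight W t * \<alpha> t > 0" if "t \<in> {b..a + 2 * pi}" "t \<notin># W" "t - 2 * pi \<notin># W" for t
      using weight_pos_outside[OF W(1)] \<alpha>pos that by auto
    have sW: "Suc (size (Z + W)) = N" using size S(5) by simp
    have gap': "\<exists>m\<in>{Min_mset Y'..Max_mset Y'}. \<not> T \<phi>' (add_mset m Z)" if e: "e \<in># Y'" "e = a \<or> e = b" for e
    proof (rule ccontr)
      assume "\<not> ?thesis"
      then have arc: "\<And>t. t \<in> {Min_mset Y'..Max_mset Y'} \<Longrightarrow> T \<phi>' (add_mset t Z)" by blast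
      have eW: "e \<in># W" using e S(1-4) aa by (auto simp: Y'_def)
      then have eab: "e = a' \<or> e = b'" using W(2) e(2) aa by force
      have "m \<in># Y'" "m \<noteq> e" using S(1-4) eab by (auto simp: Y'_def)
      then have "Min_mset Y' \<le> m" "m \<le> Max_mset Y'" "Min_mset Y' \<le> e" "e \<le> Max_mset Y'" using e(1) by auto
      with \<open>m \<noteq> e\<close> have mm: "Min_mset Y' < Max_mset Y'" "e \<in> {Min_mset Y'..Max_mset Y'}" by auto
      have T1: "T \<phi>' (Z + W)" using S(6) by (rule touches_mono) auto
      have T2: "T \<phi> (Z + W)" using T by (rule touches_mono) (auto simp: S(5))
      have "T \<phi>' (add_mset e (Z + W))"
        by (rule touches_arc_add[OF mm arc T1]) (use sW in auto)
      then have "\<alpha> e \<le> 0"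
        by (rule touches_factor_nonpos[OF _ touches_above[OF T2], of _ _ _ \<alpha>])
          (use S(8) trig_polys_isCont[OF S(7)] in \<open>auto simp: mult.assoc\<close>)
      moreover have "\<alpha> e > 0" using eab S(9)[of b'] S(9)[of "a' + 2 * pi"] lt trig_polys_periodic[OF S(7)] by auto
      ultimately show False by simp
    qed
    have "\<exists>\<phi>1 Y1. size Y1 = size Y' \<and> set_mset Y1 \<subseteq> {a<..<b} \<and> T \<phi>1 (Z + Y1) \<and>
      (\<forall>t\<in>{b..a + 2 * pi}. \<not> T \<phi>1 (add_mset t Z))"
    proof (rule less.hyps[of Y' \<phi>' \<beta>'])
      show "count Y' a + count Y' b < count Y a + count Y b" using ca cb True by linarith
      show "\<beta>' \<in> trig_polys (N - size Z)"
      proof -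
        have "(\<lambda>t. weight W t * \<alpha> t) \<in> trig_polys (size W + 1)" using weight_mult_trig_poly[OF S(7)] .
        moreover have "size W + 1 = N - size Z" using sW by simp
        ultimately show ?thesis unfolding \<beta>'_def using \<beta>(1) by (intro trig_polys_add) simp_all
      qed
      show "\<phi>' t - \<phi>0 t = weight Z t * \<beta>' t" for t
        using S(8)[of t] \<beta>(2)[of t] by (simp add: \<beta>'_def algebra_simps)
      show "\<beta>' t \<ge> 0" if "t \<in> {b..a + 2 * pi}" for t
        using nn[OF that] inc[OF that] by (simp add: \<beta>'_def)
      show "\<beta>' b > 0" if "b \<notin># Y'"
      proof (cases "b \<in># Y")
        case False
        then show ?thesis using pos(1) inc[of b] ab by (simp add: \<beta>'_def add_pos_nonneg)
      next
        case True
        have "weight W b * \<alpha> b > 0" by (rule incpos) (use that ab W in \<open>auto simp: Y'_def\<close>)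
        then show ?thesis using nn[of b] ab by (simp add: \<beta>'_def add_nonneg_pos)
      qed
      show "\<beta>' (a + 2 * pi) > 0" if "a \<notin># Y'"
      proof (cases "a \<in># Y")
        case False
        then show ?thesis using pos(2) inc[of "a + 2 * pi"] ab by (simp add: \<beta>'_def add_pos_nonneg)
      next
        case True
        have "weight W (a + 2 * pi) * \<alpha> (a + 2 * pi) > 0" by (rule incpos) (use that ab W in \<open>auto simp: Y'_def\<close>)
        then show ?thesis using nn[of "a + 2 * pi"] ab by (simp add: \<beta>'_def add_nonneg_pos)
      qed
      show "\<beta>' t > 0" if "b < t" "t < a + 2 * pi" for t
      proof -
        have "weight W t * \<alpha> t > 0" by (rule incpos) (use that ab W in auto)
        then show ?thesis using nn[of t] that by (simp add: \<beta>'_def add_nonneg_pos)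
      qed
      show "\<exists>m\<in>{Min_mset Y'..Max_mset Y'}. \<not> T \<phi>' (add_mset m Z)" if "a \<in># Y' \<or> b \<in># Y'"
        using that gap' by blast
    qed (use Y' size in auto)
    then show ?thesis using Y'(2) by simp
  qed
qed

end

section \<open>Clean flexes with prescribed contacts\<close>

lemma weight_times_nonneg:
  assumes "b < c" "t \<in> {b..c}" and nn: "\<And>t. t \<in> {b..c} \<Longrightarrow> weight Z t * \<alpha> t \<ge> 0" and c: "isCont \<alpha> t"
  shows "\<alpha> t \<ge> 0"
proof -
  obtain F where F: "F \<le> at t" "F \<noteq> bot" "\<forall>\<^sub>F x in F. x \<in> {b..c}"
    by (rule interval_side_filter[OF assms(1,2)])
  have "\<forall>\<^sub>F x in F. weight Z x \<noteq> 0" using filter_leD[OF F(1) weight_eventually_nonzero] .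
  with F(3) have "\<forall>\<^sub>F x in F. 0 \<le> \<alpha> x"
  proof eventually_elim
    case (elim x)
    then have "weight Z x > 0" using weight_nonneg[of Z x] by simp
    then show ?case using nn[of x] elim by (simp add: zero_le_mult_iff)
  qed
  moreover have "(\<alpha> \<longlongrightarrow> \<alpha> t) F" using c unfolding isCont_def by (rule tendsto_mono[OF F(1)])
  ultimately show ?thesis using tendsto_lowerbound F(2) by blast
qed

context circle_function
begin

text \<open>
  The points of \<open>Z\<close> are kept as contacts throughout, and only contacts in addition to \<open>Z\<close> count. Cleanness
  is the condition that every such contact is joined to \<open>s\<close> by an arc of contacts. For empty \<open>Z\<close> this makes the
  contact set connected.
\<close>

definition clean :: "real multiset \<Rightarrow> (real \<Rightarrow> real) \<Rightarrow> real \<Rightarrow> bool" where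
  "clean Z \<phi> s \<longleftrightarrow> T \<phi> (Z + replicate_mset (Suc N - size Z) s) \<and>
    (\<forall>r. s < r \<longrightarrow> r < s + 2 * pi \<longrightarrow> T \<phi> (add_mset r Z) \<longrightarrow>
      (\<forall>t\<in>{s..r}. T \<phi> (add_mset t Z)) \<or> (\<forall>t\<in>{r..s + 2 * pi}. T \<phi> (add_mset t Z)))"

lemma touches_combine:
  assumes "T \<phi> A" "T \<phi> B" "\<And>x. mult_at C x \<le> mult_at A x \<or> mult_at C x \<le> mult_at B x"
  shows "T \<phi> C"
  using assms unfolding touches_def by (meson less_le_trans)

lemma touches_flex_add:
  assumes "T \<phi> (Z + replicate_mset (Suc N - size Z) s)" "T \<phi> (add_mset r Z)" "cis r \<noteq> cis s"
  shows "T \<phi> (Z + add_mset r (replicate_mset (N - size Z) s))"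
  by (rule touches_combine[OF assms(1,2)]) (use assms(3) in auto)

lemma touches_arc_flex:
  assumes "a < b" "s \<in> {a..b}" and arc: "\<And>t. t \<in> {a..b} \<Longrightarrow> T \<phi> (add_mset t Z)"
  shows "T \<phi> (Z + replicate_mset (Suc N - size Z) s)"
proof -
  have "T \<phi> Z" using arc[OF assms(2)] by (rule touches_mono) simp
  then have "T \<phi> (Z + replicate_mset (Suc N - mult_at Z s) s)"
    using touches_arc[OF assms(1,2)] touches_add_value[OF arc] by blast
  moreover have "Suc N - size Z \<le> Suc N - mult_at Z s" using mult_at_le_size[of Z s] by simp
  ultimately show ?thesis by (elim touches_mult_at_cong) auto
qed

lemma touches_flex_at_unique:
  assumes "size Z + n = N" "T \<phi> (Z + replicate_mset (Suc N - size Z) s)"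
    "T \<phi>' (Z + add_mset r (replicate_mset n s))"
  shows "\<phi> = \<phi>'"
proof (rule touches_unique)
  show "size (Z + replicate_mset n s) = N" using assms(1) by simp
  have "Suc N - size Z = Suc n" using assms(1) by auto
  then show "T \<phi> (add_mset s (Z + replicate_mset n s))" using assms(2) by simp
  show "T \<phi>' (add_mset r (Z + replicate_mset n s))" using assms(3) by simp
qed

lemma touches_compact:
  assumes T: "\<And>j::nat. T (\<phi> j) (Z + Y j)" and size: "\<And>j. size Z + size (Y j) = Suc N"
    and Y: "\<And>j. set_mset (Y j) \<subseteq> {a..b}"
  obtains r \<phi>' Y' where "strict_mono (r :: nat \<Rightarrow> nat)" "T \<phi>' (Z + Y')" "size Z + size Y' = Suc N"
    "set_mset Y' \<subseteq> {a..b}" "\<And>t. (\<lambda>j. \<phi> (r j) t) \<longlonglongrightarrow> \<phi>' t"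
proof -
  obtain zs where zs: "mset zs = Z" using ex_mset by blast
  have "\<forall>j. \<exists>l. mset l = Y j" using ex_mset by blast
  then obtain ys where ys: "\<And>j. mset (ys j) = Y j" by metis
  define L where "L = (\<lambda>j. zs @ ys j)"
  have lz: "length zs = size Z" using zs by auto
  have set_ys: "set (ys j) = set_mset (Y j)" for j by (metis ys set_mset_mset)
  have ly: "length (ys j) = size (Y j)" for j by (metis ys size_mset)
  obtain B where B: "\<And>x. x \<in> set zs \<Longrightarrow> \<bar>x\<bar> \<le> B"
    using finite_imp_bounded[of "set zs"] unfolding bounded_iff by auto
  have "\<exists>(r :: nat \<Rightarrow> nat) \<phi>' L'. strict_mono r \<and> length L' = Suc N \<and> (\<forall>k<Suc N. (\<lambda>j. L (r j) ! k) \<longlonglongrightarrow> L' ! k) \<and>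
    (\<forall>t. (\<lambda>j. \<phi> (r j) t) \<longlonglongrightarrow> \<phi>' t) \<and> T \<phi>' (mset L')"
  proof (rule touches_compact_list)
    show "T (\<phi> j) (mset (L j))" for j using T[of j] zs ys by (simp add: L_def)
    show "length (L j) = Suc N" for j using size[of j] lz ly by (simp add: L_def)
    fix j x assume "x \<in> set (L j)"
    then have "x \<in> set zs \<or> x \<in># Y j" unfolding L_def by (auto simp: set_ys)
    then show "\<bar>x\<bar> \<le> max B (max \<bar>a\<bar> \<bar>b\<bar>)" using B[of x] Y[of j] by (auto simp: le_max_iff_disj subset_iff abs_if)
  qed
  then obtain r :: "nat \<Rightarrow> nat" and \<phi>' L' where r: "strict_mono r" "length L' = Suc N"
    "\<And>k. k < Suc N \<Longrightarrow> (\<lambda>j. L (r j) ! k) \<longlonglongrightarrow> L' ! k"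
    "\<And>t. (\<lambda>j. \<phi> (r j) t) \<longlonglongrightarrow> \<phi>' t" "T \<phi>' (mset L')" by blast
  define Y' where "Y' = mset (drop (size Z) L')"
  have sZ: "size Z \<le> Suc N" using size[of 0] by simp
  have "take (size Z) L' = zs"
  proof (rule nth_equalityI)
    show "length (take (size Z) L') = length zs" using lz r(2) sZ by simp
    fix k assume "k < length (take (size Z) L')"
    then have k: "k < size Z" "k < Suc N" using r(2) by auto
    have "(\<lambda>j. L (r j) ! k) \<longlonglongrightarrow> zs ! k" using k lz by (simp add: L_def nth_append)
    then have "L' ! k = zs ! k" using r(3)[OF k(2)] LIMSEQ_unique by blast
    then show "take (size Z) L' ! k = zs ! k" using k by simp
  qed
  then have eq: "mset L' = Z + Y'" unfolding Y'_def zs[symmetric] by (metis append_take_drop_id mset_append)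
  have "set_mset Y' \<subseteq> {a..b}"
  proof
    fix y assume "y \<in># Y'"
    then obtain k where k: "size Z \<le> k" "k < Suc N" "y = L' ! k"
      unfolding Y'_def using r(2) by (auto simp: in_set_conv_nth)
        (metis add.commute le_add1 less_diff_conv)
    have "L (r j) ! k \<in> {a..b}" for j
    proof -
      have "L (r j) ! k = ys (r j) ! (k - size Z)" using k(1) lz by (simp add: L_def nth_append)
      moreover have "k - size Z < length (ys (r j))" using k size[of "r j"] ly[of "r j"] by simp
      ultimately have "L (r j) ! k \<in> set (ys (r j))" by simp
      then show ?thesis using Y[of "r j"] by (auto simp: set_ys)
    qed
    then show "y \<in> {a..b}"
      using k(3) LIMSEQ_le_const[OF r(3)[OF k(2)], of a] LIMSEQ_le_const2[OF r(3)[OF k(2)], of b] by auto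
  qed
  moreover have "size Z + size Y' = Suc N" using arg_cong[OF eq, of size] r(2) by simp
  ultimately show thesis using that r eq by simp
qed

text \<open>
  Among the polynomials that touch \<open>u\<close> in \<open>Z\<close> and in \<open>Suc N - size Z\<close> points of the arc, and lie above \<open>\<phi>1\<close> on the complementary
  arc, take one with the largest value at an auxiliary point \<open>q\<close> of the complementary arc; it exists by
  compactness. An exchange of extreme contacts would increase this value, so between any two
  contacts in the arc there are only contacts, and the leftmost point of the contact multiset is a flex.
\<close>

lemma clean_flex_inside:
  assumes Z: "size Z < N" and ab: "a < b" "b < a + 2 * pi"
    and T1: "T \<phi>1 (Z + Y1)" and size1: "size Z + size Y1 = Suc N" and Y1: "set_mset Y1 \<subseteq> {a<..<b}"
    and out1: "\<And>t. t \<in> {b..a + 2 * pi} \<Longrightarrow> \<not> T \<phi>1 (add_mset t Z)"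
  shows "\<exists>\<phi> s. a < s \<and> s < b \<and> clean Z \<phi> s \<and> (\<forall>t\<in>{b..a + 2 * pi}. \<not> T \<phi> (add_mset t Z))"
proof -
  obtain q where q: "b < q" "q < a + 2 * pi" "weight Z q \<noteq> 0"
  proof -
    define c where "c = (b + (a + 2 * pi)) / 2"
    have "\<forall>\<^sub>F x in at c. x \<in> {b<..<a + 2 * pi}"
      using ab by (intro eventually_at_in_open') (auto simp: c_def field_simps)
    with weight_eventually_nonzero[of Z c] have "\<forall>\<^sub>F x in at c. weight Z x \<noteq> 0 \<and> x \<in> {b<..<a + 2 * pi}"
      by (rule eventually_conj)
    then have "\<exists>x. weight Z x \<noteq> 0 \<and> x \<in> {b<..<a + 2 * pi}" using eventually_happens'[of "at c"] by simp
    then show thesis using that by auto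
  qed
  \<comment> \<open>the point \<open>q\<close> avoids \<open>Z\<close>, where all values coincide\<close>
  define K where "K = (\<lambda>\<phi> Y. T \<phi> (Z + Y) \<and> size Z + size Y = Suc N \<and> set_mset Y \<subseteq> {a..b} \<and>
    (\<forall>t\<in>{b..a + 2 * pi}. \<phi>1 t \<le> \<phi> t))"
  define V where "V = {\<phi> q | \<phi> Y. K \<phi> Y}"
  have "compact V"
    unfolding compact_def
  proof (intro allI impI)
    fix f :: "nat \<Rightarrow> real" assume "\<forall>n. f n \<in> V"
    then have "\<forall>n. \<exists>\<phi> Y. f n = \<phi> q \<and> K \<phi> Y" unfolding V_def by blast
    then obtain \<phi> Y where \<phi>: "\<And>n. f n = \<phi> n q" "\<And>n. K (\<phi> n) (Y n)" by metis
    obtain r \<phi>' Y' where r: "strict_mono (r :: nat \<Rightarrow> nat)" "T \<phi>' (Z + Y')" "size Z + size Y' = Suc N"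
      "set_mset Y' \<subseteq> {a..b}" "\<And>t. (\<lambda>j. \<phi> (r j) t) \<longlonglongrightarrow> \<phi>' t"
      by (rule touches_compact[of \<phi> Z Y a b]) (use \<phi>(2) in \<open>auto simp: K_def\<close>)
    have "\<phi>1 t \<le> \<phi>' t" if "t \<in> {b..a + 2 * pi}" for t
      by (rule LIMSEQ_le_const[OF r(5)]) (use \<phi>(2) that in \<open>auto simp: K_def\<close>)
    then have "K \<phi>' Y'" using r unfolding K_def by blast
    then have "\<phi>' q \<in> V" unfolding V_def by blast
    moreover have "(f \<circ> r) \<longlonglongrightarrow> \<phi>' q" using r(5)[of q] \<phi>(1) by (simp add: o_def)
    ultimately show "\<exists>l\<in>V. \<exists>r. strict_mono r \<and> (f \<circ> r) \<longlonglongrightarrow> l" using r(1) by blast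
  qed
  moreover have "K \<phi>1 Y1" unfolding K_def using T1 size1 Y1 by auto
  then have "V \<noteq> {}" unfolding V_def by blast
  ultimately have "\<exists>v\<in>V. \<forall>w\<in>V. w \<le> v" by (rule compact_attains_sup)
  then obtain \<phi> Y where K: "K \<phi> Y" and max: "\<And>\<phi>' Y'. K \<phi>' Y' \<Longrightarrow> \<phi>' q \<le> \<phi> q"
    unfolding V_def by blast
  have T: "T \<phi> (Z + Y)" and size: "size Z + size Y = Suc N" and Y: "set_mset Y \<subseteq> {a..b}"
    and ge: "\<And>t. t \<in> {b..a + 2 * pi} \<Longrightarrow> \<phi>1 t \<le> \<phi> t" using K unfolding K_def by auto
  have TZ: "T \<phi> Z" "T \<phi>1 Z" using T T1 by (auto elim: touches_mono)
  have out: "\<not> T \<phi> (add_mset t Z)" if t: "t \<in> {b..a + 2 * pi}" for t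
  proof
    assume tt: "T \<phi> (add_mset t Z)"
    obtain \<alpha> where \<alpha>: "\<alpha> \<in> trig_polys (N - size Z)" "\<And>t. \<phi> t - \<phi>1 t = weight Z t * \<alpha> t"
      using touches_factor[OF TZ(2,1)] Z by auto
    have c: "isCont \<alpha> t" using trig_polys_isCont[OF \<alpha>(1)] .
    have "\<alpha> t \<ge> 0"
      by (rule weight_times_nonneg[OF ab(2) t _ c, of Z]) (use ge \<alpha>(2) in \<open>simp flip: \<alpha>(2)\<close>)
    moreover have "\<alpha> t \<le> 0" by (rule touches_factor_nonpos[OF tt touches_above[OF TZ(2)] \<alpha>(2) c])
    ultimately have "T \<phi>1 (add_mset t Z)" using touches_factor_zero[OF tt TZ(2) \<alpha>(2) c] by simp
    then show False using out1[OF t] by simp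
  qed
  have hull: "T \<phi> (add_mset m Z)"
    if Y': "T \<phi> (Z + Y')" "size Z + size Y' = Suc N" "set_mset Y' \<subseteq> {a..b}" "x \<in># Y'" "y \<in># Y'"
      "set_mset Y' \<subseteq> {x..y}" and m: "x \<le> m" "m \<le> y" for Y' x y m
  proof (rule ccontr)
    assume nm: "\<not> T \<phi> (add_mset m Z)"
    have xy: "a \<le> x" "y \<le> b" using Y' by auto
    then have "y < x + 2 * pi" using ab by simp
    from contacts_inward[OF Y'(1,2,6,4,5) this m nm]
    obtain \<phi>' p \<alpha> W where S: "x < m" "m < y" "x < p" "p < y" "Y' = add_mset x (add_mset y W)"
      "T \<phi>' (Z + add_mset p (add_mset m W))" "\<alpha> \<in> trig_polys 1"
      "\<And>t. \<phi>' t - \<phi> t = weight Z t * (weight W t * \<alpha> t)" "\<And>t. t \<in> {y..x + 2 * pi} \<Longrightarrow> \<alpha> t > 0" by metis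
    have \<alpha>: "\<alpha> t > 0" if "t \<in> {b..a + 2 * pi}" for t using that xy by (intro S(9)) auto
    have W: "set_mset W \<subseteq> {a..b}" using Y'(3) S(5) by auto
    have "\<phi>1 t \<le> \<phi>' t" if t: "t \<in> {b..a + 2 * pi}" for t
    proof -
      have "0 \<le> weight Z t * (weight W t * \<alpha> t)"
        by (intro mult_nonneg_nonneg weight_nonneg less_imp_le[OF \<alpha>[OF t]])
      then show ?thesis using S(8)[of t] ge[OF t] by linarith
    qed
    then have "K \<phi>' (add_mset p (add_mset m W))"
      unfolding K_def using S(1-4,6) W xy Y'(2)[unfolded S(5)] by auto
    then have "\<phi>' q \<le> \<phi> q" by (rule max)
    moreover have "weight W q > 0" by (rule weight_pos_outside[OF W]) (use q W in auto)
    then have "weight Z q * (weight W q * \<alpha> q) > 0"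
      using q \<alpha>[of q] weight_nonneg[of Z q] by (intro mult_pos_pos) auto
    ultimately show False using S(8)[of q] by linarith
  qed
  have Yne: "Y \<noteq> {#}" using size Z by auto
  define s where "s = Min_mset Y"
  have s: "s \<in># Y" "\<And>y. y \<in># Y \<Longrightarrow> s \<le> y" using Yne unfolding s_def by auto
  have flex: "T \<phi> (Z + replicate_mset (Suc N - size Z) s)"
  proof (cases "s = Max_mset Y")
    case True
    then have "set_mset Y \<subseteq> {s}" using s by (auto intro!: antisym)
    then have "Y = replicate_mset (size Y) s" by (rule set_mset_subset_singletonD)
    moreover have "size Y = Suc N - size Z" using size by simp
    ultimately have "Y = replicate_mset (Suc N - size Z) s" by metis
    with T show ?thesis by simp
  next
    case False
    have M: "Max_mset Y \<in># Y" "set_mset Y \<subseteq> {s..Max_mset Y}" using Yne s by auto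
    then have "s < Max_mset Y" using False s(2)[OF M(1)] by simp
    then show ?thesis
      by (rule touches_arc_flex) (use hull[OF T size Y s(1) M] M in auto)
  qed
  have "s \<in> {a..b}" using s(1) Y by auto
  have sC: "T \<phi> (add_mset s Z)" using T by (rule touches_mono) (use s(1) in \<open>metis add_mset_add_single mset_subset_eq_mono_add_left_cancel mset_subset_eq_single\<close>)
  have "s \<noteq> b" using out[of b] sC ab by auto
  moreover have "s \<noteq> a" using out[of "a + 2 * pi"] touches_cis[OF cis_add_2pi[symmetric] sC] ab by auto
  ultimately have s_in: "a < s" "s < b" using \<open>s \<in> {a..b}\<close> by auto
  have hull2: "T \<phi> (add_mset m Z)" if r: "T \<phi> (add_mset r Z)" "r \<noteq> s" "a < r" "r < b" and m: "min s r \<le> m" "m \<le> max s r" for r m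
  proof -
    have "cis r \<noteq> cis s" using r s_in ab by (intro cis_neq_within_period) auto
    note A = touches_flex_add[OF flex r(1) this]
    have n: "N - size Z > 0" using Z by simp
    show ?thesis
      by (rule hull[OF A _ _ _ _ _ m]) (use r s_in n Z in \<open>auto simp: min_def max_def\<close>)
  qed
  have "clean Z \<phi> s" unfolding clean_def
  proof (intro conjI flex allI impI)
    fix r assume r: "s < r" "r < s + 2 * pi" "T \<phi> (add_mset r Z)"
    show "(\<forall>t\<in>{s..r}. T \<phi> (add_mset t Z)) \<or> (\<forall>t\<in>{r..s + 2 * pi}. T \<phi> (add_mset t Z))"
    proof (cases "r < b")
      case True
      then have "\<forall>t\<in>{s..r}. T \<phi> (add_mset t Z)" using hull2[OF r(3)] r s_in by auto
      then show ?thesis ..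
    next
      case False
      then have "r > a + 2 * pi" using out[of r] r(3) by force
      moreover have r': "T \<phi> (add_mset (r - 2 * pi) Z)" using touches_cis[OF cis_diff_2pi[symmetric] r(3)] .
      ultimately have h: "T \<phi> (add_mset m Z)" if "r - 2 * pi \<le> m" "m \<le> s" for m
        using hull2[OF r'] r s_in that by auto
      have "T \<phi> (add_mset t Z)" if "t \<in> {r..s + 2 * pi}" for t
        using touches_cis[OF cis_diff_2pi h[of "t - 2 * pi"]] that by auto
      then show ?thesis by blast
    qed
  qed
  then show ?thesis using s_in out by blast
qed

lemma clean_flex_between:
  assumes Z: "size Z < N" and ab: "a < b" "b < a + 2 * pi"
    and T: "T \<phi> (Z + Y)" and size: "size Z + size Y = Suc N" and Y: "set_mset Y \<subseteq> {a..b}" "a \<in># Y" "b \<in># Y"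
    and m: "\<exists>m\<in>{a..b}. \<not> T \<phi> (add_mset m Z)"
  shows "\<exists>\<phi> s. a < s \<and> s < b \<and> clean Z \<phi> s \<and> (\<forall>t\<in>{b..a + 2 * pi}. \<not> T \<phi> (add_mset t Z))"
proof -
  have "Min_mset Y = a" "Max_mset Y = b" using Y by (auto intro!: Min_eqI Max_eqI)
  then have "\<exists>\<phi>1 Y1. size Y1 = size Y \<and> set_mset Y1 \<subseteq> {a<..<b} \<and> T \<phi>1 (Z + Y1) \<and>
    (\<forall>t\<in>{b..a + 2 * pi}. \<not> T \<phi>1 (add_mset t Z))"
    using m Y touches_mono[OF T, of Z]
    by (intro contacts_into_open_arc[OF ab _ T size Y(1), of \<phi> "\<lambda>t. 0"]) (auto simp: trig_polys_const)
  then obtain \<phi>1 Y1 where "size Y1 = size Y" "set_mset Y1 \<subseteq> {a<..<b}" "T \<phi>1 (Z + Y1)"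
    "\<And>t. t \<in> {b..a + 2 * pi} \<Longrightarrow> \<not> T \<phi>1 (add_mset t Z)" by blast
  then show ?thesis using clean_flex_inside[OF Z ab] size by metis
qed

lemma touches_replicate_cis:
  assumes "cis s = cis s'" "T \<phi> (X + replicate_mset k s)"
  shows "T \<phi> (X + replicate_mset k s')"
  using assms(2) by (rule touches_mult_at_cong) (use assms(1) in auto)

text \<open>
  Unless \<open>x\<close> is a clean flex, the polynomial with \<open>n\<close>-fold contact at \<open>x\<close> has another contact \<open>r\<close> that is not
  joined to \<open>x\<close> by an arc of contacts on either side.
\<close>

lemma clean_or_split:
  assumes Z: "size Z + n = N" "n \<ge> 1"
  shows "(\<exists>\<phi>. clean Z \<phi> x) \<or> (\<exists>\<phi> r. x < r \<and> r < x + 2 * pi \<and> T \<phi> (Z + add_mset r (replicate_mset n x)) \<and>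
    (\<exists>m\<in>{x..r}. \<not> T \<phi> (add_mset m Z)) \<and> (\<exists>m\<in>{r..x + 2 * pi}. \<not> T \<phi> (add_mset m Z)))"
    (is "?C \<or> ?S")
proof -
  have n: "Suc N - size Z = Suc n" "N - size Z = n" using Z by auto
  have flex_case: "?C \<or> ?S" if flex: "T \<phi> (Z + replicate_mset (Suc N - size Z) x)" for \<phi>
  proof (cases "clean Z \<phi> x")
    case True
    then show ?thesis by blast
  next
    case False
    then obtain r where r: "x < r" "r < x + 2 * pi" "T \<phi> (add_mset r Z)"
      "\<exists>m\<in>{x..r}. \<not> T \<phi> (add_mset m Z)" "\<exists>m\<in>{r..x + 2 * pi}. \<not> T \<phi> (add_mset m Z)"
      using flex unfolding clean_def by blast
    have "cis r \<noteq> cis x" using r by (intro cis_neq_within_period) auto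
    then have "T \<phi> (Z + add_mset r (replicate_mset n x))" using touches_flex_add[OF flex r(3)] n by simp
    then show ?thesis using r by blast
  qed
  obtain \<phi> r0 where r0: "T \<phi> (add_mset r0 (Z + replicate_mset n x))"
    using touches_exists[of "Z + replicate_mset n x"] Z by auto
  obtain r where r: "r \<in> {x..<x + 2 * pi}" "cis r = cis r0" using cis_representative by blast
  have Tr: "T \<phi> (Z + add_mset r (replicate_mset n x))" using touches_cis[OF r(2)[symmetric] r0] by simp
  show ?thesis
  proof (cases "r = x")
    case True
    then show ?thesis using flex_case[of \<phi>] Tr n by simp
  next
    case False
    then have r1: "x < r" "r < x + 2 * pi" using r(1) by auto
    show ?thesis
    proof (cases "(\<forall>m\<in>{x..r}. T \<phi> (add_mset m Z)) \<or> (\<forall>m\<in>{r..x + 2 * pi}. T \<phi> (add_mset m Z))")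
      case True
      then have "T \<phi> (Z + replicate_mset (Suc N - size Z) x)"
      proof
        assume "\<forall>m\<in>{x..r}. T \<phi> (add_mset m Z)"
        then show ?thesis using r1 by (intro touches_arc_flex[of x r]) auto
      next
        assume "\<forall>m\<in>{r..x + 2 * pi}. T \<phi> (add_mset m Z)"
        then have "T \<phi> (Z + replicate_mset (Suc N - size Z) (x + 2 * pi))"
          using r1 by (intro touches_arc_flex[of r "x + 2 * pi"]) auto
        then show ?thesis by (rule touches_replicate_cis[OF cis_add_2pi])
      qed
      then show ?thesis by (rule flex_case)
    next
      case False
      then show ?thesis using r1 Tr by blast
    qed
  qed
qed

lemma clean_contact: "clean Z \<phi> s \<Longrightarrow> size Z \<le> N \<Longrightarrow> T \<phi> (add_mset s Z)"
  unfolding clean_def by (elim conjE touches_mono) (simp add: Suc_diff_le)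

lemma split_clean_pair:
  assumes Z: "Suc (size Z) = N"
    and r: "x < r" "r < x + 2 * pi" "T \<phi> (Z + add_mset r {#x#})"
      "\<exists>m\<in>{x..r}. \<not> T \<phi> (add_mset m Z)" "\<exists>m\<in>{r..x + 2 * pi}. \<not> T \<phi> (add_mset m Z)"
  shows "\<exists>\<phi>1 \<phi>2 s1 s2. \<phi>1 \<noteq> \<phi>2 \<and> clean Z \<phi>1 s1 \<and> clean Z \<phi>2 s2"
proof -
  have Z': "size Z < N" using Z by simp
  obtain \<phi>1 s1 where 1: "x < s1" "s1 < r" "clean Z \<phi>1 s1"
    using clean_flex_between[OF Z' r(1,2,3) _ _ _ _ r(4)] Z r by auto
  have r': "T \<phi> (Z + add_mset r {#x + 2 * pi#})"
    using touches_cis[OF cis_add_2pi[symmetric], of \<phi> x "add_mset r Z"] r(3) by (simp add: add_mset_commute)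
  obtain \<phi>2 s2 where 2: "clean Z \<phi>2 s2" "\<And>t. t \<in> {x + 2 * pi..r + 2 * pi} \<Longrightarrow> \<not> T \<phi>2 (add_mset t Z)"
    using clean_flex_between[OF Z' r(2) _ r' _ _ _ _ r(5)] Z r by auto
  have "T \<phi>1 (add_mset (s1 + 2 * pi) Z)"
    using touches_cis[OF cis_add_2pi[symmetric] clean_contact[OF 1(3)]] Z' by simp
  then have "\<phi>1 \<noteq> \<phi>2" using 2(2)[of "s1 + 2 * pi"] 1 by auto
  then show ?thesis using 1 2 by blast
qed

text \<open>
  The \<open>n\<close>-fold contact is moved from \<open>a\<close> to \<open>b\<close>, one unit of multiplicity at a time. The remaining contact
  \<open>P\<close> starts at \<open>p + 2 * pi\<close> and moves to the left, because contacts do not cross. It cannot stay to the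
  right of \<open>b\<close> until the end: the last polynomial would be \<open>\<phi>b\<close>, which touches \<open>u\<close> at \<open>p\<close>, while
  an exchange destroys the contact at \<open>p\<close>. So at some stage all contacts besides \<open>Z\<close> lie in the arc from
  \<open>a\<close> to \<open>b\<close>, and both end points are among them.
\<close>

lemma clean_between_flexes:
  assumes Z: "size Z + n = N" "n \<ge> 1"
    and ord: "p < a" "a < b" "b < p + 2 * pi"
    and a: "T \<phi>a (add_mset p Z + replicate_mset n a)" and b: "T \<phi>b (add_mset p Z + replicate_mset n b)"
    and ne: "\<phi>a \<noteq> \<phi>b"
  shows "\<exists>\<phi> s. a < s \<and> s < b \<and> clean Z \<phi> s \<and> (\<forall>t\<in>{b..a + 2 * pi}. \<not> T \<phi> (add_mset t Z))"
proof (rule ccontr)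
  assume neg: "\<not> ?thesis"
  have Z': "size Z < N" using Z by simp
  have no_arc: "\<exists>m\<in>{a..b}. \<not> T \<phi> (add_mset m Z)" for \<phi>
  proof (rule ccontr)
    assume "\<not> ?thesis"
    then have "\<And>t. t \<in> {a..b} \<Longrightarrow> T \<phi> (add_mset t Z)" by blast
    then have "T \<phi> (Z + replicate_mset (Suc N - size Z) a)" "T \<phi> (Z + replicate_mset (Suc N - size Z) b)"
      using touches_arc_flex[OF ord(2)] ord(2) by auto
    then have "\<phi> = \<phi>a" "\<phi> = \<phi>b" using touches_flex_at_unique[OF Z(1)] a b by auto
    then show False using ne by simp
  qed
  have none: False if "T \<phi> (Z + Y)" "size Z + size Y = Suc N" "set_mset Y \<subseteq> {a..b}" "a \<in># Y" "b \<in># Y" for \<phi> Y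
    using clean_flex_between[OF Z' ord(2) _ that no_arc] ord neg by auto
  have ab: "cis a \<noteq> cis b" using ord by (intro cis_neq_within_period) auto
  have step: "\<exists>\<phi>' P'. T \<phi>' (add_mset P' (add_mset b (Z + replicate_mset (n - Suc k) a + replicate_mset k b))) \<and>
      a < P' \<and> P' < P \<and> \<not> T \<phi>' (add_mset p (Z + replicate_mset (n - Suc k) a + replicate_mset k b))"
    if k: "k < n" and P: "b < P" "P \<le> p + 2 * pi"
      and T: "T \<phi> (add_mset P (Z + replicate_mset (n - k) a + replicate_mset k b))" for k \<phi> P
  proof -
    define V where "V = Z + replicate_mset (n - Suc k) a + replicate_mset k b"
    have V: "Suc (size V) = N" using k Z by (simp add: V_def)
    have na: "replicate_mset (n - k) a = add_mset a (replicate_mset (n - Suc k) a)"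
      using k by (metis Suc_diff_Suc replicate_mset_Suc)
    have TV: "T \<phi> (add_mset a (add_mset P V))" using T unfolding V_def na by (simp add: add_mset_commute)
    have nb: "\<not> T \<phi> (add_mset b V)"
    proof
      assume "T \<phi> (add_mset b V)"
      then have "T \<phi> (add_mset a (add_mset b V))"
        by (rule touches_combine[OF TV]) (use ab in auto)
      then show False
        by (intro none[of \<phi> "replicate_mset (n - k) a + replicate_mset (Suc k) b"])
          (use k Z ord in \<open>auto simp: V_def na add_mset_commute add.assoc\<close>)
    qed
    have "P < a + 2 * pi" using P ord by simp
    then obtain \<phi>' P' \<alpha> where S: "a < P'" "P' < P" "T \<phi>' (add_mset P' (add_mset b V))" "\<alpha> \<in> trig_polys 1"
      "\<And>t. \<phi>' t - \<phi> t = weight V t * \<alpha> t" "\<And>t. t \<in> {P..a + 2 * pi} \<Longrightarrow> \<alpha> t > 0"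
      using exchange_contacts[OF V TV ord(2) P(1) _ nb] by metis
    have "\<not> T \<phi>' (add_mset p V)"
    proof
      assume "T \<phi>' (add_mset p V)"
      then have "T \<phi>' (add_mset (p + 2 * pi) V)" using touches_cis[OF cis_add_2pi[symmetric]] by blast
      then have "\<alpha> (p + 2 * pi) \<le> 0"
        by (rule touches_factor_nonpos[OF _ touches_above[OF TV] S(5)]) (rule trig_polys_isCont[OF S(4)])
      then show False using S(6)[of "p + 2 * pi"] P ord by auto
    qed
    then show ?thesis using S unfolding V_def by blast
  qed
  have chain: "\<exists>\<phi> P. b < P \<and> P \<le> p + 2 * pi \<and> T \<phi> (add_mset P (Z + replicate_mset (n - k) a + replicate_mset k b))"
    if "k < n" for k
    using that
  proof (induction k)
    case 0
    have "T \<phi>a (add_mset (p + 2 * pi) (Z + replicate_mset n a))"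
      using touches_cis[OF cis_add_2pi[symmetric], of \<phi>a p "Z + replicate_mset n a"] a by simp
    then show ?case using ord by (intro exI[of _ \<phi>a] exI[of _ "p + 2 * pi"]) auto
  next
    case (Suc k)
    then obtain \<phi> P where P: "b < P" "P \<le> p + 2 * pi" "T \<phi> (add_mset P (Z + replicate_mset (n - k) a + replicate_mset k b))"
      by auto
    obtain \<phi>' P' where P': "T \<phi>' (add_mset P' (add_mset b (Z + replicate_mset (n - Suc k) a + replicate_mset k b)))"
      "a < P'" "P' < P" using step[OF _ P] Suc by auto
    have T': "T \<phi>' (add_mset P' (Z + replicate_mset (n - Suc k) a + replicate_mset (Suc k) b))"
      using P'(1) by simp
    have "b < P'"
    proof (rule ccontr)
      assume "\<not> b < P'"
      moreover have "n - Suc k > 0" using Suc.prems by simp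
      ultimately show False
        by (intro none[of \<phi>' "add_mset P' (replicate_mset (n - Suc k) a + replicate_mset (Suc k) b)"])
          (use T' P' ord Z Suc.prems in \<open>auto simp: add.assoc\<close>)
    qed
    then show ?case using T' P' P by (intro exI[of _ \<phi>'] exI[of _ P']) auto
  qed
  obtain \<phi> P where P: "b < P" "P \<le> p + 2 * pi"
    "T \<phi> (add_mset P (Z + replicate_mset (n - (n - 1)) a + replicate_mset (n - 1) b))"
    using chain[of "n - 1"] Z by auto
  have n1: "n - Suc (n - 1) = 0" "replicate_mset n b = add_mset b (replicate_mset (n - 1) b)"
    using Z(2) by (auto simp flip: replicate_mset_Suc)
  obtain \<phi>' P' where P': "T \<phi>' (add_mset P' (add_mset b (Z + replicate_mset (n - 1) b)))"
      "\<not> T \<phi>' (add_mset p (Z + replicate_mset (n - 1) b))"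
    using step[OF _ P] Z n1 by auto
  have "\<phi>' = \<phi>b"
  proof (rule touches_unique)
    show "size (Z + replicate_mset n b) = N" using Z by simp
    show "T \<phi>' (add_mset P' (Z + replicate_mset n b))" using P'(1) by (simp add: n1)
    show "T \<phi>b (add_mset p (Z + replicate_mset n b))" using b by simp
  qed
  moreover have "T \<phi>b (add_mset p (Z + replicate_mset (n - 1) b))" using b by (rule touches_mono) (simp add: n1)
  ultimately show False using P'(2) by simp
qed

text \<open>
  Induction on \<open>n\<close>, the degree that remains after the contacts in \<open>Z\<close> are prescribed. A clean flex \<open>p\<close> is added to \<open>Z\<close>;
  the polynomials obtained for \<open>n - 1\<close>, with the one of \<open>p\<close> removed, provide at least
  \<open>n - 1\<close> further points with \<open>n\<close>-fold contact. Each arc between neighbours among these points and \<open>p\<close> contains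
  a clean flex without contacts outside the arc, so the resulting polynomials differ from each
  other and from that of \<open>p\<close>. Distinct polynomials, rather than distinct points, are counted, because an
  arc of coincidence carries infinitely many flexes of one polynomial. For \<open>n = 1\<close> there may be no further point.
  Then either two points with different polynomials are clean flexes themselves, or a non-clean point and its second
  contact bound two arcs, each of which contains a clean flex.
\<close>

theorem clean_flexes:
  assumes u: "u \<notin> trig_polys N"
  shows "size Z + n = N \<Longrightarrow> \<exists>\<Phi>. finite \<Phi> \<and> card \<Phi> \<ge> Suc n \<and>
    (\<forall>\<phi>\<in>\<Phi>. \<exists>s. T \<phi> (Z + replicate_mset (Suc n) s) \<and> (n \<ge> 1 \<longrightarrow> clean Z \<phi> s))"
proof (induction n arbitrary: Z)
  case 0
  then obtain \<phi> t where "T \<phi> (add_mset t Z)" using touches_exists[of Z] by auto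
  then show ?case by (intro exI[of _ "{\<phi>}"]) auto
next
  case (Suc k)
  define n where "n = Suc k"
  have Z: "size Z + n = N" "n \<ge> 1" "size Z < N" "Suc N - size Z = Suc n" using Suc.prems by (auto simp: n_def)
  have flex: "T \<phi> (Z + replicate_mset (Suc n) s)" if "clean Z \<phi> s" for \<phi> s using that Z(4) by (simp add: clean_def)
  have goal: ?case if "finite \<Phi>" "card \<Phi> \<ge> Suc n" "\<And>\<phi>. \<phi> \<in> \<Phi> \<Longrightarrow> \<exists>s. clean Z \<phi> s" for \<Phi>
    using that flex unfolding n_def[symmetric] by (intro exI[of _ \<Phi>]) blast
  show ?case
  proof (cases "n = 1")
    case True
    then have Z1: "Suc (size Z) = N" using Z by simp
    have pair: ?thesis if "\<phi>1 \<noteq> \<phi>2" "clean Z \<phi>1 s1" "clean Z \<phi>2 s2" for \<phi>1 \<phi>2 s1 s2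
      by (rule goal[of "{\<phi>1, \<phi>2}"]) (use that True in auto)
    have at: "(\<exists>\<phi>. clean Z \<phi> x) \<or> ?thesis" for x
      using clean_or_split[OF Z(1,2), of x]
    proof
      assume "\<exists>\<phi> r. x < r \<and> r < x + 2 * pi \<and> T \<phi> (Z + add_mset r (replicate_mset n x)) \<and>
        (\<exists>m\<in>{x..r}. \<not> T \<phi> (add_mset m Z)) \<and> (\<exists>m\<in>{r..x + 2 * pi}. \<not> T \<phi> (add_mset m Z))"
      then obtain \<phi> r where r: "x < r" "r < x + 2 * pi" "T \<phi> (Z + add_mset r (replicate_mset n x))"
        "\<exists>m\<in>{x..r}. \<not> T \<phi> (add_mset m Z)" "\<exists>m\<in>{r..x + 2 * pi}. \<not> T \<phi> (add_mset m Z)" by blast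
      have "T \<phi> (Z + add_mset r {#x#})" using r(3) True by simp
      from split_clean_pair[OF Z1 r(1,2) this r(4,5)] show ?thesis using pair by blast
    qed blast
    show ?thesis
    proof (cases "\<exists>\<phi>. clean Z \<phi> 0")
      case True
      then obtain \<phi> where \<phi>: "clean Z \<phi> 0" by blast
      obtain y where y: "\<not> T \<phi> (add_mset y Z)"
      proof (rule ccontr)
        assume "\<not> thesis"
        then have "T \<phi> (add_mset y Z)" for y using that by blast
        then have "\<phi> = u" "\<phi> \<in> trig_polys N" using touches_add_value touches_trig_poly by blast+
        then show False using u by simp
      qed
      show ?thesis
      proof (cases "\<exists>\<phi>. clean Z \<phi> y")
        case True
        then obtain \<phi>' where \<phi>': "clean Z \<phi>' y" by blast
        then have "\<phi> \<noteq> \<phi>'" using y clean_contact Z(3) by auto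
        then show ?thesis using pair \<phi> \<phi>' by blast
      qed (use at in blast)
    qed (use at in blast)
  next
    case False
    then have n2: "n \<ge> 2" using Z by simp
    obtain p \<phi>p where p: "clean Z \<phi>p p"
    proof -
      consider \<phi> where "clean Z \<phi> 0" | \<phi> r where "0 < r" "r < 0 + 2 * pi" "T \<phi> (Z + add_mset r (replicate_mset n 0))"
        "\<exists>m\<in>{0..r}. \<not> T \<phi> (add_mset m Z)"
        using clean_or_split[OF Z(1,2), of 0] by blast
      then show thesis
      proof cases
        case 2
        then have "\<exists>\<phi> s. 0 < s \<and> s < r \<and> clean Z \<phi> s \<and> (\<forall>t\<in>{r..0 + 2 * pi}. \<not> T \<phi> (add_mset t Z))"
          by (intro clean_flex_between[OF Z(3) 2(1,2,3) _ _ _ _ 2(4)]) (use Z in auto)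
        then show thesis using that by blast
      qed (rule that)
    qed
    have pC: "T \<phi>p (add_mset p Z)" using clean_contact[OF p] Z by simp
    obtain \<Phi>0 where \<Phi>0: "finite \<Phi>0" "card \<Phi>0 \<ge> n" "\<And>\<phi>. \<phi> \<in> \<Phi>0 \<Longrightarrow> \<exists>s. T \<phi> (add_mset p Z + replicate_mset n s)"
    proof -
      have "size (add_mset p Z) + k = N" using Suc.prems by simp
      from Suc.IH[OF this] show thesis using that unfolding n_def[symmetric] by blast
    qed
    define \<Phi>1 where "\<Phi>1 = \<Phi>0 - {\<phi>p}"
    have \<Phi>1: "finite \<Phi>1" "card \<Phi>1 \<ge> n - 1"
      using \<Phi>0(1,2) card_Diff1_le[of \<Phi>0 \<phi>p] unfolding \<Phi>1_def by (auto simp: card_Diff_singleton_if)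
    have p_unique: "\<phi> = \<phi>p" if "T \<phi> (Z + replicate_mset (Suc N - size Z) p)" for \<phi>
      by (rule touches_flex_at_unique[OF Z(1) that, of \<phi>p p]) (use flex[OF p] in simp)
    have "\<exists>s. s \<in> {p<..<p + 2 * pi} \<and> T \<phi> (add_mset p Z + replicate_mset n s)" if \<phi>: "\<phi> \<in> \<Phi>1" for \<phi>
    proof -
      obtain s0 where s0: "T \<phi> (add_mset p Z + replicate_mset n s0)" using \<Phi>0(3) \<phi> unfolding \<Phi>1_def by blast
      obtain s where s: "s \<in> {p..<p + 2 * pi}" "cis s = cis s0" using cis_representative by blast
      have T: "T \<phi> (add_mset p Z + replicate_mset n s)" using touches_replicate_cis[OF s(2)[symmetric] s0] .
      have "s \<noteq> p"
      proof
        assume "s = p"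
        then have "T \<phi> (Z + replicate_mset (Suc N - size Z) p)" using T Z(4) by simp
        then show False using p_unique \<phi> unfolding \<Phi>1_def by blast
      qed
      then show ?thesis using s(1) T by (intro exI[of _ s]) auto
    qed
    then obtain \<sigma> where \<sigma>: "\<And>\<phi>. \<phi> \<in> \<Phi>1 \<Longrightarrow> \<sigma> \<phi> \<in> {p<..<p + 2 * pi}"
      "\<And>\<phi>. \<phi> \<in> \<Phi>1 \<Longrightarrow> T \<phi> (add_mset p Z + replicate_mset n (\<sigma> \<phi>))" by metis
    have inj: "inj_on \<sigma> \<Phi>1"
    proof (rule inj_onI)
      fix \<phi> \<phi>' assume a: "\<phi> \<in> \<Phi>1" "\<phi>' \<in> \<Phi>1" "\<sigma> \<phi> = \<sigma> \<phi>'"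
      show "\<phi> = \<phi>'"
        by (rule touches_unique[of "Z + replicate_mset n (\<sigma> \<phi>)" _ p _ p]) (use \<sigma>(2)[OF a(1)] \<sigma>(2)[OF a(2)] a(3) Z in auto)
    qed
    define S where "S = \<sigma> ` \<Phi>1"
    have S: "finite S" "card S \<ge> n - 1" "S \<subseteq> {p<..<p + 2 * pi}"
      using \<Phi>1 \<sigma>(1) inj unfolding S_def by (auto simp: card_image)
    have Sne: "S \<noteq> {}" using S(2) n2 by auto
    \<comment> \<open>the arcs run from \<open>q\<close> to the next point, counting \<open>p\<close> also as \<open>p + 2 * pi\<close>\<close>
    define nxt where "nxt = (\<lambda>q. Min {x \<in> insert (p + 2 * pi) S. q < x})"
    have nxt: "nxt q \<in> insert (p + 2 * pi) S" "q < nxt q" "\<And>x. x \<in> insert (p + 2 * pi) S \<Longrightarrow> q < x \<Longrightarrow> nxt q \<le> x"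
      if q: "q \<in> insert p S" for q
    proof -
      have fin: "finite {x \<in> insert (p + 2 * pi) S. q < x}" using S(1) by simp
      have "p + 2 * pi \<in> {x \<in> insert (p + 2 * pi) S. q < x}" using q S(3) by auto
      then have "{x \<in> insert (p + 2 * pi) S. q < x} \<noteq> {}" by blast
      from Min_in[OF fin this] show "nxt q \<in> insert (p + 2 * pi) S" "q < nxt q" unfolding nxt_def by auto
      show "nxt q \<le> x" if "x \<in> insert (p + 2 * pi) S" "q < x" for x
        unfolding nxt_def using that by (intro Min_le[OF fin]) auto
    qed
    have "\<exists>\<phi> s. q < s \<and> s < nxt q \<and> clean Z \<phi> s \<and> (\<forall>t\<in>{nxt q..q + 2 * pi}. \<not> T \<phi> (add_mset t Z))"
      if q: "q \<in> insert p S" for q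
    proof (cases "q = p")
      case True
      have "\<exists>y. y \<in> S" using Sne by blast
      then have "nxt p < p + 2 * pi" using nxt(3)[of p] S(3) by fastforce
      then have "nxt p \<in> S" using nxt(1)[of p] by auto
      then obtain \<phi> where \<phi>: "\<phi> \<in> \<Phi>1" "nxt p = \<sigma> \<phi>" unfolding S_def by blast
      have "\<exists>\<phi> s. p < s \<and> s < \<sigma> \<phi>' \<and> clean Z \<phi> s \<and> (\<forall>t\<in>{\<sigma> \<phi>'..p + 2 * pi}. \<not> T \<phi> (add_mset t Z))"
        if \<phi>': "\<phi>' \<in> \<Phi>1" for \<phi>'
      proof (rule clean_flex_between[OF Z(3), of _ _ \<phi>' "add_mset p (replicate_mset n (\<sigma> \<phi>'))"])
        show "p < \<sigma> \<phi>'" "\<sigma> \<phi>' < p + 2 * pi" using \<sigma>(1)[OF \<phi>'] by auto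
        show "T \<phi>' (Z + add_mset p (replicate_mset n (\<sigma> \<phi>')))" using \<sigma>(2)[OF \<phi>'] by simp
        show "\<exists>m\<in>{p..\<sigma> \<phi>'}. \<not> T \<phi>' (add_mset m Z)"
        proof (rule ccontr)
          assume "\<not> ?thesis"
          then have "T \<phi>' (Z + replicate_mset (Suc N - size Z) p)"
            using \<sigma>(1)[OF \<phi>'] by (intro touches_arc_flex[of p "\<sigma> \<phi>'"]) auto
          then show False using p_unique \<phi>' unfolding \<Phi>1_def by blast
        qed
      qed (use \<sigma>(1)[OF \<phi>'] Z in auto)
      then show ?thesis using \<phi> True by simp
    next
      case False
      then have "q \<in> S" using q by simp
      then obtain \<phi> where \<phi>: "\<phi> \<in> \<Phi>1" "q = \<sigma> \<phi>" unfolding S_def by blast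
      note q_in = \<sigma>(1)[OF \<phi>(1), folded \<phi>(2)]
      note Tq = \<sigma>(2)[OF \<phi>(1), folded \<phi>(2)]
      show ?thesis
      proof (cases "nxt q = p + 2 * pi")
        case True
        have cp: "cis p = cis (p + 2 * pi)" by simp
        show ?thesis unfolding True
        proof (rule clean_flex_between[OF Z(3), of _ _ \<phi> "add_mset (p + 2 * pi) (replicate_mset n q)"])
          show "q < p + 2 * pi" "p + 2 * pi < q + 2 * pi" using q_in by auto
          show "T \<phi> (Z + add_mset (p + 2 * pi) (replicate_mset n q))"
            using touches_cis[OF cp, of \<phi> "Z + replicate_mset n q"] Tq by simp
          show "\<exists>m\<in>{q..p + 2 * pi}. \<not> T \<phi> (add_mset m Z)"
          proof (rule ccontr)
            assume "\<not> ?thesis"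
            then have "T \<phi> (Z + replicate_mset (Suc N - size Z) (p + 2 * pi))"
              using q_in by (intro touches_arc_flex[of q "p + 2 * pi"]) auto
            then have "T \<phi> (Z + replicate_mset (Suc N - size Z) p)" by (rule touches_replicate_cis[OF cp[symmetric]])
            then show False using p_unique \<phi>(1) unfolding \<Phi>1_def by blast
          qed
        qed (use q_in Z in auto)
      next
        case False
        then have "nxt q \<in> S" using nxt(1)[OF q] by simp
        then obtain \<phi>' where \<phi>': "\<phi>' \<in> \<Phi>1" "nxt q = \<sigma> \<phi>'" unfolding S_def by blast
        have "\<phi> \<noteq> \<phi>'" using \<phi>(2) \<phi>'(2) nxt(2)[OF q] by auto
        then show ?thesis
          using clean_between_flexes[OF Z(1,2) _ nxt(2)[OF q] _ Tq \<sigma>(2)[OF \<phi>'(1), folded \<phi>'(2)]]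
            q_in \<sigma>(1)[OF \<phi>'(1)] \<phi>'(2) by auto
      qed
    qed
    then obtain \<psi> s where \<psi>: "\<And>q. q \<in> insert p S \<Longrightarrow> q < s q \<and> s q < nxt q \<and> clean Z (\<psi> q) (s q) \<and>
        (\<forall>t\<in>{nxt q..q + 2 * pi}. \<not> T (\<psi> q) (add_mset t Z))" by metis
    have lt: "\<psi> q \<noteq> \<psi> q'" if q: "q \<in> insert p S" "q' \<in> insert p S" "q < q'" for q q'
    proof
      assume eq: "\<psi> q = \<psi> q'"
      have "q' \<in> insert (p + 2 * pi) S" using q S(3) by auto
      then have "nxt q \<le> q'" using nxt(3)[OF q(1)] q(3) by blast
      moreover have "nxt q' \<le> p + 2 * pi" using nxt(3)[OF q(2), of "p + 2 * pi"] q(2) S(3) by auto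
      moreover have "p \<le> q" using q(1) S(3) by auto
      ultimately have "s q' \<in> {nxt q..q + 2 * pi}" using \<psi>[OF q(2)] by auto
      moreover have "T (\<psi> q') (add_mset (s q') Z)" using \<psi>[OF q(2)] clean_contact Z(3) by auto
      ultimately show False using \<psi>[OF q(1)] eq by auto
    qed
    have injp: "inj_on \<psi> (insert p S)"
      by (rule inj_onI, rule ccontr) (use lt in \<open>metis linorder_neqE_linordered_idom\<close>)
    have "\<phi>p \<notin> \<psi> ` insert p S"
    proof
      assume "\<phi>p \<in> \<psi> ` insert p S"
      then obtain q where q: "q \<in> insert p S" "\<phi>p = \<psi> q" by blast
      have "nxt q \<le> p + 2 * pi" using nxt(3)[OF q(1), of "p + 2 * pi"] q(1) S(3) by auto
      moreover have "p \<le> q" using q(1) S(3) by auto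
      ultimately have "\<not> T \<phi>p (add_mset (p + 2 * pi) Z)" using \<psi>[OF q(1)] q(2) by auto
      then show False using touches_cis[OF cis_add_2pi[symmetric] pC] by blast
    qed
    moreover have "card (\<psi> ` insert p S) = Suc (card S)"
      using card_image[OF injp] S(1,3) by (subst (asm) card_insert_disjoint) auto
    ultimately have "card (insert \<phi>p (\<psi> ` insert p S)) \<ge> Suc n" using S(1,2) n2 by simp
    then show ?thesis using goal[of "insert \<phi>p (\<psi> ` insert p S)"] p \<psi> S(1) by blast
  qed
qed

end

section \<open>Flexes of functions on the circle\<close>

lemma (in circle_function) touches_deriv_eq:
  assumes T: "T \<phi> (replicate_mset (Suc N) s)" and j: "j \<le> 2 * N"
  shows "(deriv ^^ j) \<phi> s = (deriv ^^ j) u s"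
proof -
  have "(deriv ^^ j) (\<lambda>t. \<phi> t - u t) s = 0" by (rule touches_gap_deriv[OF T]) (use j in auto)
  then show ?thesis
    using fun_cong[OF deriv_pow_diff[OF trig_polys_cont_diff[OF touches_trig_poly[OF T]] smooth j], of s] by simp
qed

text \<open>
  Uniqueness of the osculating polynomial: the difference of two candidates is a constant multiple of the
  weight with an \<open>n\<close>-fold point at \<open>s\<close>, which vanishes there only to order \<open>2 n - 1\<close>.
\<close>

lemma osculating_poly_eqI:
  assumes \<phi>: "\<phi> \<in> trig_polys n" and d: "\<And>j. j \<le> 2 * n \<Longrightarrow> (deriv ^^ j) \<phi> s = (deriv ^^ j) u s"
  shows "osculating_poly n u s = \<phi>"
proof -
  have uniq: "\<psi> = \<phi>" if \<psi>: "\<psi> \<in> trig_polys n" "\<And>j. j \<le> 2 * n \<Longrightarrow> (deriv ^^ j) \<psi> s = (deriv ^^ j) u s" for \<psi>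
  proof -
    let ?f = "\<lambda>t. \<psi> t - \<phi> t"
    have f: "?f \<in> trig_polys n" using \<psi>(1) \<phi> by (rule trig_polys_diff)
    have "(deriv ^^ j) ?f s = 0" if "j \<le> 2 * n" for j
      using fun_cong[OF deriv_pow_diff[OF trig_polys_cont_diff[OF \<psi>(1)] trig_polys_cont_diff[OF \<phi>] that], of s] \<psi>(2)[OF that] d[OF that] by simp
    then have v: "vanish_order ?f s (2 * n)" using vanish_order_iff_deriv[OF trig_polys_cont_diff[OF f]] by simp
    have "\<exists>g\<in>trig_polys (n - size (replicate_mset n s)). ?f = (\<lambda>t. weight (replicate_mset n s) t * g t)"
    proof (rule trig_poly_divide_weight[OF f])
      fix r assume "mult_at (replicate_mset n s) r > 0"
      then have r: "cis s = cis r" "mult_at (replicate_mset n s) r = n" by (auto split: if_splits)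
      have "vanish_order ?f r (2 * n)" using vanish_order_cong_cis[OF trig_polys_periodic[OF f] r(1) v] .
      then show "vanish_order ?f r (2 * mult_at (replicate_mset n s) r - 1)" unfolding r(2) by (rule vanish_order_mono) simp
    qed simp
    then obtain g where g: "g \<in> trig_polys 0" "?f = (\<lambda>t. weight (replicate_mset n s) t * g t)" by auto
    then obtain c where "g = (\<lambda>t. c)" using trig_polys_0_iff by blast
    then have c: "?f t = weight (replicate_mset n s) t * c" for t using fun_cong[OF g(2)] by simp
    have "vanish_order (\<lambda>t. ?f t / weight (replicate_mset n s) t) s 0"
      by (rule vanish_order_divide_weight) (use v in simp)
    moreover have "\<forall>\<^sub>F t in at s. ?f t / weight (replicate_mset n s) t = c"
      using weight_eventually_nonzero[of "replicate_mset n s" s] by (rule eventually_mono) (simp add: c)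
    ultimately have "vanish_order (\<lambda>t. c) s 0" by (rule vanish_order_cong)
    then have "c = 0" by (simp add: vanish_order_def tendsto_const_iff)
    then show ?thesis using c by (auto simp: fun_eq_iff)
  qed
  show ?thesis unfolding osculating_poly_def
  proof (rule the_equality)
    show "\<phi> \<in> trig_polys n \<and> (\<forall>j\<le>2 * n. (deriv ^^ j) \<phi> s = (deriv ^^ j) u s)" using \<phi> d by blast
  qed (use uniq in blast)
qed

lemma osculating_poly_touches:
  assumes u: "periodic_2pi u" "cont_diff (2 * n) u" and T: "touches n u \<phi> (replicate_mset (Suc n) s)"
  shows "osculating_poly n u s = \<phi>"
proof -
  interpret circle_function n u using u by unfold_locales
  show ?thesis using osculating_poly_eqI[OF touches_trig_poly[OF T]] touches_deriv_eq[OF T] by blast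
qed

text \<open>
  The contact set is the union of arcs that contain \<open>s\<close>.
\<close>

lemma clean_maximal_flex_of_clean:
  assumes u: "periodic_2pi u" "cont_diff (2 * n) u" and c: "circle_function.clean n u {#} \<phi> s"
  shows "clean_maximal_flex n u s" "osculating_poly n u s = \<phi>"
proof -
  interpret circle_function n u using u by unfold_locales
  have T: "T \<phi> (replicate_mset (Suc n) s)"
    using c unfolding clean_def by simp
  have single: "T \<phi> {#t#} \<longleftrightarrow> \<phi> t = u t" for t
    using touches_single_iff touches_trig_poly[OF T] touches_above[OF T] by blast
  note arcs = c[unfolded clean_def, THEN conjunct2, unfolded single, rule_format]
  show o: "osculating_poly n u s = \<phi>" by (rule osculating_poly_touches[OF u T])
  define C where "C = {t. \<phi> t = u t}"
  have s: "s \<in> C" using T touches_add_value unfolding C_def by auto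
  have per: "t + 2 * pi \<in> C \<longleftrightarrow> t \<in> C" for t
    unfolding C_def using u_periodic trig_polys_periodic[OF touches_trig_poly[OF T]] by simp
  have *: "\<exists>A. connected A \<and> cis s \<in> A \<and> z \<in> A \<and> A \<subseteq> cis ` C" if z: "z \<in> cis ` C" for z
  proof -
    obtain t where t: "t \<in> C" "z = cis t" using z by blast
    obtain r where r: "r \<in> {s..<s + 2 * pi}" "cis r = cis t" using cis_representative by blast
    have rC: "r \<in> C" using periodic_cis[of "\<lambda>t. t \<in> C" t r] per r(2) t(1) by auto
    have conn: "connected (cis ` {a..b})" for a b
      by (intro connected_continuous_image continuous_intros) simp
    consider "r = s" | "{s..r} \<subseteq> C" "s < r" | "{r..s + 2 * pi} \<subseteq> C" "r < s + 2 * pi"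
      using arcs[of r] rC r(1) unfolding C_def by fastforce
    then show ?thesis
    proof cases
      case 1
      then show ?thesis using r t s by (intro exI[of _ "{cis s}"]) auto
    next
      case 2
      have "cis s \<in> cis ` {s..r}" "z \<in> cis ` {s..r}" using 2(2) r(2) t(2) by (auto intro: image_eqI[of _ _ r])
      then show ?thesis using 2(1) conn by (intro exI[of _ "cis ` {s..r}"]) blast
    next
      case 3
      have "cis s \<in> cis ` {r..s + 2 * pi}" "z \<in> cis ` {r..s + 2 * pi}"
        using 3(2) r(2) t(2) by (auto intro: image_eqI[of _ _ r] image_eqI[of _ _ "s + 2 * pi"])
      then show ?thesis using 3(1) conn by (intro exI[of _ "cis ` {r..s + 2 * pi}"]) blast
    qed
  qed
  have "connected_component (cis ` C) (cis s) z" if "z \<in> cis ` C" for z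
    unfolding connected_component_def using *[OF that] by blast
  then have "connected (cis ` C)"
    by (subst connected_iff_connected_component)
      (blast intro: connected_component_sym connected_component_trans)
  moreover have "circle_contact_set n u s = cis ` C" unfolding circle_contact_set_def o C_def by simp
  ultimately show "clean_maximal_flex n u s" unfolding clean_maximal_flex_def o using touches_above[OF T] by simp
qed

text \<open>
  The touching polynomials are kept in the conclusion because, applied to \<open>- u\<close>, it has to identify the
  osculating polynomials of \<open>u\<close>.
\<close>

lemma clean_maximal_flexes:
  assumes u: "periodic_2pi u" "cont_diff (2 * n) u" and n: "n \<ge> 1"
  shows "\<exists>S. S \<subseteq> {s \<in> {0..<2 * pi}. clean_maximal_flex n u s \<and> (\<exists>\<phi>. touches n u \<phi> (replicate_mset (Suc n) s))} \<and> finite S \<and> card S = n + 1"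
proof -
  interpret circle_function n u using u by unfold_locales
  have cm: "clean_maximal_flex n u s' \<and> T \<phi> (replicate_mset (Suc n) s')" if c: "clean {#} \<phi> s" "cis s = cis s'" for \<phi> s s'
  proof -
    have C: "T \<phi> {#r#} \<longleftrightarrow> T \<phi> {#r'#}" if "cis r = cis r'" for r r'
      using touches_cis[OF that, of \<phi> "{#}"] touches_cis[OF that[symmetric], of \<phi> "{#}"] by blast
    obtain j :: int where j: "s' = s + 2 * pi * of_int j" using c(2) cis_eq_iff by blast
    have sh: "T \<phi> {#r - 2 * pi * of_int j#} \<longleftrightarrow> T \<phi> {#r#}" for r
      by (rule C) (auto simp: cis_eq_iff)
    have "clean {#} \<phi> s'" unfolding clean_def
    proof (intro conjI allI impI)
      show "T \<phi> ({#} + replicate_mset (Suc n - size ({#} :: real multiset)) s')"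
        by (rule touches_replicate_cis[OF c(2) c(1)[unfolded clean_def, THEN conjunct1]])
      fix r assume r: "s' < r" "r < s' + 2 * pi" "T \<phi> {#r#}"
      let ?r = "r - 2 * pi * of_int j"
      have "(\<forall>t\<in>{s..?r}. T \<phi> {#t#}) \<or> (\<forall>t\<in>{?r..s + 2 * pi}. T \<phi> {#t#})"
        using c(1) r sh[of r] unfolding clean_def j by auto
      then show "(\<forall>t\<in>{s'..r}. T \<phi> {#t#}) \<or> (\<forall>t\<in>{r..s' + 2 * pi}. T \<phi> {#t#})"
      proof
        assume a: "\<forall>t\<in>{s..?r}. T \<phi> {#t#}"
        have "T \<phi> {#t#}" if "t \<in> {s'..r}" for t using a sh[of t] that j by auto
        then show ?thesis by blast
      next
        assume a: "\<forall>t\<in>{?r..s + 2 * pi}. T \<phi> {#t#}"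
        have "T \<phi> {#t#}" if "t \<in> {r..s' + 2 * pi}" for t using a sh[of t] that j by auto
        then show ?thesis by blast
      qed
    qed
    then show ?thesis using clean_maximal_flex_of_clean[OF u] by (simp add: clean_def)
  qed
  show ?thesis
  proof (cases "u \<in> trig_polys n")
    case True
    have Tu: "T u X" for X unfolding touches_def vanish_order_def using True by simp
    have "clean_maximal_flex n u s" for s
      by (rule cm[THEN conjunct1, of u s]) (simp_all add: clean_def Tu)
    then have "{0..<2 * pi} \<subseteq> {s \<in> {0..<2 * pi}. clean_maximal_flex n u s \<and> (\<exists>\<phi>. T \<phi> (replicate_mset (Suc n) s))}"
      using Tu by blast
    moreover have "infinite {0..<2 * pi}" by (rule infinite_Ico) simp
    ultimately show ?thesis using infinite_arbitrarily_large[of "{0..<2 * pi}" "n + 1"] by (meson order_trans)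
  next
    case False
    obtain \<Phi> where \<Phi>: "finite \<Phi>" "card \<Phi> \<ge> Suc n" "\<And>\<phi>. \<phi> \<in> \<Phi> \<Longrightarrow> \<exists>s. clean {#} \<phi> s"
    proof -
      have "size ({#} :: real multiset) + n = n" by simp
      from clean_flexes[OF False this] show thesis using that n by blast
    qed
    have "\<exists>s. s \<in> {0..<2 * pi} \<and> clean_maximal_flex n u s \<and> T \<phi> (replicate_mset (Suc n) s)" if \<phi>: "\<phi> \<in> \<Phi>" for \<phi>
    proof -
      obtain s0 where s0: "clean {#} \<phi> s0" using \<Phi>(3)[OF \<phi>] by blast
      obtain s where "s \<in> {0..<0 + 2 * pi}" "cis s = cis s0" using cis_representative by blast
      then show ?thesis using cm[OF s0, of s] by auto
    qed
    then obtain s where s: "\<And>\<phi>. \<phi> \<in> \<Phi> \<Longrightarrow> s \<phi> \<in> {0..<2 * pi} \<and> clean_maximal_flex n u (s \<phi>) \<and> T \<phi> (replicate_mset (Suc n) (s \<phi>))"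
      by metis
    then have "inj_on s \<Phi>" using osculating_poly_touches[OF u] by (intro inj_onI) metis
    then have "card (s ` \<Phi>) \<ge> n + 1" using \<Phi>(2) by (simp add: card_image)
    then obtain S where S: "S \<subseteq> s ` \<Phi>" "card S = n + 1" "finite S"
      using obtain_subset_with_card_n by blast
    have "s ` \<Phi> \<subseteq> {s \<in> {0..<2 * pi}. clean_maximal_flex n u s \<and> (\<exists>\<phi>. T \<phi> (replicate_mset (Suc n) s))}"
    proof (rule image_subsetI)
      fix \<phi> assume "\<phi> \<in> \<Phi>"
      from s[OF this] show "s \<phi> \<in> {s \<in> {0..<2 * pi}. clean_maximal_flex n u s \<and> (\<exists>\<phi>. T \<phi> (replicate_mset (Suc n) s))}"
        by (intro CollectI conjI exI[of _ \<phi>]) (elim conjE; assumption)+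
    qed
    with S show ?thesis by (intro exI[of _ S] conjI) (rule order_trans)
  qed
qed

lemma deriv_pow_uminus:
  assumes "cont_diff k f" "j \<le> k"
  shows "(deriv ^^ j) (\<lambda>t. - f t) = (\<lambda>t. - (deriv ^^ j) f t)"
proof -
  have "(deriv ^^ j) (\<lambda>t. 0) = (\<lambda>t::real. 0::real)" by (induction j) simp_all
  then show ?thesis
    using deriv_pow_diff[OF trig_polys_cont_diff[OF trig_polys_const[of 0 0]] assms] by simp
qed

lemma clean_minimal_flex_of_uminus:
  assumes u: "periodic_2pi u" "cont_diff (2 * n) u"
    and T: "touches n (\<lambda>t. - u t) \<phi> (replicate_mset (Suc n) s)"
    and c: "clean_maximal_flex n (\<lambda>t. - u t) s"
  shows "clean_minimal_flex n u s"
proof -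
  have mu: "periodic_2pi (\<lambda>t. - u t)" "cont_diff (2 * n) (\<lambda>t. - u t)"
    using u(1) cont_diff_diff[OF trig_polys_cont_diff[OF trig_polys_const[of 0 0]] u(2)]
    by (auto simp: periodic_2pi_def)
  interpret M: circle_function n "\<lambda>t. - u t" using mu by unfold_locales
  have \<phi>: "\<phi> \<in> trig_polys n" using M.touches_trig_poly[OF T] .
  have \<phi>': "(\<lambda>t. - \<phi> t) \<in> trig_polys n" using trig_polys_scale[OF \<phi>, of "-1"] by simp
  have o: "osculating_poly n (\<lambda>t. - u t) s = \<phi>" by (rule osculating_poly_touches[OF mu T])
  have o': "osculating_poly n u s = (\<lambda>t. - \<phi> t)"
  proof (rule osculating_poly_eqI[OF \<phi>'])
    fix j assume j: "j \<le> 2 * n"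
    have "(deriv ^^ j) (\<lambda>t. - \<phi> t) s = - (deriv ^^ j) \<phi> s"
      using fun_cong[OF deriv_pow_uminus[OF trig_polys_cont_diff[OF \<phi>] j]] .
    also have "\<dots> = - (deriv ^^ j) (\<lambda>t. - u t) s" using M.touches_deriv_eq[OF T j] by simp
    also have "\<dots> = (deriv ^^ j) u s" using fun_cong[OF deriv_pow_uminus[OF u(2) j]] by simp
    finally show "(deriv ^^ j) (\<lambda>t. - \<phi> t) s = (deriv ^^ j) u s" .
  qed
  have "- \<phi> t - u t = 0 \<longleftrightarrow> \<phi> t - - u t = 0" for t by auto
  then have "circle_contact_set n u s = circle_contact_set n (\<lambda>t. - u t) s"
    unfolding circle_contact_set_def o o' by presburger
  moreover have "- \<phi> t \<le> u t" for t using M.touches_above[OF T, of t] by simp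
  ultimately show ?thesis using c unfolding clean_minimal_flex_def clean_maximal_flex_def o' by simp
qed

theorem theorem1p1:
  fixes n :: nat and u :: "real \<Rightarrow> real"
  assumes "n \<ge> 1"
    and "periodic_2pi u"
    and "cont_diff (2 * n) u"
  shows "(\<exists>S. S \<subseteq> {s \<in> {0..<2 * pi}. clean_maximal_flex n u s} \<and> finite S \<and> card S = n + 1) \<and>
         (\<exists>S. S \<subseteq> {s \<in> {0..<2 * pi}. clean_minimal_flex n u s} \<and> finite S \<and> card S = n + 1)"
proof
  have mu: "periodic_2pi (\<lambda>t. - u t)" "cont_diff (2 * n) (\<lambda>t. - u t)"
    using assms(2) cont_diff_diff[OF trig_polys_cont_diff[OF trig_polys_const[of 0 0]] assms(3)]
    by (auto simp: periodic_2pi_def)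
  obtain S where S: "S \<subseteq> {s \<in> {0..<2 * pi}. clean_maximal_flex n (\<lambda>t. - u t) s \<and>
      (\<exists>\<phi>. touches n (\<lambda>t. - u t) \<phi> (replicate_mset (Suc n) s))}" "finite S" "card S = n + 1"
    using clean_maximal_flexes[OF mu assms(1)] by blast
  have "S \<subseteq> {s \<in> {0..<2 * pi}. clean_minimal_flex n u s}"
    using S(1) clean_minimal_flex_of_uminus[OF assms(2,3)] by blast
  then show "\<exists>S. S \<subseteq> {s \<in> {0..<2 * pi}. clean_minimal_flex n u s} \<and> finite S \<and> card S = n + 1"
    using S by blast
  show "\<exists>S. S \<subseteq> {s \<in> {0..<2 * pi}. clean_maximal_flex n u s} \<and> finite S \<and> card S = n + 1"
    using clean_maximal_flexes[OF assms(2,3,1)] by blast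
qed

end
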